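(* The functors $1_\blacktriangleright\otimes-$ and $[1_\blacktriangleright,-]$ give respectively a reflection and a coreflection of $\mathbf{sMlt}$ in its full subcategory $\mathbf{Seq}$ of sequential multicategories; that is, both take values in $\mathbf{Seq}$, and they are respectively left adjoint and right adjoint to the inclusion $\mathbf{Seq}\to\mathbf{sMlt}$.
   Context: $\mathbf{sMlt}$ is the category of (small) symmetric multicategories and symmetric functors; a permutation $\sigma$ of the domain of an arrow $f$ gives an arrow $\sigma f$. For a category $\mathcal C$, $\mathcal C_\blacktriangleright$ is the symmetric multicategory with the objects of $\mathcal C$ and $\mathcal C_\blacktriangleright(X_1,\dots,X_n;X)=\mathcal C(X_1;X)\times\cdots\times\mathcal C(X_n;X)$, composition $\langle f_1,\dots,f_n\rangle(\langle g_{11},\dots,g_{1m_1}\rangle,\dots,\langle g_{n1},\dots,g_{nm_n}\rangle)=\langle f_1g_{11},\dots,f_1g_{1m_1},\dots,f_ng_{n1},\dots,f_ng_{nm_n}\rangle$, and symmetric structure given by permuting sequences. A symmetric multicategory is sequential if it is isomorphic to some $\mathcal C_\blacktriangleright$. $1$ is the terminal category, so $1_\blacktriangleright$ is the terminal symmetric multicategory. $\otimes$ is the Boardman–Vogt tensor product. The objects of $\mathcal M\otimes\mathcal N$ are pairs $\langle A,X\rangle$; its arrows are generated by $f_X:\langle A_1,X\rangle,\dots,\langle A_n,X\rangle\to\langle A,X\rangle$ for $f:A_1,\dots,A_n\to A$ in $\mathcal M$ and $h_A:\langle A,X_1\rangle,\dots,\langle A,X_m\rangle\to\langle A,X\rangle$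 for $h:X_1,\dots,X_m\to X$ in $\mathcal N$, subject to the relations making $(-)_X:\mathcal M\to\mathcal M\otimes\mathcal N$ and $(-)_A:\mathcal N\to\mathcal M\otimes\mathcal N$ symmetric functors and to $f_X(h_{A_1},\dots,h_{A_n})=\sigma\,h_A(f_{X_1},\dots,f_{X_m})$, with $\sigma$ the evident permutation matching the domains. The associated internal hom $[\mathcal M,\mathcal N]$ has as objects the symmetric functors $\mathcal M\to\mathcal N$; an arrow $\alpha:F_1,\dots,F_n\to F$ is a family of arrows $\alpha_A:F_1A,\dots,F_nA\to FA$ ($A\in\mathcal M$) such that $Ff(\alpha_{A_1},\dots,\alpha_{A_m})=\sigma\,\alpha_A(F_1f,\dots,F_nf)$ for every $f:A_1,\dots,A_m\to A$ in $\mathcal M$, with $\sigma$ the evident permutation; composition and symmetric structure are pointwise. *)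

theory Defs
  imports "HOL-Library.FuncSet" "HOL-Combinatorics.Permutations"
begin

section \<open>Permutations of concatenated lists\<close>

text \<open>
  A permutation of a list of length \<open>n\<close> is a function permuting \<open>{..<n}\<close>; it acts on lists by
  \<^const>\<open>permute_list\<close>, so entry \<open>i\<close> of the new list is entry \<open>\<sigma> i\<close> of the old one.  Under this
  convention the action is on the right: \<open>permute_list (\<tau> \<circ> \<sigma>) = permute_list \<sigma> \<circ> permute_list \<tau>\<close>.
\<close>

definition perm_of_list :: "nat list \<Rightarrow> nat \<Rightarrow> nat"
  where "perm_of_list is i = (if i < length is then is ! i else i)"

text \<open>The positions \<open>0, 1, 2, \<dots>\<close> cut into consecutive blocks of the given lengths.\<close>

definition blocks :: "nat list \<Rightarrow> nat list list"
  where "blocks ks = map (\<lambda>i. [sum_list (take i ks)..<sum_list (take (Suc i) ks)]) [0..<length ks]"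

text \<open>\<open>\<sigma>\<close> permutes the blocks among themselves; respectively \<open>\<sigma>s ! i\<close> permutes within block \<open>i\<close>.\<close>

definition block_perm :: "(nat \<Rightarrow> nat) \<Rightarrow> nat list \<Rightarrow> nat \<Rightarrow> nat"
  where "block_perm \<sigma> ks = perm_of_list (concat (permute_list \<sigma> (blocks ks)))"

definition sum_perm :: "(nat \<Rightarrow> nat) list \<Rightarrow> nat list \<Rightarrow> nat \<Rightarrow> nat"
  where "sum_perm \<sigma>s ks = perm_of_list (concat (map2 permute_list \<sigma>s (blocks ks)))"

text \<open>
  A list of \<open>p\<close> consecutive blocks of length \<open>q\<close> is obtained from the list of \<open>q\<close> consecutive blocks
  of length \<open>p\<close> with the transposed entries: entry \<open>i * q + j\<close> of the former is entry \<open>j * p + i\<close>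
  of the latter.
\<close>

definition transpose_perm :: "nat \<Rightarrow> nat \<Rightarrow> nat \<Rightarrow> nat"
  where "transpose_perm p q k = (if k < p * q then (k mod q) * p + k div q else k)"


section \<open>Symmetric multicategories\<close>

record ('o, 'a) smulticat =
  Obj :: "'o set"
  Arr :: "'a set"
  Dom :: "'a \<Rightarrow> 'o list"
  Cod :: "'a \<Rightarrow> 'o"
  Idt :: "'o \<Rightarrow> 'a"
  Comp :: "'a \<Rightarrow> 'a list \<Rightarrow> 'a"
  Act :: "(nat \<Rightarrow> nat) \<Rightarrow> 'a \<Rightarrow> 'a"

locale symm_multicat =
  fixes M :: "('o, 'a) smulticat"
  assumes Dom_Obj: "f \<in> Arr M \<Longrightarrow> set (Dom M f) \<subseteq> Obj M"
    and Cod_Obj: "f \<in> Arr M \<Longrightarrow> Cod M f \<in> Obj M"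
    and Idt_type: "A \<in> Obj M \<Longrightarrow> Idt M A \<in> Arr M \<and> Dom M (Idt M A) = [A] \<and> Cod M (Idt M A) = A"
    and Comp_type: "\<lbrakk>f \<in> Arr M; set gs \<subseteq> Arr M; map (Cod M) gs = Dom M f\<rbrakk> \<Longrightarrow>
      Comp M f gs \<in> Arr M \<and> Dom M (Comp M f gs) = concat (map (Dom M) gs) \<and>
      Cod M (Comp M f gs) = Cod M f"
    and Act_type: "\<lbrakk>f \<in> Arr M; \<sigma> permutes {..<length (Dom M f)}\<rbrakk> \<Longrightarrow>
      Act M \<sigma> f \<in> Arr M \<and> Dom M (Act M \<sigma> f) = permute_list \<sigma> (Dom M f) \<and>
      Cod M (Act M \<sigma> f) = Cod M f"
    and Comp_Idt: "f \<in> Arr M \<Longrightarrow> Comp M f (map (Idt M) (Dom M f)) = f"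
    and Idt_Comp: "f \<in> Arr M \<Longrightarrow> Comp M (Idt M (Cod M f)) [f] = f"
    and Comp_assoc: "\<lbrakk>f \<in> Arr M; set gs \<subseteq> Arr M; map (Cod M) gs = Dom M f;
      length hss = length gs; \<forall>hs\<in>set hss. set hs \<subseteq> Arr M;
      map (map (Cod M)) hss = map (Dom M) gs\<rbrakk> \<Longrightarrow>
      Comp M f (map2 (Comp M) gs hss) = Comp M (Comp M f gs) (concat hss)"
    and Act_id: "f \<in> Arr M \<Longrightarrow> Act M id f = f"
    and Act_Act: "\<lbrakk>f \<in> Arr M; \<sigma> permutes {..<length (Dom M f)};
      \<tau> permutes {..<length (Dom M f)}\<rbrakk> \<Longrightarrow> Act M \<sigma> (Act M \<tau> f) = Act M (\<tau> \<circ> \<sigma>) f"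
    and Comp_Act_outer: "\<lbrakk>f \<in> Arr M; set gs \<subseteq> Arr M; map (Cod M) gs = Dom M f;
      \<sigma> permutes {..<length (Dom M f)}\<rbrakk> \<Longrightarrow>
      Comp M (Act M \<sigma> f) (permute_list \<sigma> gs) =
        Act M (block_perm \<sigma> (map (\<lambda>g. length (Dom M g)) gs)) (Comp M f gs)"
    and Comp_Act_inner: "\<lbrakk>f \<in> Arr M; set gs \<subseteq> Arr M; map (Cod M) gs = Dom M f;
      list_all2 (\<lambda>\<sigma> g. \<sigma> permutes {..<length (Dom M g)}) \<sigma>s gs\<rbrakk> \<Longrightarrow>
      Comp M f (map2 (Act M) \<sigma>s gs) =
        Act M (sum_perm \<sigma>s (map (\<lambda>g. length (Dom M g)) gs)) (Comp M f gs)"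

text \<open>
  Functors are pairs of an object map and an arrow map; both are required to be \<^const>\<open>undefined\<close>
  outside the carriers, so that equality of pairs is equality of functors.
\<close>

type_synonym ('o, 'a, 'p, 'b) sfun = "('o \<Rightarrow> 'p) \<times> ('a \<Rightarrow> 'b)"

definition sfunctors ::
    "('o, 'a) smulticat \<Rightarrow> ('p, 'b) smulticat \<Rightarrow> ('o, 'a, 'p, 'b) sfun set"
  where "sfunctors M N = {F.
    fst F \<in> Obj M \<rightarrow>\<^sub>E Obj N \<and> snd F \<in> Arr M \<rightarrow>\<^sub>E Arr N \<and>
    (\<forall>f\<in>Arr M. Dom N (snd F f) = map (fst F) (Dom M f) \<and> Cod N (snd F f) = fst F (Cod M f)) \<and>
    (\<forall>A\<in>Obj M. snd F (Idt M A) = Idt N (fst F A)) \<and>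
    (\<forall>f\<in>Arr M. \<forall>gs. set gs \<subseteq> Arr M \<longrightarrow> map (Cod M) gs = Dom M f \<longrightarrow>
      snd F (Comp M f gs) = Comp N (snd F f) (map (snd F) gs)) \<and>
    (\<forall>f\<in>Arr M. \<forall>\<sigma>. \<sigma> permutes {..<length (Dom M f)} \<longrightarrow>
      snd F (Act M \<sigma> f) = Act N \<sigma> (snd F f))}"

definition sfun_id :: "('o, 'a) smulticat \<Rightarrow> ('o, 'a, 'o, 'a) sfun"
  where "sfun_id M = (\<lambda>A\<in>Obj M. A, \<lambda>f\<in>Arr M. f)"

definition sfun_comp :: "('o, 'a) smulticat \<Rightarrow> ('p, 'b, 'q, 'c) sfun \<Rightarrow> ('o, 'a, 'p, 'b) sfun
    \<Rightarrow> ('o, 'a, 'q, 'c) sfun"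
  where "sfun_comp M G F = (compose (Obj M) (fst G) (fst F), compose (Arr M) (snd G) (snd F))"

definition smulticat_iso :: "('o, 'a) smulticat \<Rightarrow> ('p, 'b) smulticat \<Rightarrow> bool"
  where "smulticat_iso M N \<longleftrightarrow> (\<exists>F\<in>sfunctors M N. \<exists>G\<in>sfunctors N M.
    sfun_comp M G F = sfun_id M \<and> sfun_comp N F G = sfun_id N)"


section \<open>Categories and sequential multicategories\<close>

record ('o, 'a) cat =
  CObj :: "'o set"
  CArr :: "'a set"
  CDom :: "'a \<Rightarrow> 'o"
  CCod :: "'a \<Rightarrow> 'o"
  CId :: "'o \<Rightarrow> 'a"
  CComp :: "'a \<Rightarrow> 'a \<Rightarrow> 'a"

locale category =
  fixes C :: "('o, 'a) cat"
  assumes CDom_CObj: "f \<in> CArr C \<Longrightarrow> CDom C f \<in> CObj C"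
    and CCod_CObj: "f \<in> CArr C \<Longrightarrow> CCod C f \<in> CObj C"
    and CId_type: "X \<in> CObj C \<Longrightarrow> CId C X \<in> CArr C \<and> CDom C (CId C X) = X \<and> CCod C (CId C X) = X"
    and CComp_type: "\<lbrakk>f \<in> CArr C; g \<in> CArr C; CCod C g = CDom C f\<rbrakk> \<Longrightarrow>
      CComp C f g \<in> CArr C \<and> CDom C (CComp C f g) = CDom C g \<and> CCod C (CComp C f g) = CCod C f"
    and CComp_CId: "f \<in> CArr C \<Longrightarrow> CComp C f (CId C (CDom C f)) = f"
    and CId_CComp: "f \<in> CArr C \<Longrightarrow> CComp C (CId C (CCod C f)) f = f"
    and CComp_assoc: "\<lbrakk>f \<in> CArr C; g \<in> CArr C; h \<in> CArr C; CCod C g = CDom C f;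
      CCod C h = CDom C g\<rbrakk> \<Longrightarrow> CComp C (CComp C f g) h = CComp C f (CComp C g h)"

text \<open>
  The multicategory of sequences \<open>C\<^sub>\<triangleright>\<close>.  An arrow carries its codomain explicitly, since the empty
  sequence is an arrow into every object.
\<close>

definition seq_of :: "('o, 'a) cat \<Rightarrow> ('o, 'a list \<times> 'o) smulticat"
  where "seq_of C = \<lparr>
    Obj = CObj C,
    Arr = {(fs, X). X \<in> CObj C \<and> set fs \<subseteq> CArr C \<and> (\<forall>f\<in>set fs. CCod C f = X)},
    Dom = (\<lambda>(fs, X). map (CDom C) fs),
    Cod = snd,
    Idt = (\<lambda>X. ([CId C X], X)),
    Comp = (\<lambda>(fs, X) gs. (concat (map2 (\<lambda>f g. map (CComp C f) (fst g)) fs gs), X)),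
    Act = (\<lambda>\<sigma> (fs, X). (permute_list \<sigma> fs, X))\<rparr>"

text \<open>
  A category \<open>C\<close> with \<open>M \<cong> C\<^sub>\<triangleright>\<close> has its objects in bijection with those of \<open>M\<close> and its arrows in
  bijection with the unary arrows of \<open>M\<close>, so taking it over the types of \<open>M\<close> is no restriction.
\<close>

definition sequential :: "('o, 'a) smulticat \<Rightarrow> bool"
  where "sequential M \<longleftrightarrow> symm_multicat M \<and>
    (\<exists>C :: ('o, 'a) cat. category C \<and> smulticat_iso M (seq_of C))"

definition terminal_cat :: "(unit, unit) cat"
  where "terminal_cat = \<lparr>CObj = {()}, CArr = {()}, CDom = (\<lambda>_. ()), CCod = (\<lambda>_. ()),
    CId = (\<lambda>_. ()), CComp = (\<lambda>_ _. ())\<rparr>"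

definition one_seq :: "(unit, unit list \<times> unit) smulticat"
  where "one_seq = seq_of terminal_cat"


section \<open>Symmetric multicategories given by generators and relations\<close>

datatype ('x, 'g) mterm =
    TGen 'g
  | TIdt 'x
  | TComp "('x, 'g) mterm" "('x, 'g) mterm list"
  | TAct "nat \<Rightarrow> nat" "('x, 'g) mterm"

record ('x, 'g) presentation =
  PObj :: "'x set"
  PGen :: "'g set"
  PDom :: "'g \<Rightarrow> 'x list"
  PCod :: "'g \<Rightarrow> 'x"
  PRel :: "(('x, 'g) mterm \<times> ('x, 'g) mterm) set"

primrec tdom :: "('x, 'g) presentation \<Rightarrow> ('x, 'g) mterm \<Rightarrow> 'x list" where
  "tdom P (TGen g) = PDom P g"
| "tdom P (TIdt x) = [x]"
| "tdom P (TComp t ts) = concat (map (tdom P) ts)"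
| "tdom P (TAct \<sigma> t) = permute_list \<sigma> (tdom P t)"

primrec tcod :: "('x, 'g) presentation \<Rightarrow> ('x, 'g) mterm \<Rightarrow> 'x" where
  "tcod P (TGen g) = PCod P g"
| "tcod P (TIdt x) = x"
| "tcod P (TComp t ts) = tcod P t"
| "tcod P (TAct \<sigma> t) = tcod P t"

primrec twf :: "('x, 'g) presentation \<Rightarrow> ('x, 'g) mterm \<Rightarrow> bool" where
  "twf P (TGen g) \<longleftrightarrow> g \<in> PGen P"
| "twf P (TIdt x) \<longleftrightarrow> x \<in> PObj P"
| "twf P (TComp t ts) \<longleftrightarrow> twf P t \<and> list_all (twf P) ts \<and> map (tcod P) ts = tdom P t"
| "twf P (TAct \<sigma> t) \<longleftrightarrow> twf P t \<and> \<sigma> permutes {..<length (tdom P t)}"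

text \<open>
  The least congruence on well-formed terms that contains the given relations and makes the terms
  into a symmetric multicategory.
\<close>

inductive tcong :: "('x, 'g) presentation \<Rightarrow> ('x, 'g) mterm \<Rightarrow> ('x, 'g) mterm \<Rightarrow> bool"
  for P where
  rel: "(s, t) \<in> PRel P \<Longrightarrow> tcong P s t"
| refl: "twf P t \<Longrightarrow> tcong P t t"
| sym: "tcong P s t \<Longrightarrow> tcong P t s"
| trans: "tcong P s t \<Longrightarrow> tcong P t u \<Longrightarrow> tcong P s u"
| cong_Comp: "\<lbrakk>twf P (TComp s ss); tcong P s t; list_all2 (tcong P) ss ts\<rbrakk> \<Longrightarrow>
    tcong P (TComp s ss) (TComp t ts)"
| cong_Act: "\<lbrakk>twf P (TAct \<sigma> s); tcong P s t\<rbrakk> \<Longrightarrow> tcong P (TAct \<sigma> s) (TAct \<sigma> t)"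
| Comp_Idt: "twf P t \<Longrightarrow> tcong P (TComp t (map TIdt (tdom P t))) t"
| Idt_Comp: "twf P t \<Longrightarrow> tcong P (TComp (TIdt (tcod P t)) [t]) t"
| Comp_assoc: "\<lbrakk>twf P (TComp s ts); length uss = length ts;
    list_all2 (\<lambda>t us. twf P (TComp t us)) ts uss\<rbrakk> \<Longrightarrow>
    tcong P (TComp s (map2 TComp ts uss)) (TComp (TComp s ts) (concat uss))"
| Act_id: "twf P t \<Longrightarrow> tcong P (TAct id t) t"
| Act_Act: "\<lbrakk>twf P t; \<sigma> permutes {..<length (tdom P t)}; \<tau> permutes {..<length (tdom P t)}\<rbrakk> \<Longrightarrow>
    tcong P (TAct \<sigma> (TAct \<tau> t)) (TAct (\<tau> \<circ> \<sigma>) t)"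
| Comp_Act_outer: "\<lbrakk>twf P (TComp s ts); \<sigma> permutes {..<length (tdom P s)}\<rbrakk> \<Longrightarrow>
    tcong P (TComp (TAct \<sigma> s) (permute_list \<sigma> ts))
      (TAct (block_perm \<sigma> (map (\<lambda>t. length (tdom P t)) ts)) (TComp s ts))"
| Comp_Act_inner: "\<lbrakk>twf P (TComp s ts);
    list_all2 (\<lambda>\<sigma> t. \<sigma> permutes {..<length (tdom P t)}) \<sigma>s ts\<rbrakk> \<Longrightarrow>
    tcong P (TComp s (map2 TAct \<sigma>s ts))
      (TAct (sum_perm \<sigma>s (map (\<lambda>t. length (tdom P t)) ts)) (TComp s ts))"

definition tclass :: "('x, 'g) presentation \<Rightarrow> ('x, 'g) mterm \<Rightarrow> ('x, 'g) mterm set"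
  where "tclass P t = {s. tcong P t s}"

definition trep :: "('x, 'g) mterm set \<Rightarrow> ('x, 'g) mterm"
  where "trep c = (SOME t. t \<in> c)"

definition presented :: "('x, 'g) presentation \<Rightarrow> ('x, ('x, 'g) mterm set) smulticat"
  where "presented P = \<lparr>
    Obj = PObj P,
    Arr = tclass P ` {t. twf P t},
    Dom = (\<lambda>c. tdom P (trep c)),
    Cod = (\<lambda>c. tcod P (trep c)),
    Idt = (\<lambda>x. tclass P (TIdt x)),
    Comp = (\<lambda>c cs. tclass P (TComp (trep c) (map trep cs))),
    Act = (\<lambda>\<sigma> c. tclass P (TAct \<sigma> (trep c)))\<rparr>"


section \<open>The Boardman--Vogt tensor product\<close>

text \<open>\<open>Inl (f, X)\<close> is the generator \<open>f\<^sub>X\<close> and \<open>Inr (A, h)\<close> is the generator \<open>h\<^sub>A\<close>.\<close>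

type_synonym ('o, 'a, 'p, 'b) tensor_gen = "('a \<times> 'p) + ('o \<times> 'b)"
type_synonym ('o, 'a, 'p, 'b) tensor_term = "('o \<times> 'p, ('o, 'a, 'p, 'b) tensor_gen) mterm"

abbreviation lgen :: "'a \<Rightarrow> 'p \<Rightarrow> ('o, 'a, 'p, 'b) tensor_term"
  where "lgen f X \<equiv> TGen (Inl (f, X))"

abbreviation rgen :: "'o \<Rightarrow> 'b \<Rightarrow> ('o, 'a, 'p, 'b) tensor_term"
  where "rgen A h \<equiv> TGen (Inr (A, h))"

inductive_set tensor_rel :: "('o, 'a) smulticat \<Rightarrow> ('p, 'b) smulticat \<Rightarrow>
    (('o, 'a, 'p, 'b) tensor_term \<times> ('o, 'a, 'p, 'b) tensor_term) set"
  for M :: "('o, 'a) smulticat" and N :: "('p, 'b) smulticat" where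
  lgen_Idt: "\<lbrakk>A \<in> Obj M; X \<in> Obj N\<rbrakk> \<Longrightarrow> (lgen (Idt M A) X, TIdt (A, X)) \<in> tensor_rel M N"
| lgen_Comp: "\<lbrakk>f \<in> Arr M; set gs \<subseteq> Arr M; map (Cod M) gs = Dom M f; X \<in> Obj N\<rbrakk> \<Longrightarrow>
    (lgen (Comp M f gs) X, TComp (lgen f X) (map (\<lambda>g. lgen g X) gs)) \<in> tensor_rel M N"
| lgen_Act: "\<lbrakk>f \<in> Arr M; \<sigma> permutes {..<length (Dom M f)}; X \<in> Obj N\<rbrakk> \<Longrightarrow>
    (lgen (Act M \<sigma> f) X, TAct \<sigma> (lgen f X)) \<in> tensor_rel M N"
| rgen_Idt: "\<lbrakk>A \<in> Obj M; X \<in> Obj N\<rbrakk> \<Longrightarrow> (rgen A (Idt N X), TIdt (A, X)) \<in> tensor_rel M N"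
| rgen_Comp: "\<lbrakk>A \<in> Obj M; h \<in> Arr N; set ks \<subseteq> Arr N; map (Cod N) ks = Dom N h\<rbrakk> \<Longrightarrow>
    (rgen A (Comp N h ks), TComp (rgen A h) (map (rgen A) ks)) \<in> tensor_rel M N"
| rgen_Act: "\<lbrakk>A \<in> Obj M; h \<in> Arr N; \<sigma> permutes {..<length (Dom N h)}\<rbrakk> \<Longrightarrow>
    (rgen A (Act N \<sigma> h), TAct \<sigma> (rgen A h)) \<in> tensor_rel M N"
| interchange: "\<lbrakk>f \<in> Arr M; h \<in> Arr N\<rbrakk> \<Longrightarrow>
    (TComp (lgen f (Cod N h)) (map (\<lambda>A. rgen A h) (Dom M f)),
     TAct (transpose_perm (length (Dom M f)) (length (Dom N h)))
       (TComp (rgen (Cod M f) h) (map (\<lambda>X. lgen f X) (Dom N h)))) \<in> tensor_rel M N"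

definition tensor_presentation :: "('o, 'a) smulticat \<Rightarrow> ('p, 'b) smulticat \<Rightarrow>
    ('o \<times> 'p, ('o, 'a, 'p, 'b) tensor_gen) presentation"
  where "tensor_presentation M N = \<lparr>
    PObj = Obj M \<times> Obj N,
    PGen = (Arr M \<times> Obj N) <+> (Obj M \<times> Arr N),
    PDom = case_sum (\<lambda>(f, X). map (\<lambda>A. (A, X)) (Dom M f)) (\<lambda>(A, h). map (\<lambda>X. (A, X)) (Dom N h)),
    PCod = case_sum (\<lambda>(f, X). (Cod M f, X)) (\<lambda>(A, h). (A, Cod N h)),
    PRel = tensor_rel M N\<rparr>"

definition tensor :: "('o, 'a) smulticat \<Rightarrow> ('p, 'b) smulticat \<Rightarrow>
    ('o \<times> 'p, ('o, 'a, 'p, 'b) tensor_term set) smulticat"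
  where "tensor M N = presented (tensor_presentation M N)"

text \<open>The functor \<open>F \<otimes> G : M \<otimes> N \<rightarrow> M' \<otimes> N'\<close>, sending \<open>f\<^sub>X\<close> to \<open>(F f)\<^bsub>G X\<^esub>\<close> and \<open>h\<^sub>A\<close> to \<open>(G h)\<^bsub>F A\<^esub>\<close>.\<close>

definition tensor_map ::
    "('o, 'a) smulticat \<Rightarrow> ('p, 'b) smulticat \<Rightarrow> ('o1, 'a1) smulticat \<Rightarrow> ('p1, 'b1) smulticat \<Rightarrow>
     ('o, 'a, 'o1, 'a1) sfun \<Rightarrow> ('p, 'b, 'p1, 'b1) sfun \<Rightarrow>
     ('o \<times> 'p, ('o, 'a, 'p, 'b) tensor_term set,
      'o1 \<times> 'p1, ('o1, 'a1, 'p1, 'b1) tensor_term set) sfun"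
  where "tensor_map M N M' N' F G =
    (\<lambda>x\<in>Obj (tensor M N). map_prod (fst F) (fst G) x,
     \<lambda>c\<in>Arr (tensor M N). tclass (tensor_presentation M' N')
       (map_mterm (map_prod (fst F) (fst G))
         (map_sum (map_prod (snd F) (fst G)) (map_prod (fst F) (snd G))) (trep c)))"

text \<open>The functor \<open>(-)\<^sub>A : N \<rightarrow> M \<otimes> N\<close>.\<close>

definition tensor_in :: "('o, 'a) smulticat \<Rightarrow> ('p, 'b) smulticat \<Rightarrow> 'o \<Rightarrow>
    ('p, 'b, 'o \<times> 'p, ('o, 'a, 'p, 'b) tensor_term set) sfun"
  where "tensor_in M N A =
    (\<lambda>X\<in>Obj N. (A, X), \<lambda>h\<in>Arr N. tclass (tensor_presentation M N) (rgen A h))"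


section \<open>The internal hom\<close>

text \<open>An arrow \<open>\<alpha> : F\<^sub>1, \<dots>, F\<^sub>n \<rightarrow> F\<close> is the triple of its domain, its family of components and \<open>F\<close>.\<close>

type_synonym ('o, 'a, 'p, 'b) strans =
  "('o, 'a, 'p, 'b) sfun list \<times> ('o \<Rightarrow> 'b) \<times> ('o, 'a, 'p, 'b) sfun"

definition stransformations ::
    "('o, 'a) smulticat \<Rightarrow> ('p, 'b) smulticat \<Rightarrow> ('o, 'a, 'p, 'b) strans set"
  where "stransformations M N = {(Fs, \<alpha>, F).
    set Fs \<subseteq> sfunctors M N \<and> F \<in> sfunctors M N \<and> \<alpha> \<in> Obj M \<rightarrow>\<^sub>E Arr N \<and>
    (\<forall>A\<in>Obj M. Dom N (\<alpha> A) = map (\<lambda>G. fst G A) Fs \<and> Cod N (\<alpha> A) = fst F A) \<and>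
    (\<forall>f\<in>Arr M. Comp N (snd F f) (map \<alpha> (Dom M f)) =
      Act N (transpose_perm (length (Dom M f)) (length Fs))
        (Comp N (\<alpha> (Cod M f)) (map (\<lambda>G. snd G f) Fs)))}"

definition ihom :: "('o, 'a) smulticat \<Rightarrow> ('p, 'b) smulticat \<Rightarrow>
    (('o, 'a, 'p, 'b) sfun, ('o, 'a, 'p, 'b) strans) smulticat"
  where "ihom M N = \<lparr>
    Obj = sfunctors M N,
    Arr = stransformations M N,
    Dom = (\<lambda>(Fs, \<alpha>, F). Fs),
    Cod = (\<lambda>(Fs, \<alpha>, F). F),
    Idt = (\<lambda>F. ([F], \<lambda>A\<in>Obj M. Idt N (fst F A), F)),
    Comp = (\<lambda>(Fs, \<alpha>, F) \<beta>s. (concat (map fst \<beta>s),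
      \<lambda>A\<in>Obj M. Comp N (\<alpha> A) (map (\<lambda>(Gs, \<beta>, G). \<beta> A) \<beta>s), F)),
    Act = (\<lambda>\<sigma> (Fs, \<alpha>, F). (permute_list \<sigma> Fs, \<lambda>A\<in>Obj M. Act N \<sigma> (\<alpha> A), F))\<rparr>"

text \<open>The functor \<open>[K, F] : [K, M] \<rightarrow> [K, N]\<close> for \<open>F : M \<rightarrow> N\<close>: composition with \<open>F\<close>.\<close>

definition ihom_map :: "('k, 'c) smulticat \<Rightarrow> ('o, 'a) smulticat \<Rightarrow> ('o, 'a, 'p, 'b) sfun \<Rightarrow>
    (('k, 'c, 'o, 'a) sfun, ('k, 'c, 'o, 'a) strans,
     ('k, 'c, 'p, 'b) sfun, ('k, 'c, 'p, 'b) strans) sfun"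
  where "ihom_map K M F =
    (\<lambda>G\<in>Obj (ihom K M). sfun_comp K F G,
     \<lambda>\<alpha>\<in>Arr (ihom K M). case \<alpha> of (Gs, a, G) \<Rightarrow>
       (map (sfun_comp K F) Gs, \<lambda>A\<in>Obj K. snd F (a A), sfun_comp K F G))"

text \<open>Evaluation at the object \<open>A\<close> of \<open>K\<close>, as a functor \<open>[K, M] \<rightarrow> M\<close>.\<close>

definition ihom_eval :: "('k, 'c) smulticat \<Rightarrow> ('o, 'a) smulticat \<Rightarrow> 'k \<Rightarrow>
    (('k, 'c, 'o, 'a) sfun, ('k, 'c, 'o, 'a) strans, 'o, 'a) sfun"
  where "ihom_eval K M A =
    (\<lambda>G\<in>Obj (ihom K M). fst G A, \<lambda>\<alpha>\<in>Arr (ihom K M). case \<alpha> of (Gs, a, G) \<Rightarrow> a A)"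


section \<open>The functors \<open>1\<^sub>\<triangleright> \<otimes> -\<close> and \<open>[1\<^sub>\<triangleright>, -]\<close>\<close>

abbreviation one_tensor where "one_tensor M \<equiv> tensor one_seq M"

abbreviation one_tensor_map
  where "one_tensor_map M N F \<equiv> tensor_map one_seq M one_seq N (sfun_id one_seq) F"

abbreviation one_ihom where "one_ihom M \<equiv> ihom one_seq M"

abbreviation one_ihom_map where "one_ihom_map M F \<equiv> ihom_map one_seq M F"

text \<open>
  The transposes of \<open>H : 1\<^sub>\<triangleright> \<otimes> M \<rightarrow> S\<close> along the unit \<open>(-)\<^sub>* : M \<rightarrow> 1\<^sub>\<triangleright> \<otimes> M\<close> and of
  \<open>K : S \<rightarrow> [1\<^sub>\<triangleright>, M]\<close> along the counit \<open>[1\<^sub>\<triangleright>, M] \<rightarrow> M\<close> (evaluation at \<open>*\<close>), where \<open>*\<close> is the object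
  of \<open>1\<^sub>\<triangleright>\<close>.  They are given explicitly because HOL has no existential quantification over families
  that are indexed by symmetric multicategories over varying types.
\<close>

definition one_tensor_transpose :: "('o, 'a) smulticat \<Rightarrow>
    (unit \<times> 'o, (unit, unit list \<times> unit, 'o, 'a) tensor_term set, 's, 'c) sfun \<Rightarrow>
    ('o, 'a, 's, 'c) sfun"
  where "one_tensor_transpose M H = sfun_comp M H (tensor_in one_seq M ())"

definition one_ihom_transpose :: "('s, 'c) smulticat \<Rightarrow> ('o, 'a) smulticat \<Rightarrow>
    ('s, 'c, (unit, unit list \<times> unit, 'o, 'a) sfun, (unit, unit list \<times> unit, 'o, 'a) strans) sfun \<Rightarrow>
    ('s, 'c, 'o, 'a) sfun"
  where "one_ihom_transpose S M K = sfun_comp S (ihom_eval one_seq M ()) K"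

end

theory Submission
  imports Defs
begin

text \<open>
  A multicategory is sequential exactly when every object carries a commutative monoid structure
  (a functor from \<open>1\<^sub>\<triangleright>\<close>) for which all arrows are monoid homomorphisms.  Given such a structure with
  \<open>n\<close>-fold multiplications \<open>u\<^sub>n\<close>, inserting units into all but one argument of an arrow \<open>h\<close> yields unary
  homomorphisms \<open>h\<^sub>1, \<dots>, h\<^sub>n\<close>, and evaluating the homomorphism law on a diagonal matrix of identities
  and units gives \<open>h = u\<^sub>n(h\<^sub>1, \<dots>, h\<^sub>n)\<close>; so arrows are the same as sequences of unary arrows.
  The same computation shows that homomorphisms between monoids in any multicategory are closed
  under composition and permutation.  Hence \<open>[1\<^sub>\<triangleright>, M]\<close> is a sequential multicategory, and so is
  \<open>1\<^sub>\<triangleright> \<otimes> M\<close>, whose interchange relation says that the generators are homomorphisms.  Both universal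
  properties follow because a sequential multicategory has only one such structure (Eckmann--Hilton),
  which every functor into it therefore preserves.
\<close>

section \<open>Blocks and transpositions\<close>

text \<open>Arrows of \<open>1\<^sub>\<triangleright> \<otimes> M\<close> are classes of terms with
  no normal form at hand, so that all of them are homomorphisms is shown by induction on terms.
  Closure of homomorphisms under composition and permutation must therefore be available before
  every arrow is known to be one; for the internal hom it is also needed between monoids that may
  share an object. A direct proof would have to manipulate transpositions nested inside composites.
  Unary homomorphisms avoid this: for one argument the transposition is the identity, and tuples of
  unary homomorphisms compose as sequences do. To reach the unary components, the law is evaluated
  on matrices of arities 0 and 1. The transposition then moves blocks, possibly empty ones, and is
  recognised as the identity by its effect on distinct labels.\<close>

lemma map2_replicate_left: "length ys = n \<Longrightarrow> map2 h (replicate n x) ys = map (h x) ys"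
  by (rule nth_equalityI) auto

lemma map_eq_replicate: "(\<And>x. x \<in> set xs \<Longrightarrow> f x = c) \<Longrightarrow> length xs = n \<Longrightarrow> map f xs = replicate n c"
  by (auto simp flip: map_replicate_const)

lemma list_all2_concatI: "list_all2 (list_all2 P) xss yss \<Longrightarrow> list_all2 P (concat xss) (concat yss)"
  by (induction rule: list_all2_induct) (auto intro: list_all2_appendI)

lemma concat_concat_eq: "concat (concat xsss) = concat (map concat xsss)"
  by (induction xsss) auto

lemma concat_map_if_eq: "concat (map (\<lambda>l. if l = k then ys else []) [0..<n]) = (if k < n then ys else [])"
  by (induction n) auto

lemma sum_list_map_if_eq: "(\<Sum>l\<leftarrow>[0..<n]. if l = k then m else 0) = (if k < n then m else (0::nat))"
  by (induction n) auto

lemma concat_map_replicate_eq: "concat (map (\<lambda>n. replicate n x) ms) = replicate (sum_list ms) x"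
  by (induction ms) (auto simp: replicate_add)

lemma sum_list_concat_eq: "sum_list (concat xss) = (\<Sum>xs\<leftarrow>xss. sum_list xs)"
  by (induction xss) auto

lemma blocks_Nil [simp]: "blocks [] = []"
  by (simp add: blocks_def)

lemma map_add_upt_atLeast: "map ((+) (k::nat)) [a..<b] = [k + a..<k + b]"
  by (rule nth_equalityI) auto

lemma blocks_Cons: "blocks (k # ks) = [0..<k] # map (map ((+) k)) (blocks ks)"
  by (rule nth_equalityI)
    (auto simp: blocks_def nth_Cons map_add_upt_atLeast add_ac simp del: upt_Suc split: nat.split)

lemma concat_blocks: "concat (blocks ks) = [0..<sum_list ks]"
proof (induction ks)
  case (Cons k ks)
  have "map ((+) k) [0..<sum_list ks] = [k..<k + sum_list ks]"
    by (simp add: map_add_upt_atLeast)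
  then show ?case
    using Cons upt_add_eq_append[of 0 k "sum_list ks"]
    by (simp add: blocks_Cons map_concat[symmetric])
qed simp

lemma length_blocks [simp]: "length (blocks ks) = length ks"
  by (simp add: blocks_def)

text \<open>Blocks of positions are the universal instance: reading the entries of
  \<open>concat xss\<close> at them recovers \<open>xss\<close>. This carries a rearrangement of
  \<open>blocks\<close> over to a rearrangement of arbitrary lists of labels.\<close>

lemma map_nth_blocks: "map (map ((!) (concat xss))) (blocks (map length xss)) = xss"
proof (induction xss)
  case (Cons xs xss)
  have "map ((!) (xs @ concat xss)) [0..<length xs] = xs"
    by (rule nth_equalityI) (auto simp: nth_append)
  moreover have "((!) (xs @ concat xss)) \<circ> ((+) (length xs)) = (!) (concat xss)"
    by (auto simp: nth_append)
  ultimately show ?case using Cons by (simp add: blocks_Cons)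
qed simp

lemma length_nth_blocks: "i < length ks \<Longrightarrow> length (blocks ks ! i) = ks ! i"
  by (simp add: blocks_def take_Suc_conv_app_nth)

section \<open>The action of block permutations on lists of labels\<close>

lemma permutes_perm_of_list:
  assumes "mset is = mset [0..<n]" shows "perm_of_list is permutes {..<n}"
proof -
  have d: "distinct is" "set is = {..<n}" "length is = n"
    using mset_eq_imp_distinct_iff[OF assms] mset_eq_setD[OF assms] mset_eq_length[OF assms]
    by (auto simp: atLeast0LessThan)
  have "bij_betw ((!) is) {..<n} {..<n}" by (rule bij_betw_nth) (use d in auto)
  then have "bij_betw (perm_of_list is) {..<n} {..<n}"
    by (rule iffD1[OF bij_betw_cong, rotated]) (simp add: perm_of_list_def d)
  then show ?thesis
    by (rule bij_imp_permutes) (simp add: perm_of_list_def d)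
qed

lemma permute_list_perm_of_list:
  "length is = length xs \<Longrightarrow> permute_list (perm_of_list is) xs = map ((!) xs) is"
  by (rule nth_equalityI) (auto simp: permute_list_def perm_of_list_def)

lemma mset_concat_permute_list:
  "\<sigma> permutes {..<length xss} \<Longrightarrow> mset (concat (permute_list \<sigma> xss)) = mset (concat xss)"
  by (simp add: mset_concat flip: sum_mset_sum_list)

lemma mset_concat_map2_permute_list:
  "list_all2 (\<lambda>\<sigma> xs. \<sigma> permutes {..<length xs}) \<sigma>s xss \<Longrightarrow>
    mset (concat (map2 permute_list \<sigma>s xss)) = mset (concat xss)"
  by (induction rule: list_all2_induct) auto

lemma permutes_block_perm:
  assumes "\<sigma> permutes {..<length ks}" shows "block_perm \<sigma> ks permutes {..<sum_list ks}"
  unfolding block_perm_def using assms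
  by (intro permutes_perm_of_list) (simp add: mset_concat_permute_list concat_blocks)

text \<open>With \<open>permute_list_sum_perm\<close> this is the interface to the two permutations
  of the multicategory axioms: from here on they are handled through their action on labels.\<close>

lemma permute_list_block_perm:
  assumes "\<sigma> permutes {..<length xss}"
  shows "permute_list (block_perm \<sigma> (map length xss)) (concat xss) = concat (permute_list \<sigma> xss)"
proof -
  let ?bs = "blocks (map length xss)"
  have s: "\<sigma> permutes {..<length ?bs}" using assms by simp
  have "length (concat (permute_list \<sigma> ?bs)) = length (concat xss)"
    using mset_eq_length[OF mset_concat_permute_list[OF s]]
    by (simp add: concat_blocks length_concat)
  then have "permute_list (block_perm \<sigma> (map length xss)) (concat xss) =
      map ((!) (concat xss)) (concat (permute_list \<sigma> ?bs))"
    unfolding block_perm_def by (rule permute_list_perm_of_list)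
  also have "\<dots> = concat (permute_list \<sigma> xss)"
    using permute_list_map[OF s, of "map ((!) (concat xss))"] by (simp add: map_concat map_nth_blocks)
  finally show ?thesis .
qed

lemma list_all2_blocks:
  "list_all2 (\<lambda>\<sigma> k. \<sigma> permutes {..<k}) \<sigma>s ks \<Longrightarrow>
    list_all2 (\<lambda>\<sigma> xs. \<sigma> permutes {..<length xs}) \<sigma>s (blocks ks)"
  by (auto simp: list_all2_conv_all_nth length_nth_blocks)

lemma permutes_sum_perm:
  assumes "list_all2 (\<lambda>\<sigma> k. \<sigma> permutes {..<k}) \<sigma>s ks"
  shows "sum_perm \<sigma>s ks permutes {..<sum_list ks}"
  unfolding sum_perm_def using list_all2_blocks[OF assms]
  by (intro permutes_perm_of_list) (simp add: mset_concat_map2_permute_list concat_blocks)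

lemma permute_list_sum_perm:
  assumes "list_all2 (\<lambda>\<sigma> xs. \<sigma> permutes {..<length xs}) \<sigma>s xss"
  shows "permute_list (sum_perm \<sigma>s (map length xss)) (concat xss) =
    concat (map2 permute_list \<sigma>s xss)"
proof -
  let ?bs = "blocks (map length xss)"
  have s: "list_all2 (\<lambda>\<sigma> xs. \<sigma> permutes {..<length xs}) \<sigma>s ?bs"
    using assms by (intro list_all2_blocks) (simp add: list.rel_map)
  have "length (concat (map2 permute_list \<sigma>s ?bs)) = length (concat xss)"
    using mset_eq_length[OF mset_concat_map2_permute_list[OF s]]
    by (simp add: concat_blocks length_concat)
  then have "permute_list (sum_perm \<sigma>s (map length xss)) (concat xss) =
      map ((!) (concat xss)) (concat (map2 permute_list \<sigma>s ?bs))"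
    unfolding sum_perm_def by (rule permute_list_perm_of_list)
  also have "map (map h) (map2 permute_list \<sigma>s ?bs) = map2 permute_list \<sigma>s (map (map h) ?bs)"
    for h :: "nat \<Rightarrow> 'a"
    using s by (induction rule: list_all2_induct) (auto simp: permute_list_map)
  then have "map ((!) (concat xss)) (concat (map2 permute_list \<sigma>s ?bs)) =
      concat (map2 permute_list \<sigma>s xss)"
    by (simp add: map_concat map_nth_blocks)
  finally show ?thesis .
qed

text \<open>On distinct labels the action is faithful, so an equation between permutations can be
  checked by rearranging one list instead of by arithmetic on positions.\<close>

lemma permutes_eqI:
  assumes "\<sigma> permutes {..<length xs}" "\<tau> permutes {..<length xs}" "distinct xs"
    and "permute_list \<sigma> xs = permute_list \<tau> xs"
  shows "\<sigma> = \<tau>"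
proof
  fix i show "\<sigma> i = \<tau> i"
  proof (cases "i < length xs")
    case True
    then have "xs ! \<sigma> i = xs ! \<tau> i" using assms by (metis permute_list_nth)
    moreover have "\<sigma> i < length xs" "\<tau> i < length xs"
      using True assms(1,2) permutes_in_image by fastforce+
    ultimately show ?thesis using assms(3) nth_eq_iff_index_eq by blast
  next
    case False
    then show ?thesis using assms(1,2) by (metis lessThan_iff permutes_not_in)
  qed
qed

lemma permutes_lessThan_less: "\<sigma> permutes {..<n} \<Longrightarrow> i < n \<Longrightarrow> \<sigma> i < n"
  using permutes_in_image[of \<sigma> "{..<n}" i] by simp

text \<open>Blocks may be empty, so a nontrivial \<open>\<sigma>\<close> can leave the labels in
  place: only the relative order of the nonempty blocks counts. This is how a transposition
  disappears in \<open>ishom_matrix\<close>.\<close>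

lemma block_perm_idI:
  assumes "\<sigma> permutes {..<length xss}" "distinct (concat xss)"
    and "concat (permute_list \<sigma> xss) = concat xss"
  shows "block_perm \<sigma> (map length xss) = id"
proof (rule permutes_eqI)
  show "block_perm \<sigma> (map length xss) permutes {..<length (concat xss)}"
    using permutes_block_perm[of \<sigma> "map length xss"] assms by (simp add: length_concat)
qed (use assms in \<open>auto simp: permute_list_block_perm permutes_id\<close>)

text \<open>Blocks of length one arise when unary arrows are composed into an operation whose
  arguments are permuted, as in \<open>Act_tup\<close>.\<close>

lemma block_perm_replicate_Suc_0:
  assumes "\<sigma> permutes {..<n}" shows "block_perm \<sigma> (replicate n (Suc 0)) = \<sigma>"
proof -
  let ?xss = "map (\<lambda>i. [i]) [0..<n]"
  have l: "map length ?xss = replicate n (Suc 0)" by (rule nth_equalityI) auto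
  have "permute_list (block_perm \<sigma> (map length ?xss)) (concat ?xss) = permute_list \<sigma> [0..<n]"
    using assms by (subst permute_list_block_perm) (simp_all add: permute_list_map)
  moreover have "block_perm \<sigma> (replicate n (Suc 0)) permutes {..<n}"
    using permutes_block_perm[of \<sigma> "replicate n (Suc 0)"] assms by (simp add: sum_list_replicate)
  ultimately show ?thesis
    using assms unfolding l by (intro permutes_eqI[of _ "[0..<n]"]) simp_all
qed

section \<open>Transposition of matrices stored by rows\<close>

lemma concat_map_map_upt:
  "concat (map (\<lambda>i. map (f i) [0..<p]) [0..<q]) = map (\<lambda>k. f (k div p) (k mod p)) [0..<q * p]"
proof (induction q)
  case (Suc q)
  have "map (\<lambda>k. f (k div p) (k mod p)) [q * p..<q * p + p] = map (f q) [0..<p]"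
    by (rule nth_equalityI) (auto simp: div_mult2_eq)
  then show ?case
    using Suc upt_add_eq_append[of 0 "q * p" p] by (simp add: add.commute)
qed simp

lemma transpose_perm_less: "k < p * q \<Longrightarrow> transpose_perm p q k < p * q"
proof -
  assume k: "k < p * q"
  then have "k div q < p" "k mod q < q"
    by (auto simp: less_mult_imp_div_less mult.commute intro: mod_less_divisor) (cases q; simp)
  then have "k mod q * p + k div q < Suc (k mod q) * p" by simp
  also have "\<dots> \<le> q * p" using \<open>k mod q < q\<close> by (intro mult_right_mono) simp_all
  finally show ?thesis using k by (simp add: transpose_perm_def mult.commute)
qed

lemma transpose_perm_inverse: "transpose_perm q p (transpose_perm p q k) = k"
proof (cases "k < p * q")
  case True
  then have "k div q < p" by (simp add: less_mult_imp_div_less)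
  then show ?thesis using True transpose_perm_less[OF True]
    by (auto simp: transpose_perm_def mult.commute)
qed (simp add: transpose_perm_def mult.commute)

lemma permutes_transpose_perm: "transpose_perm p q permutes {..<p * q}"
proof (rule bij_imp_permutes)
  show "bij_betw (transpose_perm p q) {..<p * q} {..<p * q}"
    by (rule bij_betw_byWitness[of _ "transpose_perm q p"])
      (use transpose_perm_less[of _ q p] in
        \<open>auto simp: transpose_perm_inverse transpose_perm_less mult.commute\<close>)
qed (simp add: transpose_perm_def)

text \<open>There are \<open>q\<close> rows of length \<open>p\<close>. Read by columns, position
  \<open>k = j * q + i\<close> holds the entry of row \<open>i\<close> and column \<open>j\<close>,
  which is stored at \<open>i * p + j\<close>; this is \<open>transpose_perm p q k\<close>.\<close>

lemma permute_list_transpose_perm: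
  "permute_list (transpose_perm p q) (concat (map (\<lambda>i. map (f i) [0..<p]) [0..<q])) =
    concat (map (\<lambda>j. map (\<lambda>i. f i j) [0..<q]) [0..<p])"
  unfolding concat_map_map_upt
proof (rule nth_equalityI)
  fix k assume "k < length (permute_list (transpose_perm p q) (map (\<lambda>k. f (k div p) (k mod p)) [0..<q * p]))"
  then have k: "k < p * q" by (simp add: mult.commute)
  then have "k div q < p" by (simp add: less_mult_imp_div_less)
  then show "permute_list (transpose_perm p q) (map (\<lambda>k. f (k div p) (k mod p)) [0..<q * p]) ! k =
      map (\<lambda>k. f (k mod q) (k div q)) [0..<p * q] ! k"
    using k transpose_perm_less[OF k] permutes_transpose_perm[of p q]
    by (subst permute_list_nth) (auto simp: mult.commute transpose_perm_def)
qed (simp add: mult.commute)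

lemma permute_list_transpose_perm_lists:
  assumes "length xs = q" "length ys = p"
  shows "permute_list (transpose_perm p q) (concat (map (\<lambda>x. map (f x) ys) xs)) =
    concat (map (\<lambda>y. map (\<lambda>x. f x y) xs) ys)"
proof -
  have "map (\<lambda>x. map (f x) ys) xs = map (\<lambda>i. map (\<lambda>j. f (xs ! i) (ys ! j)) [0..<p]) [0..<q]"
    "map (\<lambda>y. map (\<lambda>x. f x y) xs) ys = map (\<lambda>j. map (\<lambda>i. f (xs ! i) (ys ! j)) [0..<q]) [0..<p]"
    using assms by (auto intro!: nth_equalityI)
  then show ?thesis by (simp add: permute_list_transpose_perm)
qed

text \<open>The form in which transposition meets sequences: \<open>p\<close>-fold operations
  inserted below a sequence repeat each entry, while inserting the sequence into a
  \<open>p\<close>-fold operation repeats the whole list.\<close>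

lemma permute_list_transpose_perm_replicate:
  assumes "length xs = q"
  shows "permute_list (transpose_perm p q) (concat (map (replicate p) xs)) = concat (replicate p xs)"
proof -
  have "map (\<lambda>_. x) [0..<p] = replicate p x" for x :: 'b by (simp add: map_replicate_const)
  then show ?thesis
    using permute_list_transpose_perm_lists[OF assms, of "[0..<p]" p "\<lambda>x _. x"]
    by (simp add: map_replicate_const)
qed

lemma permute_list_replicate:
  assumes "\<sigma> permutes {..<n}" shows "permute_list \<sigma> (replicate n x) = replicate n x"
  using assms by (intro nth_equalityI) (auto simp: permute_list_nth permutes_lessThan_less)

text \<open>With a single argument the homomorphism law carries no permutation; this makes unary
  homomorphisms easy to compose.\<close>

lemma transpose_perm_Suc_0: "transpose_perm p (Suc 0) = id"
  by (auto simp: transpose_perm_def)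

section \<open>Commutative monoids and their homomorphisms\<close>

text \<open>Commutative monoids in unbiased form: \<open>U i n\<close> is the \<open>n\<close>-fold
  multiplication on \<open>E i\<close>, with unit \<open>U i 0\<close>. \<open>U_1\<close> and
  \<open>U_Comp\<close> are the unit and associativity laws, \<open>U_Act\<close> is commutativity.
  The index is kept apart from the object because different monoids may live on one object.\<close>

locale cmon_family = symm_multicat M
  for M :: "('o, 'a) smulticat" +
  fixes I :: "'i set" and E :: "'i \<Rightarrow> 'o" and U :: "'i \<Rightarrow> nat \<Rightarrow> 'a"
  assumes E_Obj: "i \<in> I \<Longrightarrow> E i \<in> Obj M"
    and U_type: "i \<in> I \<Longrightarrow> U i n \<in> Arr M \<and> Dom M (U i n) = replicate n (E i) \<and> Cod M (U i n) = E i"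
    and U_1: "i \<in> I \<Longrightarrow> U i 1 = Idt M (E i)"
    and U_Comp: "i \<in> I \<Longrightarrow> Comp M (U i (length ms)) (map (U i) ms) = U i (sum_list ms)"
    and U_Act: "i \<in> I \<Longrightarrow> \<sigma> permutes {..<n} \<Longrightarrow> Act M \<sigma> (U i n) = U i n"
begin

lemma U_typed [simp]:
  assumes "i \<in> I"
  shows "U i n \<in> Arr M" "Dom M (U i n) = replicate n (E i)" "Cod M (U i n) = E i"
  using U_type[OF assms] by auto

text \<open>The law of \<open>ishom [i] f j\<close> written without its transposition, which is
  trivial for one argument.\<close>

definition uhom :: "'i \<Rightarrow> 'a \<Rightarrow> 'i \<Rightarrow> bool"
  where "uhom i f j \<longleftrightarrow> i \<in> I \<and> j \<in> I \<and> f \<in> Arr M \<and> Dom M f = [E i] \<and> Cod M f = E j \<and>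
    (\<forall>p. Comp M f [U i p] = Comp M (U j p) (replicate p f))"

definition uhoms :: "'i list \<Rightarrow> 'a list \<Rightarrow> 'i \<Rightarrow> bool"
  where "uhoms is fs j \<longleftrightarrow> j \<in> I \<and> list_all2 (\<lambda>i f. uhom i f j) is fs"

text \<open>In a multicategory of sequences, where \<open>U j n\<close> is \<open>n\<close> copies
  of an identity, this is the sequence \<open>fs\<close> itself.\<close>

definition tup :: "'i \<Rightarrow> 'a list \<Rightarrow> 'a"
  where "tup j fs = Comp M (U j (length fs)) fs"

text \<open>With \<open>U j p\<close> for the value of the \<open>p\<close>-ary arrow of
  \<open>1\<^sub>\<triangleright>\<close>, this is the condition on arrows of
  \<open>[1\<^sub>\<triangleright>, M]\<close>. The transposition matches \<open>p\<close> blocks,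
  one for each copy of \<open>h\<close>, with one block of length \<open>p\<close> for each
  argument.\<close>

definition ishom :: "'i list \<Rightarrow> 'a \<Rightarrow> 'i \<Rightarrow> bool"
  where "ishom is h j \<longleftrightarrow> set is \<subseteq> I \<and> j \<in> I \<and> h \<in> Arr M \<and> Dom M h = map E is \<and> Cod M h = E j \<and>
    (\<forall>p. Comp M (U j p) (replicate p h) =
      Act M (transpose_perm p (length is)) (Comp M h (map (\<lambda>i. U i p) is)))"

lemma uhomD:
  assumes "uhom i f j"
  shows "i \<in> I" "j \<in> I" "f \<in> Arr M" "Dom M f = [E i]" "Cod M f = E j"
    "Comp M f [U i p] = Comp M (U j p) (replicate p f)"
  using assms by (auto simp: uhom_def)

lemma uhomsD:
  assumes "uhoms is fs j"
  shows "j \<in> I" "set is \<subseteq> I" "length fs = length is" "set fs \<subseteq> Arr M"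
    "map (Cod M) fs = replicate (length is) (E j)" "map (Dom M) fs = map (\<lambda>i. [E i]) is"
    "k < length is \<Longrightarrow> uhom (is ! k) (fs ! k) j" "f \<in> set fs \<Longrightarrow> Cod M f = E j"
proof -
  have *: "list_all2 (\<lambda>i f. uhom i f j) is fs" "j \<in> I" using assms by (auto simp: uhoms_def)
  then have l: "length fs = length is" and u: "\<And>k. k < length is \<Longrightarrow> uhom (is ! k) (fs ! k) j"
    by (auto simp: list_all2_conv_all_nth)
  show "j \<in> I" "length fs = length is" by fact+
  show "set is \<subseteq> I" "set fs \<subseteq> Arr M"
    using u l by (auto simp: set_conv_nth uhom_def)
  show c: "f \<in> set fs \<Longrightarrow> Cod M f = E j" for f
    using u l by (auto simp: in_set_conv_nth uhom_def)
  show "map (Cod M) fs = replicate (length is) (E j)"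
    using c l by (intro map_eq_replicate)
  show "map (Dom M) fs = map (\<lambda>i. [E i]) is"
    by (rule nth_equalityI) (use uhomD(4)[OF u] l in auto)
  show "k < length is \<Longrightarrow> uhom (is ! k) (fs ! k) j" by (rule u)
qed

section \<open>Tuples of unary homomorphisms\<close>

lemma tup_type:
  assumes "uhoms is fs j"
  shows "tup j fs \<in> Arr M" "Dom M (tup j fs) = map E is" "Cod M (tup j fs) = E j"
proof -
  note u = uhomsD[OF assms]
  have "concat (map (Dom M) fs) = map E is"
    unfolding u(6) by (induction "is") auto
  then show "tup j fs \<in> Arr M" "Dom M (tup j fs) = map E is" "Cod M (tup j fs) = E j"
    using Comp_type[of "U j (length fs)" fs] u unfolding tup_def by auto
qed

lemma uhom_Idt:
  assumes "i \<in> I" shows "uhom i (Idt M (E i)) i"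
  unfolding uhom_def
  using assms E_Obj Idt_type Idt_Comp[of "U i _"] Comp_Idt[of "U i _"] by (auto simp: map_replicate)

lemma uhoms_replicate_Idt: "i \<in> I \<Longrightarrow> uhoms (replicate n i) (replicate n (Idt M (E i))) i"
  by (auto simp: uhoms_def list_all2_conv_all_nth uhom_Idt)

lemma tup_replicate_Idt: "i \<in> I \<Longrightarrow> tup i (replicate n (Idt M (E i))) = U i n"
  using Comp_Idt[of "U i n"] by (simp add: tup_def map_replicate)

lemma tup_singleton:
  assumes "uhom i f j" shows "tup j [f] = f"
  using Idt_Comp[of f] U_1[of j] uhomD[OF assms] by (simp add: tup_def)

text \<open>Distributivity: by associativity \<open>f\<close> meets the operation
  \<open>U i m\<close>, passes it by the homomorphism law as \<open>m\<close> copies of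
  \<open>f\<close>, and each copy is then composed with its own entry.\<close>

lemma uhom_Comp_tup:
  assumes f: "uhom i f j" and g: "uhoms is gs i"
  shows "Comp M f [tup i gs] = tup j (map (\<lambda>g. Comp M f [g]) gs)"
proof -
  note u = uhomsD[OF g] and v = uhomD[OF f]
  let ?m = "length gs"
  have "Comp M f [tup i gs] = Comp M (Comp M f [U i ?m]) gs"
    using Comp_assoc[of f "[U i ?m]" "[gs]"] u v by (simp add: tup_def)
  \<comment> \<open>Cutting \<open>gs\<close> into singletons gives each copy of \<open>f\<close>
    its own argument list for \<open>Comp_assoc\<close>.\<close>
  also have "\<dots> = Comp M (Comp M (U j ?m) (replicate ?m f)) (concat (map (\<lambda>g. [g]) gs))"
    using v(6) by (simp add: concat_map_singleton)
  also have "\<dots> = Comp M (U j ?m) (map2 (Comp M) (replicate ?m f) (map (\<lambda>g. [g]) gs))"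
    by (rule Comp_assoc[symmetric])
      (use u v in \<open>auto intro!: map_eq_replicate\<close>)
  finally show ?thesis by (simp add: tup_def map2_replicate_left comp_def)
qed

text \<open>The law for \<open>g\<close> says that \<open>Comp M g [U i p]\<close> is the tuple of
  \<open>p\<close> copies of \<open>g\<close>, over which \<open>f\<close> distributes.\<close>

lemma uhom_Comp:
  assumes f: "uhom j f k" and g: "uhom i g j"
  shows "uhom i (Comp M f [g]) k"
proof -
  note u = uhomD[OF g] and v = uhomD[OF f]
  have "Comp M (Comp M f [g]) [U i p] = Comp M (U k p) (replicate p (Comp M f [g]))" for p
  proof -
    have "Comp M (Comp M f [g]) [U i p] = Comp M f [Comp M g [U i p]]"
      using Comp_assoc[of f "[g]" "[[U i p]]"] u v by simp
    also have "\<dots> = Comp M f [tup j (replicate p g)]"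
      using u by (simp add: tup_def)
    also have "\<dots> = tup k (map (\<lambda>g. Comp M f [g]) (replicate p g))"
      by (rule uhom_Comp_tup[OF f, of "replicate p i"])
        (use g u in \<open>auto simp: uhoms_def list_all2_conv_all_nth\<close>)
    finally show ?thesis by (simp add: tup_def)
  qed
  then show ?thesis using Comp_type[of f "[g]"] u v by (auto simp: uhom_def)
qed

lemma U_Comp_tup:
  assumes "j \<in> I" and "\<forall>hs\<in>set hss. set hs \<subseteq> Arr M \<and> (\<forall>h\<in>set hs. Cod M h = E j)"
  shows "Comp M (U j (length hss)) (map (tup j) hss) = tup j (concat hss)"
proof -
  have eq: "map2 (Comp M) (map (U j \<circ> length) hss) hss = map (tup j) hss"
    by (rule nth_equalityI) (auto simp: tup_def)
  have "Comp M (U j (length hss)) (map (tup j) hss) =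
      Comp M (Comp M (U j (length hss)) (map (U j \<circ> length) hss)) (concat hss)"
    unfolding eq[symmetric] using assms
    by (intro Comp_assoc) (auto intro!: map_eq_replicate)
  then show ?thesis
    using U_Comp[OF assms(1), of "map length hss"] by (simp add: tup_def length_concat)
qed

text \<open>The composition rule of \<open>C\<^sub>\<triangleright>\<close>: each entry of the outer
  tuple distributes over the inner tuple in its argument, and the resulting tuple of tuples flattens
  by associativity. No permutation enters.\<close>

lemma Comp_tup:
  assumes f: "uhoms is fs j" and l: "length iss = length is" "length gss = length is"
    and g: "\<And>k. k < length is \<Longrightarrow> uhoms (iss ! k) (gss ! k) (is ! k)"
  defines "hss \<equiv> map2 (\<lambda>f gs. map (\<lambda>g. Comp M f [g]) gs) fs gss"
  shows "Comp M (tup j fs) (map2 tup is gss) = tup j (concat hss)"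
    and "uhoms (concat iss) (concat hss) j"
proof -
  note u = uhomsD[OF f]
  have h: "uhoms (iss ! k) (hss ! k) j" if "k < length is" for k
  proof -
    have "list_all2 (\<lambda>i f. uhom i f j) (iss ! k) (map (\<lambda>g. Comp M (fs ! k) [g]) (gss ! k))"
      using g[OF that] uhom_Comp[OF u(7)[OF that]]
      by (auto simp: uhoms_def list_all2_conv_all_nth)
    then show ?thesis using that u l by (simp add: hss_def uhoms_def)
  qed
  have lh: "length hss = length is" using u l by (simp add: hss_def)
  have "list_all2 (list_all2 (\<lambda>i f. uhom i f j)) iss hss"
    using h lh l by (auto simp: list_all2_conv_all_nth[of _ iss] uhoms_def)
  then show "uhoms (concat iss) (concat hss) j"
    using u(1) by (simp add: uhoms_def list_all2_concatI)
  let ?ts = "map2 tup is gss"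
  have ts: "?ts ! k \<in> Arr M" "Cod M (?ts ! k) = E (is ! k)" if "k < length is" for k
    using tup_type[OF g[OF that]] that l by auto
  have "Comp M (tup j fs) (concat (map (\<lambda>t. [t]) ?ts)) =
      Comp M (U j (length fs)) (map2 (Comp M) fs (map (\<lambda>t. [t]) ?ts))"
    unfolding tup_def[of j fs]
  proof (rule Comp_assoc[symmetric])
    show "\<forall>hs\<in>set (map (\<lambda>t. [t]) ?ts). set hs \<subseteq> Arr M"
      using ts l by (auto simp: in_set_conv_nth)
    show "map (map (Cod M)) (map (\<lambda>t. [t]) ?ts) = map (Dom M) fs"
      unfolding u(6) using ts l by (intro nth_equalityI) auto
  qed (use u l in auto)
  also have "map2 (Comp M) fs (map (\<lambda>t. [t]) ?ts) = map (tup j) hss"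
  proof (rule nth_equalityI)
    fix k assume "k < length (map2 (Comp M) fs (map (\<lambda>t. [t]) ?ts))"
    then have k: "k < length is" using u l by simp
    then show "map2 (Comp M) fs (map (\<lambda>t. [t]) ?ts) ! k = map (tup j) hss ! k"
      using u(3) l uhom_Comp_tup[OF u(7)[OF k] g[OF k]] by (simp add: hss_def)
  qed (use u l in \<open>simp add: hss_def\<close>)
  also have "Comp M (U j (length fs)) (map (tup j) hss) = tup j (concat hss)"
  proof -
    have "\<forall>hs\<in>set hss. set hs \<subseteq> Arr M \<and> (\<forall>h\<in>set hs. Cod M h = E j)"
      using uhomsD(4,8)[OF h] lh by (metis in_set_conv_nth)
    then show ?thesis using U_Comp_tup[OF u(1), of hss] lh u(3) by simp
  qed
  finally show "Comp M (tup j fs) ?ts = tup j (concat hss)" unfolding concat_map_singleton by simp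
qed

text \<open>By \<open>Comp_Act_outer\<close> a permutation of the unary entries amounts to one of
  the operation, which \<open>U_Act\<close> absorbs.\<close>

lemma Act_tup:
  assumes f: "uhoms is fs j" and s: "\<sigma> permutes {..<length is}"
  shows "Act M \<sigma> (tup j fs) = tup j (permute_list \<sigma> fs)"
    and "uhoms (permute_list \<sigma> is) (permute_list \<sigma> fs) j"
proof -
  note u = uhomsD[OF f]
  have "map (\<lambda>g. length (Dom M g)) fs = replicate (length is) 1"
    using arg_cong[OF u(6), of "map length"] by (simp add: comp_def map_replicate_const)
  then show "Act M \<sigma> (tup j fs) = tup j (permute_list \<sigma> fs)"
    using Comp_Act_outer[of "U j (length fs)" fs \<sigma>] u s
    by (simp add: tup_def U_Act block_perm_replicate_Suc_0)
  show "uhoms (permute_list \<sigma> is) (permute_list \<sigma> fs) j"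
    using f by (simp add: uhoms_def list_all2_permute_list_iff[OF s])
qed

text \<open>Both sides of the law are tuples of entries of \<open>fs\<close>: \<open>p\<close>
  copies of the list on the left, each entry \<open>p\<close> times on the right. Transposing a
  matrix with constant rows turns the second into the first.\<close>

lemma ishom_tup:
  assumes f: "uhoms is fs j" shows "ishom is (tup j fs) j"
proof -
  note u = uhomsD[OF f] and t = tup_type[OF f]
  let ?n = "length is"
  have "Comp M (U j p) (replicate p (tup j fs)) =
      Act M (transpose_perm p ?n) (Comp M (tup j fs) (map (\<lambda>i. U i p) is))" for p
  proof -
    have "Comp M (U j p) (replicate p (tup j fs)) = tup j (concat (replicate p fs))"
      using U_Comp_tup[OF u(1), of "replicate p fs"] u by simp
    also have "\<dots> = tup j (permute_list (transpose_perm p ?n) (concat (map (replicate p) fs)))"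
      by (simp add: permute_list_transpose_perm_replicate u(3))
    \<comment> \<open>Writing each copy of an entry as its composite with an identity gives the
      shape of \<open>Comp_tup\<close>, since \<open>U i p\<close> is the tuple of \<open>p\<close>
      identities.\<close>
    also have "map (replicate p) fs =
        map2 (\<lambda>f gs. map (\<lambda>g. Comp M f [g]) gs) fs (map (\<lambda>i. replicate p (Idt M (E i))) is)"
    proof (rule nth_equalityI)
      fix k assume "k < length (map (replicate p) fs)"
      then have k: "k < length is" using u by simp
      then have "Comp M (fs ! k) [Idt M (E (is ! k))] = fs ! k"
        using uhomD[OF u(7)[OF k]] Comp_Idt[of "fs ! k"] by simp
      then show "map (replicate p) fs ! k =
          map2 (\<lambda>f gs. map (\<lambda>g. Comp M f [g]) gs) fs (map (\<lambda>i. replicate p (Idt M (E i))) is) ! k"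
        using k u(3) by (simp add: map_replicate)
    qed (use u in simp)
    also note eq = calculation
    let ?gss = "map (\<lambda>i. replicate p (Idt M (E i))) is"
    let ?hss = "map2 (\<lambda>f gs. map (\<lambda>g. Comp M f [g]) gs) fs ?gss"
    have "uhoms (map (replicate p) is ! k) (?gss ! k) (is ! k)" if "k < ?n" for k
      using that u(2) by (auto intro!: uhoms_replicate_Idt)
    note C = Comp_tup[OF f _ _ this, simplified]
    have "map2 tup is ?gss = map (\<lambda>i. U i p) is"
      using u(2) by (intro nth_equalityI) (auto intro!: tup_replicate_Idt)
    then have "Comp M (tup j fs) (map (\<lambda>i. U i p) is) = tup j (concat ?hss)"
      using C(1) by simp
    moreover have "length (concat (map (replicate p) is)) = p * ?n"
      by (simp add: length_concat comp_def sum_list_triv mult.commute)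
    then have "Act M (transpose_perm p ?n) (tup j (concat ?hss)) =
        tup j (permute_list (transpose_perm p ?n) (concat ?hss))"
      by (intro Act_tup(1)[OF C(2)]) (simp add: permutes_transpose_perm)
    ultimately show ?thesis using eq by simp
  qed
  then show ?thesis using t u by (auto simp: ishom_def)
qed

text \<open>The \<open>x l r\<close> are lists of labels whose lengths prescribe a matrix of arities; the last two
  assumptions say that transposing that matrix does not change the order of the labels.\<close>

lemma ishom_matrix:
  fixes x :: "nat \<Rightarrow> nat \<Rightarrow> 'l list"
  assumes h: "ishom is h j"
    and d: "distinct (concat (map (\<lambda>l. concat (map (x l) [0..<p])) [0..<length is]))"
    and t: "concat (map (\<lambda>r. concat (map (\<lambda>l. x l r) [0..<length is])) [0..<p]) =
      concat (map (\<lambda>l. concat (map (x l) [0..<p])) [0..<length is])"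
  shows "Comp M (U j p)
      (map (\<lambda>r. Comp M h (map (\<lambda>l. U (is ! l) (length (x l r))) [0..<length is])) [0..<p]) =
    Comp M h (map (\<lambda>l. U (is ! l) (\<Sum>r\<leftarrow>[0..<p]. length (x l r))) [0..<length is])"
proof -
  let ?n = "length is" and ?T = "transpose_perm p (length is)"
  define u where "u l r = U (is ! l) (length (x l r))" for l r
  let ?col = "\<lambda>r. map (\<lambda>l. u l r) [0..<?n]" and ?row = "\<lambda>l. map (u l) [0..<p]"
  let ?us = "map (\<lambda>i. U i p) is"
  let ?xss = "concat (map (\<lambda>l. map (x l) [0..<p]) [0..<?n])"
  have h': "set is \<subseteq> I" "j \<in> I" "h \<in> Arr M" "Dom M h = map E is" "Cod M h = E j"
    "Comp M (U j p) (replicate p h) = Act M ?T (Comp M h ?us)"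
    using h by (auto simp: ishom_def)
  have I: "is ! l \<in> I" if "l < ?n" for l using h'(1) that by auto
  have us: "set ?us \<subseteq> Arr M" "map (Cod M) ?us = Dom M h" using h'(1,4) by auto
  have hus: "Comp M h ?us \<in> Arr M" "Dom M (Comp M h ?us) = concat (map (\<lambda>i. replicate p (E i)) is)"
  proof -
    have eq: "map (Dom M) ?us = map (\<lambda>i. replicate p (E i)) is" using h'(1) by auto
    then show "Comp M h ?us \<in> Arr M" "Dom M (Comp M h ?us) = concat (map (\<lambda>i. replicate p (E i)) is)"
      using Comp_type[OF h'(3) us] unfolding eq by auto
  qed
  have len: "length (Dom M (Comp M h ?us)) = p * ?n"
    unfolding hus by (simp add: length_concat comp_def sum_list_triv mult.commute)
  have len': "length ?xss = p * ?n"
    by (simp add: length_concat comp_def sum_list_triv mult.commute)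
  have T: "?T permutes {..<p * ?n}" by (rule permutes_transpose_perm)
  have rows: "set (concat (map ?row [0..<?n])) \<subseteq> Arr M"
    using I by (auto simp: u_def)
  have cod_rows: "map (map (Cod M)) (map ?row [0..<?n]) = map (Dom M) ?us"
    using I by (intro nth_equalityI) (auto simp: u_def map_replicate_const)
  \<comment> \<open>Both sides of the law for \<open>h\<close> are composed with the matrix of
    operations \<open>u l r\<close>: it is inserted by columns on the left, and by rows, after a
    permutation of blocks, on the right.\<close>
  have "Comp M (U j p) (map (\<lambda>r. Comp M h (?col r)) [0..<p]) =
      Comp M (U j p) (map2 (Comp M) (replicate p h) (map ?col [0..<p]))"
    by (simp add: map2_replicate_left comp_def)
  also have "\<dots> = Comp M (Comp M (U j p) (replicate p h)) (concat (map ?col [0..<p]))"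
  proof (rule Comp_assoc)
    have "map (Cod M) (?col r) = Dom M h" for r
      unfolding h' using I by (intro nth_equalityI) (auto simp: u_def)
    then show "map (map (Cod M)) (map ?col [0..<p]) = map (Dom M) (replicate p h)"
      by (auto intro!: map_eq_replicate simp: comp_def)
  qed (use h' I in \<open>auto simp: u_def\<close>)
  also have "\<dots> = Comp M (Act M ?T (Comp M h ?us)) (permute_list ?T (concat (map ?row [0..<?n])))"
    unfolding permute_list_transpose_perm h'(6) ..
  also have "\<dots> = Act M (block_perm ?T (map (\<lambda>g. length (Dom M g)) (concat (map ?row [0..<?n]))))
      (Comp M (Comp M h ?us) (concat (map ?row [0..<?n])))"
  proof (rule Comp_Act_outer[OF hus(1) rows])
    show "map (Cod M) (concat (map ?row [0..<?n])) = Dom M (Comp M h ?us)"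
      unfolding map_concat cod_rows using Comp_type[OF h'(3) us] by simp
  qed (simp only: len T)
  also have "map (\<lambda>g. length (Dom M g)) (concat (map ?row [0..<?n])) = map length ?xss"
    using I by (auto simp: map_concat u_def comp_def intro!: arg_cong[of _ _ concat])
  \<comment> \<open>The block lengths are the arities \<open>length (x l r)\<close>; by
    \<open>t\<close> the transposition keeps the order of the labels, and by \<open>d\<close> these
    are distinct.\<close>
  also have "block_perm ?T (map length ?xss) = id"
  proof (rule block_perm_idI)
    show "?T permutes {..<length ?xss}" using len' T by simp
    have c: "concat ?xss = concat (map (\<lambda>l. concat (map (x l) [0..<p])) [0..<?n])"
      by (simp add: concat_concat_eq comp_def map_concat)
    show "distinct (concat ?xss)" using d c by simp
    show "concat (permute_list ?T ?xss) = concat ?xss"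
      unfolding permute_list_transpose_perm c using t by (simp add: concat_concat_eq comp_def map_concat)
  qed
  also have "Act M id (Comp M (Comp M h ?us) (concat (map ?row [0..<?n]))) =
      Comp M (Comp M h ?us) (concat (map ?row [0..<?n]))"
  proof (rule Act_id)
    show "Comp M (Comp M h ?us) (concat (map ?row [0..<?n])) \<in> Arr M"
      using Comp_type[OF hus(1) rows] cod_rows Comp_type[OF h'(3) us] by (simp add: map_concat)
  qed
  also have "\<dots> = Comp M h (map2 (Comp M) ?us (map ?row [0..<?n]))"
  proof (rule Comp_assoc[symmetric, OF h'(3) us])
    show "\<forall>gs\<in>set (map ?row [0..<?n]). set gs \<subseteq> Arr M" using I by (auto simp: u_def)
  qed (simp_all only: cod_rows length_map length_upt minus_nat.diff_0)
  \<comment> \<open>Along row \<open>l\<close> the entries compose with \<open>U (is ! l) p\<close>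
    to the operation whose arity is the row sum.\<close>
  also have "map2 (Comp M) ?us (map ?row [0..<?n]) =
      map (\<lambda>l. U (is ! l) (\<Sum>r\<leftarrow>[0..<p]. length (x l r))) [0..<?n]"
  proof (rule nth_equalityI)
    fix l assume "l < length (map2 (Comp M) ?us (map ?row [0..<?n]))"
    then show "map2 (Comp M) ?us (map ?row [0..<?n]) ! l =
        map (\<lambda>l. U (is ! l) (\<Sum>r\<leftarrow>[0..<p]. length (x l r))) [0..<?n] ! l"
      using U_Comp[OF I, of l "map (\<lambda>r. length (x l r)) [0..<p]"] by (simp add: u_def[abs_def] comp_def)
  qed simp
  finally show ?thesis by (simp add: u_def)
qed

section \<open>Unary components and closure of homomorphisms\<close>

definition proj :: "'i list \<Rightarrow> 'a \<Rightarrow> nat \<Rightarrow> 'a"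
  where "proj is h k = Comp M h (map (\<lambda>l. U (is ! l) (if l = k then 1 else 0)) [0..<length is])"

text \<open>The law for \<open>proj is h k\<close> is the law for \<open>h\<close> on the matrix
  with ones in row \<open>k\<close> and zeros elsewhere: every column inserts units beside argument
  \<open>k\<close>, and the row sums are \<open>p\<close> in row \<open>k\<close> and 0 elsewhere.
  With one nonempty row, transposing does not reorder the labels.\<close>

lemma uhom_proj:
  assumes h: "ishom is h j" and k: "k < length is"
  shows "uhom (is ! k) (proj is h k) j"
proof -
  let ?n = "length is"
  let ?us = "map (\<lambda>l. U (is ! l) (if l = k then 1 else 0)) [0..<?n]"
  have h': "set is \<subseteq> I" "j \<in> I" "h \<in> Arr M" "Dom M h = map E is" "Cod M h = E j"
    using h by (auto simp: ishom_def)
  have I: "is ! l \<in> I" if "l < ?n" for l using h'(1) that by auto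
  have us: "set ?us \<subseteq> Arr M" using I by auto
  have cod: "map (Cod M) ?us = Dom M h" unfolding h' using I by (intro nth_equalityI) auto
  have dom: "map (Dom M) ?us = map (\<lambda>l. if l = k then [E (is ! k)] else []) [0..<?n]"
    using I by auto
  have type: "proj is h k \<in> Arr M" "Dom M (proj is h k) = [E (is ! k)]" "Cod M (proj is h k) = E j"
    using Comp_type[OF h'(3) us cod] k h'(5) unfolding proj_def dom concat_map_if_eq by auto
  have "Comp M (proj is h k) [U (is ! k) p] = Comp M (U j p) (replicate p (proj is h k))" for p
  proof -
    \<comment> \<open>Only argument \<open>k\<close> is still open; the units in the other arguments
      take empty lists.\<close>
    let ?vss = "map (\<lambda>l. if l = k then [U (is ! k) p] else []) [0..<?n]"
    have "Comp M (proj is h k) [U (is ! k) p] = Comp M (Comp M h ?us) (concat ?vss)"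
      using k by (simp add: proj_def concat_map_if_eq)
    also have "\<dots> = Comp M h (map2 (Comp M) ?us ?vss)"
      using h'(3) us cod I k by (intro Comp_assoc[symmetric]) (auto intro!: nth_equalityI split: if_splits)
    also have "map2 (Comp M) ?us ?vss = map (\<lambda>l. U (is ! l) (if l = k then p else 0)) [0..<?n]"
    proof (rule nth_equalityI)
      fix l assume "l < length (map2 (Comp M) ?us ?vss)"
      then show "map2 (Comp M) ?us ?vss ! l = map (\<lambda>l. U (is ! l) (if l = k then p else 0)) [0..<?n] ! l"
        using U_Comp[OF I, of k "[p]"] U_Comp[OF I, of l "[]"] by auto
    qed simp
    also have "map (\<lambda>l. U (is ! l) (if l = k then p else 0)) [0..<?n] =
        map (\<lambda>l. U (is ! l) (\<Sum>r\<leftarrow>[0..<p]. length (if l = k then [r] else []))) [0..<?n]"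
      by (auto simp: sum_list_triv)
    also have "Comp M h \<dots> = Comp M (U j p)
        (map (\<lambda>r. Comp M h (map (\<lambda>l. U (is ! l) (length (if l = k then [r] else []))) [0..<?n])) [0..<p])"
    proof (rule ishom_matrix[OF h, symmetric])
      have "concat (map (\<lambda>r. if l = k then [r] else []) [0..<p]) = (if l = k then [0..<p] else [])" for l
        by (auto simp: concat_map_singleton)
      then have *: "concat (map (\<lambda>l. concat (map (\<lambda>r. if l = k then [r] else []) [0..<p])) [0..<?n]) = [0..<p]"
        using k by (simp add: concat_map_if_eq)
      show "distinct (concat (map (\<lambda>l. concat (map (\<lambda>r. if l = k then [r] else []) [0..<p])) [0..<?n]))"
        unfolding * by simp
      show "concat (map (\<lambda>r. concat (map (\<lambda>l. if l = k then [r] else []) [0..<?n])) [0..<p]) =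
          concat (map (\<lambda>l. concat (map (\<lambda>r. if l = k then [r] else []) [0..<p])) [0..<?n])"
        unfolding * using k by (simp add: concat_map_if_eq concat_map_singleton)
    qed
    also have "(\<lambda>r. Comp M h (map (\<lambda>l. U (is ! l) (length (if l = k then [r] else []))) [0..<?n])) =
        (\<lambda>r :: nat. proj is h k)"
      unfolding proj_def by (intro ext arg_cong[of _ _ "Comp M h"]) auto
    finally show ?thesis by (simp add: map_replicate_const)
  qed
  then show ?thesis using type I k h' by (simp add: uhom_def)
qed

lemma uhoms_proj: "ishom is h j \<Longrightarrow> uhoms is (map (proj is h) [0..<length is]) j"
  by (auto simp: uhoms_def list_all2_conv_all_nth uhom_proj ishom_def)

text \<open>Column \<open>r\<close> of the diagonal matrix yields \<open>proj is h r\<close>, while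
  every row sum is 1, so that the rows insert identities into \<open>h\<close>.\<close>

lemma tup_proj:
  assumes h: "ishom is h j"
  shows "tup j (map (proj is h) [0..<length is]) = h"
proof -
  let ?n = "length is" and ?x = "\<lambda>l r. if l = r then [l] else []"
  have h': "set is \<subseteq> I" "h \<in> Arr M" "Dom M h = map E is"
    using h by (auto simp: ishom_def)
  have *: "concat (map (\<lambda>l. concat (map (?x l) [0..<?n])) [0..<?n]) = [0..<?n]"
  proof -
    have eq: "?x l = (\<lambda>r. if r = l then [l] else [])" for l by auto
    have "concat (map (?x l) [0..<?n]) = (if l < ?n then [l] else [])" for l
      unfolding eq by (rule concat_map_if_eq)
    then have eq2: "map (\<lambda>l. concat (map (?x l) [0..<?n])) [0..<?n] = map (\<lambda>l. [l]) [0..<?n]"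
      by simp
    show ?thesis unfolding eq2 concat_map_singleton by simp
  qed
  have **: "concat (map (\<lambda>r. concat (map (\<lambda>l. ?x l r) [0..<?n])) [0..<?n]) = [0..<?n]"
  proof -
    have eq: "(\<lambda>l. ?x l r) = (\<lambda>l. if l = r then [r] else [])" for r by auto
    have "concat (map (\<lambda>l. ?x l r) [0..<?n]) = (if r < ?n then [r] else [])" for r
      unfolding eq by (rule concat_map_if_eq)
    then have eq2: "map (\<lambda>r. concat (map (\<lambda>l. ?x l r) [0..<?n])) [0..<?n] = map (\<lambda>r. [r]) [0..<?n]"
      by simp
    show ?thesis unfolding eq2 concat_map_singleton by simp
  qed
  have "tup j (map (proj is h) [0..<?n]) = Comp M (U j ?n)
      (map (\<lambda>r. Comp M h (map (\<lambda>l. U (is ! l) (length (?x l r))) [0..<?n])) [0..<?n])"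
    by (auto simp: tup_def proj_def intro!: arg_cong[of _ _ "Comp M _"])
  also have "\<dots> = Comp M h (map (\<lambda>l. U (is ! l) (\<Sum>r\<leftarrow>[0..<?n]. length (?x l r))) [0..<?n])"
    by (rule ishom_matrix[OF h]) (simp_all only: * ** distinct_upt)
  also have "map (\<lambda>l. U (is ! l) (\<Sum>r\<leftarrow>[0..<?n]. length (?x l r))) [0..<?n] = map (Idt M) (Dom M h)"
  proof -
    have eq: "(\<lambda>r. length (?x l r)) = (\<lambda>r. if r = l then 1 else 0)" for l by auto
    have "(\<Sum>r\<leftarrow>[0..<?n]. length (?x l r)) = 1" if "l < ?n" for l
      unfolding eq sum_list_map_if_eq using that by simp
    then have "U (is ! l) (\<Sum>r\<leftarrow>[0..<?n]. length (?x l r)) = Idt M (E (is ! l))" if "l < ?n" for l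
      using U_1[of "is ! l"] h'(1) that nth_mem by (metis subsetD)
    then have "map (\<lambda>l. U (is ! l) (\<Sum>r\<leftarrow>[0..<?n]. length (?x l r))) [0..<?n] =
        map (\<lambda>l. Idt M (E (is ! l))) [0..<?n]"
      by (intro map_cong refl) simp_all
    moreover have "map (\<lambda>l. Idt M (E (is ! l))) [0..<?n] = map (Idt M) (Dom M h)"
      unfolding h'(3) by (rule nth_equalityI) auto
    ultimately show ?thesis by (rule HOL.trans)
  qed
  finally show ?thesis using Comp_Idt[OF h'(2)] by simp
qed

text \<open>Trades the law with its transposition for a list of unary homomorphisms; in this form
  closure properties reduce to \<open>Comp_tup\<close> and \<open>Act_tup\<close>.\<close>

lemma ishom_iff: "ishom is h j \<longleftrightarrow> (\<exists>fs. uhoms is fs j \<and> h = tup j fs)"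
  using ishom_tup uhoms_proj tup_proj by metis

text \<open>Makes tupling injective. As a tuple \<open>U i 0\<close> is empty, so inserting it at
  \<open>l\<close> deletes the entry \<open>fs ! l\<close>; as a tuple \<open>U i 1\<close> is a
  single identity, which leaves \<open>fs ! k\<close> unchanged.\<close>

lemma proj_tup:
  assumes f: "uhoms is fs j" and k: "k < length is"
  shows "proj is (tup j fs) k = fs ! k"
proof -
  note u = uhomsD[OF f]
  let ?n = "length is"
  let ?\<delta> = "\<lambda>l. if l = k then 1 else (0::nat)"
  let ?iss = "map (\<lambda>l. replicate (?\<delta> l) (is ! l)) [0..<?n]"
  let ?gss = "map (\<lambda>l. replicate (?\<delta> l) (Idt M (E (is ! l)))) [0..<?n]"
  let ?hss = "map2 (\<lambda>f gs. map (\<lambda>g. Comp M f [g]) gs) fs ?gss"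
  have I: "is ! l \<in> I" if "l < ?n" for l using u(2) that by auto
  have "proj is (tup j fs) k = Comp M (tup j fs) (map2 tup is ?gss)"
    unfolding proj_def using I
    by (intro arg_cong[of _ _ "Comp M _"] nth_equalityI)
      (auto simp del: replicate.simps One_nat_def simp: tup_replicate_Idt)
  also have "\<dots> = tup j (concat ?hss)"
    by (rule Comp_tup(1)[OF f, of ?iss])
      (auto simp del: replicate.simps One_nat_def intro!: uhoms_replicate_Idt I)
  also have "?hss = map (\<lambda>l. if l = k then [fs ! k] else []) [0..<?n]"
    using uhomD[OF u(7)] Comp_Idt[of "fs ! k"] u(3) k by (intro nth_equalityI) auto
  finally show ?thesis
    using k tup_singleton[OF u(7)[OF k]] by (simp add: concat_map_if_eq)
qed

text \<open>Operations are homomorphisms because they are tuples of identities; commutativity enters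
  through \<open>ishom_tup\<close>.\<close>

lemma ishom_U: "i \<in> I \<Longrightarrow> ishom (replicate n i) (U i n) i"
  using ishom_tup[OF uhoms_replicate_Idt] by (simp add: tup_replicate_Idt)

lemma ishom_Idt: "i \<in> I \<Longrightarrow> ishom [i] (Idt M (E i)) i"
  using ishom_U[of i 1] U_1[of i] by simp

text \<open>All arrows are decomposed into their unary components, and \<open>Comp_tup\<close>
  exhibits the composite as a tuple again.\<close>

lemma ishom_Comp:
  assumes h: "ishom is h j" and l: "length iss = length is" "length gs = length is"
    and g: "\<And>k. k < length is \<Longrightarrow> ishom (iss ! k) (gs ! k) (is ! k)"
  shows "ishom (concat iss) (Comp M h gs) j"
proof -
  obtain fs where fs: "uhoms is fs j" "h = tup j fs" using h ishom_iff by auto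
  define gss where "gss = map2 (\<lambda>is g. map (proj is g) [0..<length is]) iss gs"
  have gs: "map2 tup is gss = gs"
    using l g tup_proj by (intro nth_equalityI) (auto simp: gss_def)
  have u: "uhoms (iss ! k) (gss ! k) (is ! k)" if "k < length is" for k
    using uhoms_proj[OF g[OF that]] that l by (simp add: gss_def)
  have "length gss = length is" using l by (simp add: gss_def)
  note C = Comp_tup[OF fs(1) l(1) this u]
  show ?thesis using ishom_tup[OF C(2)] C(1) gs fs(2) by simp
qed

lemma ishom_Act:
  assumes "ishom is h j" "\<sigma> permutes {..<length is}"
  shows "ishom (permute_list \<sigma> is) (Act M \<sigma> h) j"
  using assms Act_tup ishom_iff by metis

end

section \<open>Symmetric functors and sequential multicategories\<close>

lemma sfunctorsD:
  assumes "F \<in> sfunctors M N"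
  shows "A \<in> Obj M \<Longrightarrow> fst F A \<in> Obj N"
    and "f \<in> Arr M \<Longrightarrow> snd F f \<in> Arr N"
    and "f \<in> Arr M \<Longrightarrow> Dom N (snd F f) = map (fst F) (Dom M f)"
    and "f \<in> Arr M \<Longrightarrow> Cod N (snd F f) = fst F (Cod M f)"
    and "A \<in> Obj M \<Longrightarrow> snd F (Idt M A) = Idt N (fst F A)"
    and "f \<in> Arr M \<Longrightarrow> set gs \<subseteq> Arr M \<Longrightarrow> map (Cod M) gs = Dom M f \<Longrightarrow>
      snd F (Comp M f gs) = Comp N (snd F f) (map (snd F) gs)"
    and "f \<in> Arr M \<Longrightarrow> \<sigma> permutes {..<length (Dom M f)} \<Longrightarrow> snd F (Act M \<sigma> f) = Act N \<sigma> (snd F f)"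
    and "fst F \<in> extensional (Obj M)" and "snd F \<in> extensional (Arr M)"
  using assms by (auto simp: sfunctors_def PiE_def)

lemma sfunctorsI:
  assumes "fst F \<in> extensional (Obj M)" "snd F \<in> extensional (Arr M)"
    and "\<And>A. A \<in> Obj M \<Longrightarrow> fst F A \<in> Obj N"
    and "\<And>f. f \<in> Arr M \<Longrightarrow> snd F f \<in> Arr N"
    and "\<And>f. f \<in> Arr M \<Longrightarrow> Dom N (snd F f) = map (fst F) (Dom M f)"
    and "\<And>f. f \<in> Arr M \<Longrightarrow> Cod N (snd F f) = fst F (Cod M f)"
    and "\<And>A. A \<in> Obj M \<Longrightarrow> snd F (Idt M A) = Idt N (fst F A)"
    and "\<And>f gs. f \<in> Arr M \<Longrightarrow> set gs \<subseteq> Arr M \<Longrightarrow> map (Cod M) gs = Dom M f \<Longrightarrow>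
      snd F (Comp M f gs) = Comp N (snd F f) (map (snd F) gs)"
    and "\<And>f \<sigma>. f \<in> Arr M \<Longrightarrow> \<sigma> permutes {..<length (Dom M f)} \<Longrightarrow> snd F (Act M \<sigma> f) = Act N \<sigma> (snd F f)"
  shows "F \<in> sfunctors M N"
  using assms by (auto simp: sfunctors_def PiE_def)

lemma sfunctors_eqI:
  assumes "F \<in> sfunctors M N" "G \<in> sfunctors M N'"
    and "\<And>A. A \<in> Obj M \<Longrightarrow> fst F A = fst G A" "\<And>f. f \<in> Arr M \<Longrightarrow> snd F f = snd G f"
  shows "F = G"
  using assms by (intro prod_eqI extensionalityI[of _ "Obj M"] extensionalityI[of _ "Arr M"])
    (auto simp: sfunctorsD)

lemma fst_sfun_comp [simp]: "A \<in> Obj M \<Longrightarrow> fst (sfun_comp M G F) A = fst G (fst F A)"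
  and snd_sfun_comp [simp]: "f \<in> Arr M \<Longrightarrow> snd (sfun_comp M G F) f = snd G (snd F f)"
  by (simp_all add: sfun_comp_def compose_def)

lemma fst_sfun_id [simp]: "A \<in> Obj M \<Longrightarrow> fst (sfun_id M) A = A"
  and snd_sfun_id [simp]: "f \<in> Arr M \<Longrightarrow> snd (sfun_id M) f = f"
  by (simp_all add: sfun_id_def)

lemma sfunctors_map_Cod:
  assumes "F \<in> sfunctors M N" "set gs \<subseteq> Arr M" "map (Cod M) gs = Dom M f" "f \<in> Arr M"
  shows "map (Cod N) (map (snd F) gs) = Dom N (snd F f)"
proof -
  have "map (Cod N) (map (snd F) gs) = map (fst F) (map (Cod M) gs)"
    using assms(1,2) by (auto simp: sfunctorsD)
  then show ?thesis using assms by (simp add: sfunctorsD)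
qed

context symm_multicat begin

lemma in_Dom_Obj: "f \<in> Arr M \<Longrightarrow> A \<in> set (Dom M f) \<Longrightarrow> A \<in> Obj M"
  using Dom_Obj by auto

lemma sfun_id_sfunctors: "sfun_id M \<in> sfunctors M M"
proof (rule sfunctorsI)
  fix f gs assume "f \<in> Arr M" "set gs \<subseteq> Arr M" "map (Cod M) gs = Dom M f"
  moreover from this have "map (snd (sfun_id M)) gs = gs" by (intro map_idI) auto
  ultimately show "snd (sfun_id M) (Comp M f gs) =
      Comp M (snd (sfun_id M) f) (map (snd (sfun_id M)) gs)"
    using Comp_type by simp
qed (use Cod_Obj Idt_type Act_type in_Dom_Obj in
  \<open>auto simp: sfun_id_def extensional_def intro!: map_idI[symmetric]\<close>)

lemma sfun_comp_sfunctors: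
  assumes F: "F \<in> sfunctors M N" and G: "G \<in> sfunctors N P"
  shows "sfun_comp M G F \<in> sfunctors M P"
proof (rule sfunctorsI)
  fix f gs assume f: "f \<in> Arr M" "set gs \<subseteq> Arr M" "map (Cod M) gs = Dom M f"
  have eq: "map (snd (sfun_comp M G F)) gs = map (snd G) (map (snd F) gs)"
    using f by auto
  have "set (map (snd F) gs) \<subseteq> Arr N" using f F by (auto simp: sfunctorsD)
  then show "snd (sfun_comp M G F) (Comp M f gs) =
      Comp P (snd (sfun_comp M G F) f) (map (snd (sfun_comp M G F)) gs)"
    unfolding eq using f F G sfunctors_map_Cod[OF F f(2,3,1)]
    by (simp add: sfunctorsD Comp_type del: map_map)
qed (use F G Cod_Obj Idt_type Act_type in_Dom_Obj in
  \<open>auto simp: sfunctorsD sfun_comp_def compose_def extensional_def\<close>)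

end

text \<open>A bijective functor is invertible: applying \<open>G\<close> to a law for the inverse
  gives a law that \<open>G\<close> satisfies. The closure conditions on \<open>N\<close> allow this
  cancellation of \<open>G\<close>, and for \<open>seq_of C\<close> they are checked
  directly.\<close>

lemma smulticat_isoI:
  fixes N :: "('p, 'b) smulticat" and M :: "('o, 'a) smulticat"
  assumes G: "G \<in> sfunctors N M"
    and bij: "bij_betw (fst G) (Obj N) (Obj M)" "bij_betw (snd G) (Arr N) (Arr M)"
    and Dom_Obj: "\<And>f. f \<in> Arr N \<Longrightarrow> set (Dom N f) \<subseteq> Obj N"
    and Cod_Obj: "\<And>f. f \<in> Arr N \<Longrightarrow> Cod N f \<in> Obj N"
    and Idt_type: "\<And>A. A \<in> Obj N \<Longrightarrow> Idt N A \<in> Arr N"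
    and Comp_type: "\<And>f gs. \<lbrakk>f \<in> Arr N; set gs \<subseteq> Arr N; map (Cod N) gs = Dom N f\<rbrakk> \<Longrightarrow> Comp N f gs \<in> Arr N"
    and Act_type: "\<And>f \<sigma>. \<lbrakk>f \<in> Arr N; \<sigma> permutes {..<length (Dom N f)}\<rbrakk> \<Longrightarrow> Act N \<sigma> f \<in> Arr N"
  shows "smulticat_iso M N"
proof -
  define F where "F = (\<lambda>A\<in>Obj M. inv_into (Obj N) (fst G) A, \<lambda>f\<in>Arr M. inv_into (Arr N) (snd G) f)"
  have FG: "A \<in> Obj N \<Longrightarrow> fst F (fst G A) = A" "f \<in> Arr N \<Longrightarrow> snd F (snd G f) = f" for A f
    using bij G by (auto simp: F_def bij_betw_def sfunctorsD)
  have ex: "A \<in> Obj M \<Longrightarrow> \<exists>B. B \<in> Obj N \<and> A = fst G B" "f \<in> Arr M \<Longrightarrow> \<exists>g. g \<in> Arr N \<and> f = snd G g" for A f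
    using bij by (auto simp: bij_betw_def image_iff)
  have mapFG: "set As \<subseteq> Obj N \<Longrightarrow> map (fst F) (map (fst G) As) = As" for As
    using FG by (auto intro!: map_idI)
  have "F \<in> sfunctors M N"
  proof (rule sfunctorsI)
    show "fst F \<in> extensional (Obj M)" "snd F \<in> extensional (Arr M)" by (simp_all add: F_def)
    show "A \<in> Obj M \<Longrightarrow> fst F A \<in> Obj N" "f \<in> Arr M \<Longrightarrow> snd F f \<in> Arr N" for A f
      using ex FG by metis+
    show "A \<in> Obj M \<Longrightarrow> snd F (Idt M A) = Idt N (fst F A)" for A
      using ex(1)[of A] FG G Idt_type by (auto simp flip: sfunctorsD(5))
    fix f assume "f \<in> Arr M"
    then obtain f' where f: "f' \<in> Arr N" "f = snd G f'" using ex by auto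
    show "Dom N (snd F f) = map (fst F) (Dom M f)" "Cod N (snd F f) = fst F (Cod M f)"
      using f G FG Dom_Obj[OF f(1)] Cod_Obj[OF f(1)] mapFG by (auto simp: sfunctorsD simp del: map_map)
    show "snd F (Act M \<sigma> f) = Act N \<sigma> (snd F f)" if "\<sigma> permutes {..<length (Dom M f)}" for \<sigma>
    proof -
      have "\<sigma> permutes {..<length (Dom N f')}" using that f G by (simp add: sfunctorsD)
      then show ?thesis using f FG Act_type sfunctorsD(7)[OF G] by metis
    qed
    show "snd F (Comp M f gs) = Comp N (snd F f) (map (snd F) gs)"
      if gs: "set gs \<subseteq> Arr M" "map (Cod M) gs = Dom M f" for gs
    proof -
      define gs' where "gs' = map (snd F) gs"
      have g: "gs = map (snd G) gs'" "set gs' \<subseteq> Arr N"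
        using gs(1) ex(2) FG(2) by (force simp: gs'_def intro!: map_idI[symmetric])+
      have "map (Cod N) gs' = map (fst F) (map (Cod M) gs)"
        using g G FG Cod_Obj by (auto simp: sfunctorsD)
      also have "\<dots> = Dom N f'"
        using gs(2) f G mapFG Dom_Obj by (simp add: sfunctorsD del: map_map)
      finally have "Comp M f gs = snd G (Comp N f' gs')" "Comp N f' gs' \<in> Arr N"
        using f g G Comp_type by (auto simp: sfunctorsD)
      then show ?thesis using f FG by (simp add: gs'_def)
    qed
  qed
  moreover have "sfun_comp M G F = sfun_id M" "sfun_comp N F G = sfun_id N"
    using ex FG by (force simp: sfun_comp_def compose_def sfun_id_def fun_eq_iff)+
  ultimately show ?thesis using G unfolding smulticat_iso_def by auto
qed

section \<open>Sequential multicategories and compatible monoid structures\<close>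

lemma seq_of_simps [simp]:
  "Obj (seq_of C) = CObj C"
  "(fs, X) \<in> Arr (seq_of C) \<longleftrightarrow> X \<in> CObj C \<and> set fs \<subseteq> CArr C \<and> (\<forall>f\<in>set fs. CCod C f = X)"
  "Dom (seq_of C) (fs, X) = map (CDom C) fs"
  "Cod (seq_of C) (fs, X) = X"
  "Idt (seq_of C) X = ([CId C X], X)"
  "Comp (seq_of C) (fs, X) gs = (concat (map2 (\<lambda>f g. map (CComp C f) (fst g)) fs gs), X)"
  "Act (seq_of C) \<sigma> (fs, X) = (permute_list \<sigma> fs, X)"
  by (auto simp: seq_of_def)

lemma seq_of_Comp_type:
  assumes C: "category C"
    and f: "f \<in> Arr (seq_of C)" "set gs \<subseteq> Arr (seq_of C)" "map (Cod (seq_of C)) gs = Dom (seq_of C) f"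
  shows "Comp (seq_of C) f gs \<in> Arr (seq_of C)"
proof -
  interpret category C by fact
  obtain fs X where fX: "f = (fs, X)" by (cases f)
  have "CComp C h k \<in> CArr C \<and> CCod C (CComp C h k) = X"
    if hk: "(h, (ks, Y)) \<in> set (zip fs gs)" "k \<in> set ks" for h ks Y k
  proof -
    obtain i where i: "i < length fs" "i < length gs" "fs ! i = h" "gs ! i = (ks, Y)"
      using hk(1) by (auto simp: in_set_zip)
    have "(ks, Y) \<in> Arr (seq_of C)" using f(2) i(2,4) by (metis nth_mem subsetD)
    moreover have "h \<in> CArr C" "CCod C h = X" using f(1) fX i(1,3) by auto
    moreover have "Y = CDom C h" using arg_cong[OF f(3), of "\<lambda>xs. xs ! i"] i fX by simp
    ultimately show ?thesis using CComp_type[of h k] hk(2) by auto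
  qed
  then show ?thesis using f(1) fX by auto
qed

text \<open>The working form of \<open>sequential\<close>: here the index is the object itself. The
  lemma \<open>sequential\<close> gives one direction of the equivalence,
  \<open>sequential_structure_exists\<close> the other.\<close>

locale sequential_structure = cmon_family M "Obj M" "\<lambda>A. A" U
  for M :: "('o, 'a) smulticat" and U +
  assumes Arr_ishom: "h \<in> Arr M \<Longrightarrow> ishom (Dom M h) h (Cod M h)"
begin

definition unary_cat :: "('o, 'a) cat"
  where "unary_cat = \<lparr>CObj = Obj M, CArr = {f \<in> Arr M. length (Dom M f) = 1},
    CDom = (\<lambda>f. hd (Dom M f)), CCod = Cod M, CId = Idt M, CComp = (\<lambda>f g. Comp M f [g])\<rparr>"

lemma unary_cat_simps [simp]:
  "CObj unary_cat = Obj M" "CArr unary_cat = {f \<in> Arr M. length (Dom M f) = 1}"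
  "CDom unary_cat f = hd (Dom M f)" "CCod unary_cat = Cod M" "CId unary_cat = Idt M"
  "CComp unary_cat f g = Comp M f [g]"
  by (simp_all add: unary_cat_def)

lemma Dom_unary: "length (Dom M f) = Suc 0 \<Longrightarrow> Dom M f = [hd (Dom M f)]"
  by (cases "Dom M f") auto

lemma category_unary_cat: "category unary_cat"
proof
  fix f g assume "f \<in> CArr unary_cat" "g \<in> CArr unary_cat" "CCod unary_cat g = CDom unary_cat f"
  then have f: "f \<in> Arr M" "g \<in> Arr M" "Dom M f = [Cod M g]" "Dom M g = [hd (Dom M g)]"
    using Dom_unary[of f] Dom_unary[of g] by auto
  then show "CComp unary_cat f g \<in> CArr unary_cat \<and> CDom unary_cat (CComp unary_cat f g) = CDom unary_cat g \<and>
      CCod unary_cat (CComp unary_cat f g) = CCod unary_cat f"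
    using Comp_type[of f "[g]"] by (auto simp del: One_nat_def) (metis One_nat_def length_Cons list.size(3))
  fix h assume "h \<in> CArr unary_cat" "CCod unary_cat h = CDom unary_cat g"
  then have "h \<in> Arr M" "Dom M g = [Cod M h]" using f(4) by auto
  then show "CComp unary_cat (CComp unary_cat f g) h = CComp unary_cat f (CComp unary_cat g h)"
    using f Comp_assoc[of f "[g]" "[[h]]"] by auto
next
  fix f assume "f \<in> CArr unary_cat"
  then have f: "f \<in> Arr M" "Dom M f = [hd (Dom M f)]" using Dom_unary[of f] by auto
  show "CDom unary_cat f \<in> CObj unary_cat" "CCod unary_cat f \<in> CObj unary_cat"
    using in_Dom_Obj[OF f(1), of "hd (Dom M f)"] f Cod_Obj by (auto, metis list.set_intros(1))
  show "CComp unary_cat f (CId unary_cat (CDom unary_cat f)) = f"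
    "CComp unary_cat (CId unary_cat (CCod unary_cat f)) f = f"
    using Comp_Idt[OF f(1)] Idt_Comp[OF f(1)] f(2) by (auto, metis list.simps(8,9))
qed (use Idt_type in auto)

lemma uhom_unary:
  assumes "f \<in> CArr unary_cat" shows "uhom (CDom unary_cat f) f (CCod unary_cat f)"
proof -
  have f: "f \<in> Arr M" "Dom M f = [hd (Dom M f)]" using assms Dom_unary[of f] by auto
  obtain A where A: "Dom M f = [A]" using f(2) by blast
  have AO: "A \<in> Obj M" using in_Dom_Obj[OF f(1)] A by auto
  have "Comp M f [U A p] \<in> Arr M" for p using Comp_type[of f "[U A p]"] f(1) A AO by auto
  then have "\<forall>p. Comp M f [U A p] = Comp M (U (Cod M f) p) (replicate p f)"
    using Arr_ishom[OF f(1)] by (simp add: ishom_def A transpose_perm_Suc_0 Act_id)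
  then show ?thesis using f(1) A AO Cod_Obj by (simp add: uhom_def)
qed

lemma uhoms_seq:
  assumes "(fs, X) \<in> Arr (seq_of unary_cat)"
  shows "uhoms (map (CDom unary_cat) fs) fs X"
proof -
  have "uhom (CDom unary_cat f) f X" if "f \<in> set fs" for f
    using assms uhom_unary[of f] that by (auto simp del: unary_cat_simps(2) simp: subsetD)
  then show ?thesis using assms by (auto simp: uhoms_def list_all2_conv_all_nth)
qed

lemma sequential: "sequential M"
proof -
  let ?N = "seq_of unary_cat"
  interpret C: category unary_cat by (rule category_unary_cat)
  \<comment> \<open>Tupling is the explicit direction of the isomorphism: \<open>Comp_tup\<close>
    and \<open>Act_tup\<close> make it a functor, \<open>proj_tup\<close> and
    \<open>tup_proj\<close> a bijection on arrows.\<close>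
  define G where "G = (\<lambda>A\<in>Obj M. A, \<lambda>(fs, X)\<in>Arr ?N. tup X fs)"
  have G: "snd G (fs, X) = tup X fs" if "(fs, X) \<in> Arr ?N" for fs X
    using that by (simp add: G_def)
  have Comp_G: "snd G (Comp ?N f gs) = Comp M (snd G f) (map (snd G) gs)"
    if f: "f \<in> Arr ?N" "set gs \<subseteq> Arr ?N" "map (Cod ?N) gs = Dom ?N f" for f gs
  proof -
    obtain fs X where fX: "f = (fs, X)" by (cases f)
    let ?is = "map (CDom unary_cat) fs" and ?iss = "map (\<lambda>g. map (CDom unary_cat) (fst g)) gs"
    note u = uhoms_seq[of fs X, folded fX, OF f(1)]
    have l: "length gs = length fs" using f(3) fX by (metis length_map seq_of_simps(3))
    have cod: "snd (gs ! k) = ?is ! k" if "k < length fs" for k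
      using arg_cong[OF f(3), of "\<lambda>xs. xs ! k"] that l by (cases "gs ! k") (simp add: fX)
    have g: "gs ! k \<in> Arr ?N" if "k < length fs" for k using that l f(2) by auto
    have "uhoms (?iss ! k) (map fst gs ! k) (?is ! k)" if k: "k < length ?is" for k
    proof -
      have "(fst (gs ! k), ?is ! k) \<in> Arr ?N" using g[of k] cod[of k] k by (metis length_map prod.collapse)
      from uhoms_seq[OF this] show ?thesis using k l by simp
    qed
    then have "Comp M (tup X fs) (map2 tup ?is (map fst gs)) =
        tup X (concat (map2 (\<lambda>f gs. map (\<lambda>g. Comp M f [g]) gs) fs (map fst gs)))"
      by (intro Comp_tup(1)[OF u, of ?iss]) (simp_all add: l)
    moreover have "map2 tup ?is (map fst gs) = map (snd G) gs"
    proof (rule nth_equalityI)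
      fix k assume "k < length (map2 tup ?is (map fst gs))"
      then have k: "k < length fs" using l by simp
      have "gs ! k = (fst (gs ! k), ?is ! k)" using cod[OF k] by (metis prod.collapse)
      then have "snd G (gs ! k) = tup (?is ! k) (fst (gs ! k))" using G[of "fst (gs ! k)" "?is ! k"] g[OF k] by argo
      then show "map2 tup ?is (map fst gs) ! k = map (snd G) gs ! k" using k l by simp
    qed (simp add: l)
    moreover have "map2 (\<lambda>f gs. map (\<lambda>g. Comp M f [g]) gs) fs (map fst gs) =
        map2 (\<lambda>f g. map (CComp unary_cat f) (fst g)) fs gs"
      by (rule nth_equalityI) (auto simp: l)
    moreover have "Comp ?N f gs \<in> Arr ?N"
      by (rule seq_of_Comp_type[OF category_unary_cat f])
    ultimately show ?thesis using f(1) G by (simp add: fX del: seq_of_simps(2))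
  qed
  have "G \<in> sfunctors ?N M"
  proof (rule sfunctorsI)
    show "fst G \<in> extensional (Obj ?N)" "snd G \<in> extensional (Arr ?N)" by (simp_all add: G_def)
    show "A \<in> Obj ?N \<Longrightarrow> fst G A \<in> Obj M" for A by (simp add: G_def)
    show "A \<in> Obj ?N \<Longrightarrow> snd G (Idt ?N A) = Idt M (fst G A)" for A
      using Idt_type[of A] G[of "[Idt M A]" A] tup_singleton[OF uhom_Idt] by (simp add: G_def)
    fix f assume f: "f \<in> Arr ?N"
    obtain fs X where fX: "f = (fs, X)" by (cases f)
    note u = uhoms_seq[of fs X, folded fX, OF f]
    have "set (map (CDom unary_cat) fs) \<subseteq> Obj M" "X \<in> Obj M" using uhomsD(1,2)[OF u] by auto
    then have "map (fst G) (map (CDom unary_cat) fs) = map (CDom unary_cat) fs" "fst G X = X"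
      by (auto simp: G_def intro!: map_idI)
    then show "snd G f \<in> Arr M" "Dom M (snd G f) = map (fst G) (Dom ?N f)" "Cod M (snd G f) = fst G (Cod ?N f)"
      using tup_type[OF u] G[of fs X] f by (simp_all add: fX del: seq_of_simps(2) map_map)
    show "snd G (Act ?N \<sigma> f) = Act M \<sigma> (snd G f)" if s: "\<sigma> permutes {..<length (Dom ?N f)}" for \<sigma>
    proof -
      have s: "\<sigma> permutes {..<length (map (CDom unary_cat) fs)}" using s fX by simp
      have "Act ?N \<sigma> f \<in> Arr ?N" using f s by (simp add: fX)
      then show ?thesis using G f Act_tup(1)[OF u s] by (simp add: fX del: seq_of_simps(2))
    qed
  qed (rule Comp_G)
  moreover have "bij_betw (fst G) (Obj ?N) (Obj M)"
    by (auto simp: G_def bij_betw_def inj_on_def)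
  moreover have "bij_betw (snd G) (Arr ?N) (Arr M)"
    unfolding bij_betw_def
  proof
    show "inj_on (snd G) (Arr ?N)"
    proof (rule inj_onI)
      fix f g assume fg: "f \<in> Arr ?N" "g \<in> Arr ?N" "snd G f = snd G g"
      obtain fs X gs Y where f: "f = (fs, X)" and g: "g = (gs, Y)" by (cases f, cases g)
      note u = uhoms_seq[of fs X, folded f, OF fg(1)] and v = uhoms_seq[of gs Y, folded g, OF fg(2)]
      have eq: "tup X fs = tup Y gs" using fg G f g by auto
      have X: "X = Y" using tup_type(3)[OF u] tup_type(3)[OF v] eq by simp
      have D: "map (CDom unary_cat) fs = map (CDom unary_cat) gs"
        using tup_type(2)[OF u] tup_type(2)[OF v] eq by simp
      then have l: "length fs = length gs" by (metis length_map)
      have "fs = gs"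
      proof (rule nth_equalityI)
        fix k assume "k < length fs"
        then show "fs ! k = gs ! k" using proj_tup[OF u, of k] proj_tup[OF v, of k] D eq X l by simp
      qed (rule l)
      then show "f = g" using f g X by simp
    qed
    have "\<exists>f\<in>Arr ?N. h = snd G f" if h: "h \<in> Arr M" for h
    proof -
      let ?fs = "map (proj (Dom M h) h) [0..<length (Dom M h)]"
      have "uhoms (Dom M h) ?fs (Cod M h)" using uhoms_proj Arr_ishom[OF h] by simp
      then have fs: "(?fs, Cod M h) \<in> Arr ?N"
        using uhomD[OF uhomsD(7)] h Cod_Obj by fastforce
      have "h = snd G (?fs, Cod M h)" unfolding G[OF fs] tup_proj[OF Arr_ishom[OF h]] ..
      then show ?thesis using fs by blast
    qed
    then show "snd G ` Arr ?N = Arr M"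
      using \<open>G \<in> sfunctors ?N M\<close> by (auto simp: sfunctorsD)
  qed
  moreover have "Act ?N \<sigma> f \<in> Arr ?N" if "f \<in> Arr ?N" "\<sigma> permutes {..<length (Dom ?N f)}" for f \<sigma>
    using that by (cases f) auto
  moreover have "set (Dom ?N f) \<subseteq> Obj ?N" "Cod ?N f \<in> Obj ?N" if "f \<in> Arr ?N" for f
    using that C.CDom_CObj by (cases f; auto)+
  moreover have "Idt ?N A \<in> Arr ?N" if "A \<in> Obj ?N" for A
    using that Idt_type by auto
  ultimately have "smulticat_iso M ?N"
    using seq_of_Comp_type[OF category_unary_cat] by (intro smulticat_isoI) blast+
  then show ?thesis
    using category_unary_cat symm_multicat_axioms unfolding sequential_def by blast
qed

text \<open>As arrows of \<open>M\<close> the operations \<open>V n\<close> are homomorphisms for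
  \<open>U\<close>. A nullary homomorphism is the empty tuple, so the units agree; inserting units
  into all but one argument of \<open>V n\<close> gives \<open>V 1\<close>, so its unary components
  are identities and \<open>V n\<close> is their tuple.\<close>

lemma monoid_unique:
  assumes A: "A \<in> Obj M"
    and V: "\<And>n. V n \<in> Arr M \<and> Dom M (V n) = replicate n A \<and> Cod M (V n) = A"
    and V_1: "V 1 = Idt M A"
    and V_Comp: "\<And>ms. Comp M (V (length ms)) (map V ms) = V (sum_list ms)"
  shows "V n = U A n"
proof -
  have h: "ishom (replicate n A) (V n) A" for n using Arr_ishom[of "V n"] V by simp
  have 0: "V 0 = U A 0"
    using tup_proj[OF h[of 0]] Comp_Idt[of "U A 0"] A by (simp add: tup_def)
  have "proj (replicate n A) (V n) k = Idt M A" if k: "k < n" for k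
  proof -
    have eq: "map (\<lambda>l. U (replicate n A ! l) (if l = k then 1 else 0)) [0..<n] =
        map V (map (\<lambda>l. if l = k then 1 else 0) [0..<n])"
      using 0 V_1 U_1[OF A] by auto
    then show ?thesis
      using V_Comp[of "map (\<lambda>l. if l = k then 1 else 0) [0..<n]"] V_1 k
      unfolding proj_def length_replicate eq sum_list_map_if_eq by simp
  qed
  then have "map (proj (replicate n A) (V n)) [0..<n] = replicate n (Idt M A)"
    by (intro map_eq_replicate) auto
  then show ?thesis using tup_proj[OF h[of n]] tup_replicate_Idt[OF A] by simp
qed

lemma sfunctor_preserves_monoid:
  assumes N: "cmon_family N I E W" and F: "F \<in> sfunctors N M" and i: "i \<in> I"
  shows "snd F (W i n) = U (fst F (E i)) n"
proof -
  interpret N: cmon_family N I E W by fact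
  note E = N.E_Obj[OF i]
  show ?thesis
  proof (rule monoid_unique)
    fix ms
    have "Comp M (snd F (W i (length ms))) (map (snd F) (map (W i) ms)) =
        snd F (Comp N (W i (length ms)) (map (W i) ms))"
      by (rule sfunctorsD(6)[OF F, symmetric]) (use i in \<open>auto intro: map_eq_replicate\<close>)
    then show "Comp M (snd F (W i (length ms))) (map (\<lambda>n. snd F (W i n)) ms) = snd F (W i (sum_list ms))"
      using N.U_Comp[OF i] by (simp add: comp_def)
  qed (use F i E in \<open>auto simp: sfunctorsD N.U_1[unfolded One_nat_def]\<close>)
qed

end

lemma sequential_structure_exists:
  fixes S :: "('o, 'a) smulticat"
  assumes "sequential S" obtains U where "sequential_structure S U"
proof -
  obtain C :: "('o, 'a) cat" and F G where S: "symm_multicat S" and C: "category C"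
    and F: "F \<in> sfunctors S (seq_of C)" and G: "G \<in> sfunctors (seq_of C) S"
    and GF: "sfun_comp S G F = sfun_id S" and FG: "sfun_comp (seq_of C) F G = sfun_id (seq_of C)"
    using assms unfolding sequential_def smulticat_iso_def by blast
  interpret symm_multicat S by fact
  interpret C: category C by fact
  let ?N = "seq_of C"
  have gf: "A \<in> Obj S \<Longrightarrow> fst G (fst F A) = A" "f \<in> Arr S \<Longrightarrow> snd G (snd F f) = f" for A f
    using GF by (metis fst_sfun_comp fst_sfun_id, metis snd_sfun_comp snd_sfun_id)
  \<comment> \<open>These sequences of identities are the monoid operations of
    \<open>C\<^sub>\<triangleright>\<close>; they are carried to \<open>S\<close> along the
    isomorphism.\<close>
  define w where "w X n = (replicate n (CId C X), X)" for X n
  have w: "w X n \<in> Arr ?N" "Dom ?N (w X n) = replicate n X" "Cod ?N (w X n) = X" if "X \<in> CObj C" for X n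
    using C.CId_type[OF that] that by (auto simp: w_def)
  have w_Comp: "Comp ?N (w X n) (map (\<lambda>fs. (fs, X)) fss) = (concat fss, X)"
    if "X \<in> CObj C" "length fss = n" "\<forall>fs\<in>set fss. (fs, X) \<in> Arr ?N" for X n fss
  proof -
    have "map2 (\<lambda>f g. map (CComp C f) (fst g)) (replicate n (CId C X)) (map (\<lambda>fs. (fs, X)) fss) = fss"
    proof (rule nth_equalityI)
      fix k assume "k < length (map2 (\<lambda>f g. map (CComp C f) (fst g)) (replicate n (CId C X)) (map (\<lambda>fs. (fs, X)) fss))"
      then have k: "k < n" "(fss ! k, X) \<in> Arr ?N" using that by auto
      then have "map (CComp C (CId C X)) (fss ! k) = fss ! k"
        using C.CId_CComp by (intro map_idI) (metis seq_of_simps(2) subsetD)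
      then show "map2 (\<lambda>f g. map (CComp C f) (fst g)) (replicate n (CId C X)) (map (\<lambda>fs. (fs, X)) fss) ! k = fss ! k"
        using k that by simp
    qed (use that in simp)
    then show ?thesis by (simp add: w_def)
  qed
  define U where "U A n = snd G (w (fst F A) n)" for A n
  have FO: "fst F A \<in> CObj C" if "A \<in> Obj S" for A using that F by (auto dest: sfunctorsD(1))
  interpret U: cmon_family S "Obj S" "\<lambda>A. A" U
  proof
    fix A assume A: "A \<in> Obj S"
    note wA = w[OF FO[OF A]]
    show "A \<in> Obj S" by fact
    show "U A n \<in> Arr S \<and> Dom S (U A n) = replicate n A \<and> Cod S (U A n) = A" for n
      using wA G gf(1)[OF A] by (auto simp: U_def sfunctorsD)
    show "U A 1 = Idt S A"
      using sfunctorsD(5)[OF G, of "fst F A"] FO[OF A] gf(1)[OF A] by (simp add: U_def w_def)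
    show "Comp S (U A (length ms)) (map (U A) ms) = U A (sum_list ms)" for ms
    proof -
      have "Comp S (U A (length ms)) (map (U A) ms) =
          snd G (Comp ?N (w (fst F A) (length ms)) (map (w (fst F A)) ms))"
        using wA by (subst sfunctorsD(6)[OF G]) (auto simp: U_def[abs_def] comp_def intro!: map_eq_replicate)
      also have "Comp ?N (w (fst F A) (length ms)) (map (w (fst F A)) ms) = w (fst F A) (sum_list ms)"
        using w_Comp[OF FO[OF A], of "map (\<lambda>n. replicate n (CId C (fst F A))) ms" "length ms"] wA
        by (simp add: w_def[abs_def] comp_def concat_map_replicate_eq)
      finally show ?thesis by (simp add: U_def[abs_def])
    qed
    show "Act S \<sigma> (U A n) = U A n" if s: "\<sigma> permutes {..<n}" for \<sigma> n
    proof -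
      show ?thesis
        using sfunctorsD(7)[OF G, of "w (fst F A) n" \<sigma>] wA s
        by (simp add: U_def) (simp add: w_def permute_list_replicate)
    qed
  qed
  have "U.ishom (Dom S h) h (Cod S h)" if h: "h \<in> Arr S" for h
  proof -
    obtain fs X where fX: "snd F h = (fs, X)" by (cases "snd F h")
    have fh: "(fs, X) \<in> Arr ?N" using F h fX by (metis sfunctorsD(2))
    have Gh: "snd G (fs, X) = h" using gf(2)[OF h] fX by simp
    have X: "fst F (Cod S h) = X" using sfunctorsD(4)[OF F h] fX by simp
    have D: "map (fst F) (Dom S h) = map (CDom C) fs" using sfunctorsD(3)[OF F h] fX by simp
    have l: "length (Dom S h) = length fs" using D by (metis length_map)
    have XO: "X \<in> CObj C" using fh by simp
    have "Comp S (U (Cod S h) p) (replicate p h) =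
        Act S (transpose_perm p (length (Dom S h))) (Comp S h (map (\<lambda>A. U A p) (Dom S h)))" for p
    proof -
      let ?ws = "map (\<lambda>A. w (fst F A) p) (Dom S h)"
      have ws: "set ?ws \<subseteq> Arr ?N" "map (Cod ?N) ?ws = Dom ?N (fs, X)"
        unfolding seq_of_simps(3) D[symmetric] using w(1,3)[OF FO[OF in_Dom_Obj[OF h]]] by auto
      \<comment> \<open>Inserting the operations below the sequence repeats each entry
        \<open>p\<close> times, whereas inserting the sequence into \<open>w X p\<close> repeats the
        whole list; the two differ by a transposition.\<close>
      have "map2 (\<lambda>f g. map (CComp C f) (fst g)) fs ?ws = map (replicate p) fs"
      proof (rule nth_equalityI)
        fix k assume "k < length (map2 (\<lambda>f g. map (CComp C f) (fst g)) fs ?ws)"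
        then have k: "k < length fs" by simp
        then have "fst F (Dom S h ! k) = CDom C (fs ! k)"
          using arg_cong[OF D, of "\<lambda>xs. xs ! k"] l by simp
        moreover have "fs ! k \<in> CArr C" using k fh by auto
        ultimately show "map2 (\<lambda>f g. map (CComp C f) (fst g)) fs ?ws ! k = map (replicate p) fs ! k"
          using k l C.CComp_CId by (simp add: w_def map_replicate)
      qed (simp add: l)
      then have C_ws: "Comp ?N (fs, X) ?ws = (concat (map (replicate p) fs), X)" by simp
      have "Comp S (U (Cod S h) p) (replicate p h) =
          Comp S (snd G (w X p)) (map (snd G) (replicate p (fs, X)))"
        by (simp add: U_def X Gh)
      also have "\<dots> = snd G (Comp ?N (w X p) (replicate p (fs, X)))"
        using w[OF XO] fh by (subst sfunctorsD(6)[OF G]) (auto simp del: seq_of_simps(2))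
      also have "Comp ?N (w X p) (replicate p (fs, X)) = (concat (replicate p fs), X)"
        using w_Comp[OF XO, of "replicate p fs" p] fh by simp
      also have "\<dots> = Act ?N (transpose_perm p (length fs)) (Comp ?N (fs, X) ?ws)"
        unfolding C_ws by (simp add: permute_list_transpose_perm_replicate)
      also have "snd G \<dots> = Act S (transpose_perm p (length fs)) (snd G (Comp ?N (fs, X) ?ws))"
      proof (rule sfunctorsD(7)[OF G seq_of_Comp_type[OF C fh ws]])
        show "transpose_perm p (length fs) permutes {..<length (Dom ?N (Comp ?N (fs, X) ?ws))}"
          unfolding C_ws using permutes_transpose_perm[of p "length fs"]
          by (simp add: length_concat comp_def sum_list_triv mult.commute)
      qed
      also have "snd G (Comp ?N (fs, X) ?ws) = Comp S h (map (snd G) ?ws)"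
        using sfunctorsD(6)[OF G fh ws] Gh by simp
      also have "map (snd G) ?ws = map (\<lambda>A. U A p) (Dom S h)" by (simp add: U_def)
      finally show ?thesis by (simp add: l)
    qed
    then show ?thesis using h Cod_Obj Dom_Obj by (auto simp: U.ishom_def)
  qed
  then have "sequential_structure S U" by unfold_locales
  then show ?thesis by (rule that)
qed

section \<open>The internal hom from the terminal multicategory\<close>

text \<open>Arrows of \<open>1\<^sub>\<triangleright>\<close> are determined by their arity, and
  composition adds arities, so \<open>un n\<close> is the generic \<open>n\<close>-fold
  multiplication.\<close>

definition un :: "nat \<Rightarrow> unit list \<times> unit"
  where "un n = (replicate n (), ())"

lemma unit_list_eq_replicate: "fs = replicate (length fs) ()"
  by (induction fs) auto

lemma unit_list_eqI: "length fs = length gs \<Longrightarrow> fs = (gs :: unit list)"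
  by (metis unit_list_eq_replicate)

lemma un_length: "un (length (fst w)) = w"
  by (cases w) (auto simp: un_def simp flip: unit_list_eq_replicate)

lemma length_fst_un [simp]: "length (fst (un n)) = n"
  by (simp add: un_def)

lemma one_seq_simps [simp]:
  "Obj one_seq = UNIV" "Arr one_seq = UNIV" "Dom one_seq w = fst w" "Cod one_seq w = ()"
  "Idt one_seq x = un 1"
  by (auto simp: one_seq_def terminal_cat_def seq_of_def un_def split: prod.splits intro!: unit_list_eqI)

lemma Comp_one_seq [simp]:
  assumes "length ws = n"
  shows "Comp one_seq (un n) ws = un (\<Sum>w\<leftarrow>ws. length (fst w))"
proof -
  have "map2 (\<lambda>f g. map (CComp terminal_cat f) (fst g)) (replicate n ()) ws =
      map (\<lambda>w. map (CComp terminal_cat ()) (fst w)) ws"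
    using assms by (rule map2_replicate_left)
  then show ?thesis
    by (auto simp: one_seq_def un_def length_concat comp_def intro!: unit_list_eqI)
qed

lemma Act_one_seq [simp]: "Act one_seq \<sigma> w = w"
  by (cases w) (auto simp: one_seq_def intro!: unit_list_eqI)

lemma un_cases: obtains n where "w = un n"
  using un_length[of w] by metis

lemma Comp_one_seq': "length ws = length (fst w) \<Longrightarrow> Comp one_seq w ws = un (\<Sum>w\<leftarrow>ws. length (fst w))"
  using Comp_one_seq un_length by metis

lemma symm_multicat_one_seq: "symm_multicat one_seq"
proof
  fix f :: "unit list \<times> unit" and gs hss
  assume gs: "map (Cod one_seq) gs = Dom one_seq f" "length hss = length gs"
    and hss: "map (map (Cod one_seq)) hss = map (Dom one_seq) gs"
  have l1: "length gs = length (fst f)" using gs(1) by (metis length_map one_seq_simps(3))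
  have "map length (map (map (Cod one_seq)) hss) = map length (map (Dom one_seq) gs)"
    unfolding hss ..
  then have l: "length gs = length (fst f)" "length hss = length (fst f)"
    "map length hss = map (\<lambda>w. length (fst w)) gs"
    using l1 gs(2) by (simp_all add: comp_def)
  have "map (\<lambda>w. length (fst w)) (map2 (Comp one_seq) gs hss) =
      map (\<lambda>hs. \<Sum>w\<leftarrow>hs. length (fst w)) hss"
  proof (rule nth_equalityI)
    fix k assume "k < length (map (\<lambda>w. length (fst w)) (map2 (Comp one_seq) gs hss))"
    then have k: "k < length gs" "k < length hss" using l by auto
    then have "length (hss ! k) = length (fst (gs ! k))"
      using arg_cong[OF l(3), of "\<lambda>xs. xs ! k"] by simp
    then show "map (\<lambda>w. length (fst w)) (map2 (Comp one_seq) gs hss) ! k =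
        map (\<lambda>hs. \<Sum>w\<leftarrow>hs. length (fst w)) hss ! k"
      using k by (simp add: Comp_one_seq')
  qed (simp add: l)
  then show "Comp one_seq f (map2 (Comp one_seq) gs hss) = Comp one_seq (Comp one_seq f gs) (concat hss)"
    using l by (simp add: Comp_one_seq' length_concat sum_list_concat_eq map_concat comp_def)
next
  fix f :: "unit list \<times> unit" and gs \<sigma>
  assume "map (Cod one_seq) gs = Dom one_seq f" "\<sigma> permutes {..<length (Dom one_seq f)}"
  then have l: "length gs = length (fst f)" and s: "\<sigma> permutes {..<length gs}"
    by (metis length_map one_seq_simps(3), metis length_map one_seq_simps(3))
  have "sum_mset (mset (map (\<lambda>w. length (fst w)) (permute_list \<sigma> gs))) =
      sum_mset (mset (map (\<lambda>w. length (fst w)) gs))"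
    using s by simp
  then show "Comp one_seq (Act one_seq \<sigma> f) (permute_list \<sigma> gs) =
    Act one_seq (block_perm \<sigma> (map (\<lambda>g. length (Dom one_seq g)) gs)) (Comp one_seq f gs)"
    using l unfolding sum_mset_sum_list by (simp add: Comp_one_seq')
next
  fix f :: "unit list \<times> unit" and gs \<sigma>s
  assume "map (Cod one_seq) gs = Dom one_seq f"
    "list_all2 (\<lambda>\<sigma> g. \<sigma> permutes {..<length (Dom one_seq g)}) \<sigma>s gs"
  then have "map2 (Act one_seq) \<sigma>s gs = gs"
    by (intro nth_equalityI) (auto dest: list_all2_lengthD)
  then show "Comp one_seq f (map2 (Act one_seq) \<sigma>s gs) =
      Act one_seq (sum_perm \<sigma>s (map (\<lambda>g. length (Dom one_seq g)) gs)) (Comp one_seq f gs)" by simp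
next
  fix f :: "unit list \<times> unit" and gs
  assume gs: "map (Cod one_seq) gs = Dom one_seq f"
  then have "length gs = length (fst f)" by (metis length_map one_seq_simps(3))
  then show "Comp one_seq f gs \<in> Arr one_seq \<and> Dom one_seq (Comp one_seq f gs) = concat (map (Dom one_seq) gs) \<and>
      Cod one_seq (Comp one_seq f gs) = Cod one_seq f"
    by (auto simp: Comp_one_seq' length_concat comp_def intro!: unit_list_eqI)
qed (auto simp: Comp_one_seq' un_def comp_def sum_list_triv prod_eq_iff intro!: unit_list_eqI)

text \<open>A functor from \<open>1\<^sub>\<triangleright>\<close> amounts to a commutative monoid,
  so the functors themselves serve as index set. Several of them may share the object
  \<open>fst F ()\<close>.\<close>

lemma (in symm_multicat) cmon_family_one_seq:
  "cmon_family M (sfunctors one_seq M) (\<lambda>F. fst F ()) (\<lambda>F n. snd F (un n))"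
proof (intro cmon_family.intro symm_multicat_axioms cmon_family_axioms.intro)
  fix F assume F: "F \<in> sfunctors one_seq M"
  note D = sfunctorsD[OF F, simplified]
  show "fst F () \<in> Obj M" using D by simp
  show "snd F (un n) \<in> Arr M \<and> Dom M (snd F (un n)) = replicate n (fst F ()) \<and> Cod M (snd F (un n)) = fst F ()" for n
    using D by (auto simp: un_def map_replicate)
  show "snd F (un 1) = Idt M (fst F ())" using D by simp
  show "Comp M (snd F (un (length ms))) (map (\<lambda>n. snd F (un n)) ms) = snd F (un (sum_list ms))" for ms
    using D(6)[of "map un ms" "un (length ms)"] unit_list_eqI[of "map (\<lambda>_. ()) ms" "fst (un (length ms))"]
    by (simp add: comp_def)
  show "Act M \<sigma> (snd F (un n)) = snd F (un n)" if "\<sigma> permutes {..<n}" for \<sigma> n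
    using D(7)[of \<sigma> "un n"] that by simp
qed

text \<open>The converse passage, from monoids to functors. The carriers of \<open>one_seq\<close>
  are whole types, so both maps are written without \<open>restrict\<close>.\<close>

lemma (in cmon_family) functor_of_monoid:
  assumes i: "i \<in> I"
  shows "(\<lambda>_. E i, \<lambda>w. U i (length (fst w))) \<in> sfunctors one_seq M"
proof (rule sfunctorsI)
  fix w :: "unit list \<times> unit" and ws assume "map (Cod one_seq) ws = Dom one_seq w"
  then have "length ws = length (fst w)" by (metis length_map one_seq_simps(3))
  then show "snd (\<lambda>_. E i, \<lambda>w. U i (length (fst w))) (Comp one_seq w ws) =
      Comp M (snd (\<lambda>_. E i, \<lambda>w. U i (length (fst w))) w) (map (snd (\<lambda>_. E i, \<lambda>w. U i (length (fst w)))) ws)"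
    using U_Comp[OF i, of "map (\<lambda>w. length (fst w)) ws"] by (simp add: Comp_one_seq' comp_def)
qed (use i E_Obj[OF i] U_1[OF i] in \<open>auto simp: U_Act map_replicate_const\<close>)

text \<open>Over \<open>1\<^sub>\<triangleright>\<close> an arrow of the internal hom is its domain, its single component and its codomain.\<close>

abbreviation component :: "(unit, 'b, 'p, 'c) strans \<Rightarrow> 'c"
  where "component t \<equiv> fst (snd t) ()"

lemma one_ihom_simps [simp]:
  "Obj (one_ihom M) = sfunctors one_seq M"
  "Dom (one_ihom M) t = fst t"
  "Cod (one_ihom M) t = snd (snd t)"
  "Idt (one_ihom M) F = ([F], \<lambda>_. Idt M (fst F ()), F)"
  "Comp (one_ihom M) t ts = (concat (map fst ts), \<lambda>_. Comp M (component t) (map component ts), snd (snd t))"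
  "Act (one_ihom M) \<sigma> t = (permute_list \<sigma> (fst t), \<lambda>_. Act M \<sigma> (component t), snd (snd t))"
  by (simp_all add: ihom_def case_prod_unfold restrict_def)

lemma one_ihom_sel:
  "fst (Comp (one_ihom M) t ts) = concat (map fst ts)"
  "component (Comp (one_ihom M) t ts) = Comp M (component t) (map component ts)"
  "fst (Act (one_ihom M) \<sigma> t) = permute_list \<sigma> (fst t)"
  "component (Act (one_ihom M) \<sigma> t) = Act M \<sigma> (component t)"
  by simp_all

lemma strans_eqI: "fst s = fst t \<Longrightarrow> component s = component t \<Longrightarrow> snd (snd s) = snd (snd t) \<Longrightarrow> s = t"
  by (auto simp: prod_eq_iff fun_eq_iff)

section \<open>The internal hom as a multicategory of monoids and homomorphisms\<close>

context symm_multicat begin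

interpretation H: cmon_family M "sfunctors one_seq M" "\<lambda>F. fst F ()" "\<lambda>F n. snd F (un n)"
  by (rule cmon_family_one_seq)

text \<open>\<open>1\<^sub>\<triangleright>\<close> has one object and the arrows
  \<open>un n\<close>, so the condition on the single component is the homomorphism law for every
  \<open>p\<close>.\<close>

lemma Arr_one_ihom:
  "t \<in> Arr (one_ihom M) \<longleftrightarrow> H.ishom (fst t) (component t) (snd (snd t))"
proof -
  have all_un: "(\<forall>w. P w) \<longleftrightarrow> (\<forall>n. P (un n))" for P by (metis un_length)
  have m: "map f (fst (un n)) = replicate n (f ())" for f :: "unit \<Rightarrow> 'a" and n by (simp add: un_def)
  obtain Fs \<alpha> F where t: "t = (Fs, \<alpha>, F)" by (cases t)
  have "t \<in> Arr (one_ihom M) \<longleftrightarrow> set Fs \<subseteq> sfunctors one_seq M \<and> F \<in> sfunctors one_seq M \<and>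
      \<alpha> () \<in> Arr M \<and> Dom M (\<alpha> ()) = map (\<lambda>G. fst G ()) Fs \<and> Cod M (\<alpha> ()) = fst F () \<and>
      (\<forall>w. Comp M (snd F w) (map \<alpha> (fst w)) =
        Act M (transpose_perm (length (fst w)) (length Fs)) (Comp M (\<alpha> ()) (map (\<lambda>G. snd G w) Fs)))"
    unfolding t ihom_def stransformations_def by (simp add: PiE_def extensional_def Pi_def)
  also have "\<dots> \<longleftrightarrow> H.ishom Fs (\<alpha> ()) F"
    unfolding H.ishom_def by (subst all_un) (simp only: m length_fst_un)
  finally show ?thesis by (simp add: t)
qed

lemma one_ihom_type:
  assumes "t \<in> Arr (one_ihom M)"
  shows "component t \<in> Arr M" "Dom M (component t) = map (\<lambda>F. fst F ()) (fst t)"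
    "Cod M (component t) = fst (snd (snd t)) ()"
    "set (fst t) \<subseteq> sfunctors one_seq M" "snd (snd t) \<in> sfunctors one_seq M"
  using assms by (auto simp: Arr_one_ihom H.ishom_def)

lemma one_ihom_components:
  assumes "set ts \<subseteq> Arr (one_ihom M)" "map (Cod (one_ihom M)) ts = Dom (one_ihom M) t" "t \<in> Arr (one_ihom M)"
  shows "set (map component ts) \<subseteq> Arr M" "map (Cod M) (map component ts) = Dom M (component t)"
proof -
  show "set (map component ts) \<subseteq> Arr M" using assms(1) one_ihom_type(1) by auto
  have "map (Cod M) (map component ts) = map (\<lambda>F. fst F ()) (map (Cod (one_ihom M)) ts)"
    using assms(1) one_ihom_type(3) by auto
  then show "map (Cod M) (map component ts) = Dom M (component t)"
    using assms one_ihom_type(2) by simp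
qed

lemma one_ihom_Comp_Arr:
  assumes "t \<in> Arr (one_ihom M)" "set ts \<subseteq> Arr (one_ihom M)" "map (Cod (one_ihom M)) ts = Dom (one_ihom M) t"
  shows "Comp (one_ihom M) t ts \<in> Arr (one_ihom M)"
proof -
  have l: "length ts = length (fst t)" using assms(3) by (metis length_map one_ihom_simps(2))
  have "H.ishom (fst (ts ! k)) (component (ts ! k)) (fst t ! k)" if "k < length (fst t)" for k
  proof -
    have "snd (snd (ts ! k)) = fst t ! k"
      using arg_cong[OF assms(3), of "\<lambda>xs. xs ! k"] l that by (simp only: nth_map one_ihom_simps(2,3))
    moreover have "ts ! k \<in> Arr (one_ihom M)" using assms(2) l that by auto
    ultimately show ?thesis unfolding Arr_one_ihom by simp
  qed
  then show ?thesis
    using assms(1) l unfolding Arr_one_ihom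
    by (auto intro!: H.ishom_Comp[where iss = "map fst ts" and gs = "map component ts"])
qed

text \<open>Components obey the axioms of \<open>M\<close>, and domains those of lists of labels.
  Homomorphisms matter for closure alone, which comes from \<open>H.ishom_Idt\<close>,
  \<open>H.ishom_Comp\<close> and \<open>H.ishom_Act\<close>.\<close>

lemma symm_multicat_one_ihom: "symm_multicat (one_ihom M)"
proof
  note [simp] = one_ihom_type
  fix t assume t: "t \<in> Arr (one_ihom M)"
  show "set (Dom (one_ihom M) t) \<subseteq> Obj (one_ihom M)" "Cod (one_ihom M) t \<in> Obj (one_ihom M)"
    using t by simp_all
  show "Comp (one_ihom M) t (map (Idt (one_ihom M)) (Dom (one_ihom M) t)) = t"
    using t Comp_Idt[of "component t"]
    by (intro strans_eqI) (simp_all add: comp_def concat_map_singleton[of "\<lambda>x. x", simplified])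
  show "Comp (one_ihom M) (Idt (one_ihom M) (Cod (one_ihom M) t)) [t] = t"
    using t Idt_Comp[of "component t"] by (intro strans_eqI) simp_all
  show "Act (one_ihom M) id t = t" using t by (intro strans_eqI) (simp_all add: Act_id)
  fix \<sigma> assume s: "\<sigma> permutes {..<length (Dom (one_ihom M) t)}"
  show "Act (one_ihom M) \<sigma> t \<in> Arr (one_ihom M) \<and>
      Dom (one_ihom M) (Act (one_ihom M) \<sigma> t) = permute_list \<sigma> (Dom (one_ihom M) t) \<and>
      Cod (one_ihom M) (Act (one_ihom M) \<sigma> t) = Cod (one_ihom M) t"
    using t s H.ishom_Act by (simp add: Arr_one_ihom)
  fix \<tau> assume "\<tau> permutes {..<length (Dom (one_ihom M) t)}"
  then show "Act (one_ihom M) \<sigma> (Act (one_ihom M) \<tau> t) = Act (one_ihom M) (\<tau> \<circ> \<sigma>) t"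
    using t s by (intro strans_eqI) (simp_all add: Act_Act permute_list_compose)
next
  fix F assume "F \<in> Obj (one_ihom M)"
  then show "Idt (one_ihom M) F \<in> Arr (one_ihom M) \<and> Dom (one_ihom M) (Idt (one_ihom M) F) = [F] \<and>
      Cod (one_ihom M) (Idt (one_ihom M) F) = F"
    using H.ishom_Idt by (simp add: Arr_one_ihom)
next
  fix t ts
  assume t: "t \<in> Arr (one_ihom M)" and ts: "set ts \<subseteq> Arr (one_ihom M)"
    "map (Cod (one_ihom M)) ts = Dom (one_ihom M) t"
  note c = one_ihom_type[OF t] one_ihom_components[OF ts t]
  \<comment> \<open>The arities that fix the permutations are read once from the components and once
    from the domains; each form serves one half of \<open>strans_eqI\<close>.\<close>
  have lens: "map (\<lambda>g. length (Dom (one_ihom M) g)) ts = map (\<lambda>g. length (Dom M g)) (map component ts)"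
    using ts(1) one_ihom_type(2) by (auto simp: subset_code(1))
  have lens': "map (\<lambda>g. length (Dom (one_ihom M) g)) ts = map length (map fst ts)" by simp
  have l: "length ts = length (fst t)" using ts(2) by (metis length_map one_ihom_simps(2))
  show "Comp (one_ihom M) t ts \<in> Arr (one_ihom M) \<and>
      Dom (one_ihom M) (Comp (one_ihom M) t ts) = concat (map (Dom (one_ihom M)) ts) \<and>
      Cod (one_ihom M) (Comp (one_ihom M) t ts) = Cod (one_ihom M) t"
    using one_ihom_Comp_Arr[OF t ts] by (simp del: one_ihom_simps(5)) (simp add: cong: map_cong)
  show "Comp (one_ihom M) (Act (one_ihom M) \<sigma> t) (permute_list \<sigma> ts) =
      Act (one_ihom M) (block_perm \<sigma> (map (\<lambda>g. length (Dom (one_ihom M) g)) ts)) (Comp (one_ihom M) t ts)"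
    if s: "\<sigma> permutes {..<length (Dom (one_ihom M) t)}" for \<sigma>
  proof (rule strans_eqI)
    have s': "\<sigma> permutes {..<length ts}" "\<sigma> permutes {..<length (Dom M (component t))}"
      using s l c(2) by simp_all
    show "fst (Comp (one_ihom M) (Act (one_ihom M) \<sigma> t) (permute_list \<sigma> ts)) =
      fst (Act (one_ihom M) (block_perm \<sigma> (map (\<lambda>g. length (Dom (one_ihom M) g)) ts)) (Comp (one_ihom M) t ts))"
      unfolding lens' using s' permute_list_block_perm[of \<sigma> "map fst ts"] by (simp add: permute_list_map)
    show "component (Comp (one_ihom M) (Act (one_ihom M) \<sigma> t) (permute_list \<sigma> ts)) =
      component (Act (one_ihom M) (block_perm \<sigma> (map (\<lambda>g. length (Dom (one_ihom M) g)) ts)) (Comp (one_ihom M) t ts))"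
      unfolding lens using Comp_Act_outer[OF c(1,6,7) s'(2)] s' by (simp add: permute_list_map)
  qed simp
  show "Comp (one_ihom M) t (map2 (Act (one_ihom M)) \<sigma>s ts) =
      Act (one_ihom M) (sum_perm \<sigma>s (map (\<lambda>g. length (Dom (one_ihom M) g)) ts)) (Comp (one_ihom M) t ts)"
    if s: "list_all2 (\<lambda>\<sigma> g. \<sigma> permutes {..<length (Dom (one_ihom M) g)}) \<sigma>s ts" for \<sigma>s
  proof (rule strans_eqI)
    have s1: "list_all2 (\<lambda>\<sigma> xs. \<sigma> permutes {..<length xs}) \<sigma>s (map fst ts)"
      using s by (simp add: list.rel_map)
    have s2: "list_all2 (\<lambda>\<sigma> g. \<sigma> permutes {..<length (Dom M g)}) \<sigma>s (map component ts)"
      using s ts(1) one_ihom_type(2) by (auto simp: list_all2_conv_all_nth subset_code(1))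
    have m: "map fst (map2 (Act (one_ihom M)) \<sigma>s ts) = map2 permute_list \<sigma>s (map fst ts)"
      "map component (map2 (Act (one_ihom M)) \<sigma>s ts) = map2 (Act M) \<sigma>s (map component ts)"
      using list_all2_lengthD[OF s] by (auto intro!: nth_equalityI)
    show "fst (Comp (one_ihom M) t (map2 (Act (one_ihom M)) \<sigma>s ts)) =
      fst (Act (one_ihom M) (sum_perm \<sigma>s (map (\<lambda>g. length (Dom (one_ihom M) g)) ts)) (Comp (one_ihom M) t ts))"
      unfolding one_ihom_sel m lens' permute_list_sum_perm[OF s1] ..
    show "component (Comp (one_ihom M) t (map2 (Act (one_ihom M)) \<sigma>s ts)) =
      component (Act (one_ihom M) (sum_perm \<sigma>s (map (\<lambda>g. length (Dom (one_ihom M) g)) ts)) (Comp (one_ihom M) t ts))"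
      unfolding one_ihom_sel m lens Comp_Act_inner[OF c(1,6,7) s2] ..
  qed simp
  show "Comp (one_ihom M) t (map2 (Comp (one_ihom M)) ts hss) =
      Comp (one_ihom M) (Comp (one_ihom M) t ts) (concat hss)"
    if hss: "length hss = length ts" "\<forall>hs\<in>set hss. set hs \<subseteq> Arr (one_ihom M)"
      "map (map (Cod (one_ihom M))) hss = map (Dom (one_ihom M)) ts" for hss
  proof (rule strans_eqI)
    have m: "map fst (map2 (Comp (one_ihom M)) ts hss) = map (\<lambda>hs. concat (map fst hs)) hss"
      "map component (map2 (Comp (one_ihom M)) ts hss) =
        map2 (Comp M) (map component ts) (map (map component) hss)"
      using hss(1) by (auto intro!: nth_equalityI)
    have "Cod M (component h) = fst (snd (snd h)) ()" if "hs \<in> set hss" "h \<in> set hs" for hs h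
      using hss(2) that by (intro one_ihom_type) auto
    then have "map (map (Cod M)) (map (map component) hss) =
        map (map (\<lambda>F. fst F ())) (map (map (Cod (one_ihom M))) hss)"
      by simp
    also have "\<dots> = map (Dom M) (map component ts)"
      unfolding hss(3) using ts(1) one_ihom_type(2) by (auto simp: subset_code(1))
    finally have cod: "map (map (Cod M)) (map (map component) hss) = map (Dom M) (map component ts)" .
    have "\<forall>hs\<in>set (map (map component) hss). set hs \<subseteq> Arr M"
      using hss(2) one_ihom_type(1) by fastforce
    then show "component (Comp (one_ihom M) t (map2 (Comp (one_ihom M)) ts hss)) =
        component (Comp (one_ihom M) (Comp (one_ihom M) t ts) (concat hss))"
      using Comp_assoc[OF c(1,6,7) _ _ cod] hss(1)
      unfolding one_ihom_sel m by (simp add: map_concat)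
    show "fst (Comp (one_ihom M) t (map2 (Comp (one_ihom M)) ts hss)) =
        fst (Comp (one_ihom M) (Comp (one_ihom M) t ts) (concat hss))"
      unfolding one_ihom_sel m by (simp add: map_concat concat_concat_eq comp_def)
  qed simp
qed

text \<open>The multiplication of the monoid \<open>F\<close>, seen as a transformation from
  \<open>n\<close> copies of \<open>F\<close> to \<open>F\<close>; commutativity makes it one, by
  \<open>H.ishom_U\<close>.\<close>

definition ihom_monoid :: "(unit, unit list \<times> unit, 'o, 'a) sfun \<Rightarrow> nat \<Rightarrow> (unit, unit list \<times> unit, 'o, 'a) strans"
  where "ihom_monoid F n = (replicate n F, \<lambda>_. snd F (un n), F)"

lemma sequential_structure_one_ihom: "sequential_structure (one_ihom M) ihom_monoid"
proof -
  interpret J: symm_multicat "one_ihom M" by (rule symm_multicat_one_ihom)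
  interpret J: cmon_family "one_ihom M" "Obj (one_ihom M)" "\<lambda>F. F" ihom_monoid
  proof
    fix F assume F: "F \<in> Obj (one_ihom M)"
    then have F': "F \<in> sfunctors one_seq M" by simp
    show "F \<in> Obj (one_ihom M)" by fact
    show "ihom_monoid F n \<in> Arr (one_ihom M) \<and> Dom (one_ihom M) (ihom_monoid F n) = replicate n F \<and>
      Cod (one_ihom M) (ihom_monoid F n) = F" for n
      using H.ishom_U[OF F'] by (simp add: ihom_monoid_def Arr_one_ihom)
    show "ihom_monoid F 1 = Idt (one_ihom M) F"
      using H.U_1[OF F'] by (simp add: ihom_monoid_def)
    show "Comp (one_ihom M) (ihom_monoid F (length ms)) (map (ihom_monoid F) ms) = ihom_monoid F (sum_list ms)" for ms
      using H.U_Comp[OF F', of ms] by (simp add: ihom_monoid_def[abs_def] comp_def concat_map_replicate_eq)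
    show "Act (one_ihom M) \<sigma> (ihom_monoid F n) = ihom_monoid F n" if s: "\<sigma> permutes {..<n}" for \<sigma> n
      using H.U_Act[OF F' s] permute_list_replicate[OF s] by (simp add: ihom_monoid_def)
  qed
  show ?thesis
  proof unfold_locales
    fix t assume t: "t \<in> Arr (one_ihom M)"
    note c = one_ihom_type[OF t]
    have h: "H.ishom (fst t) (component t) (snd (snd t))" using t by (simp add: Arr_one_ihom)
    \<comment> \<open>On components this is the very law that makes \<open>t\<close> an arrow; on
      domains both sides are repetitions of entries of \<open>fst t\<close>, matched by the
      transposition.\<close>
    have "Comp (one_ihom M) (ihom_monoid (Cod (one_ihom M) t) p) (replicate p t) =
        Act (one_ihom M) (transpose_perm p (length (Dom (one_ihom M) t)))
          (Comp (one_ihom M) t (map (\<lambda>F. ihom_monoid F p) (Dom (one_ihom M) t)))" for p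
    proof (rule strans_eqI)
      show "component (Comp (one_ihom M) (ihom_monoid (Cod (one_ihom M) t) p) (replicate p t)) =
        component (Act (one_ihom M) (transpose_perm p (length (Dom (one_ihom M) t)))
          (Comp (one_ihom M) t (map (\<lambda>F. ihom_monoid F p) (Dom (one_ihom M) t))))"
        using h by (simp add: ihom_monoid_def H.ishom_def comp_def)
      show "fst (Comp (one_ihom M) (ihom_monoid (Cod (one_ihom M) t) p) (replicate p t)) =
        fst (Act (one_ihom M) (transpose_perm p (length (Dom (one_ihom M) t)))
          (Comp (one_ihom M) t (map (\<lambda>F. ihom_monoid F p) (Dom (one_ihom M) t))))"
        by (simp add: ihom_monoid_def comp_def permute_list_transpose_perm_replicate)
    qed (simp add: ihom_monoid_def)
    then show "J.ishom (Dom (one_ihom M) t) t (Cod (one_ihom M) t)"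
      unfolding J.ishom_def using t c(4,5) by (simp del: one_ihom_simps(4,5,6))
  qed
qed

end

section \<open>Coreflection\<close>

lemma sfun_comp_assoc:
  assumes "F \<in> sfunctors M N"
  shows "sfun_comp M H (sfun_comp M G F) = sfun_comp M (sfun_comp N H G) F"
  using sfunctorsD(1,2)[OF assms] by (auto simp: sfun_comp_def compose_def fun_eq_iff)

lemma sfun_comp_id_left: "F \<in> sfunctors M N \<Longrightarrow> sfun_comp M (sfun_id N) F = F"
  by (auto simp: sfun_comp_def compose_def sfun_id_def prod_eq_iff fun_eq_iff sfunctorsD(1,2)
      extensional_arb[OF sfunctorsD(8)] extensional_arb[OF sfunctorsD(9)])

section \<open>Evaluation and functoriality of the internal hom\<close>

lemma ihom_eval_simps [simp]:
  "F \<in> sfunctors one_seq M \<Longrightarrow> fst (ihom_eval one_seq M ()) F = fst F ()"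
  "t \<in> Arr (one_ihom M) \<Longrightarrow> snd (ihom_eval one_seq M ()) t = component t"
  by (simp_all add: ihom_eval_def case_prod_beta)

lemma (in symm_multicat) ihom_eval_sfunctors: "ihom_eval one_seq M () \<in> sfunctors (one_ihom M) M"
proof -
  interpret J: symm_multicat "one_ihom M" by (rule symm_multicat_one_ihom)
  show ?thesis
  proof (rule sfunctorsI)
    show "fst (ihom_eval one_seq M ()) \<in> extensional (Obj (one_ihom M))"
      "snd (ihom_eval one_seq M ()) \<in> extensional (Arr (one_ihom M))"
      by (simp_all add: ihom_eval_def)
    show "fst (ihom_eval one_seq M ()) F \<in> Obj M" if "F \<in> Obj (one_ihom M)" for F
      using that by (simp add: sfunctorsD(1))
    show "snd (ihom_eval one_seq M ()) (Idt (one_ihom M) F) = Idt M (fst (ihom_eval one_seq M ()) F)"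
      if F: "F \<in> Obj (one_ihom M)" for F
      using F J.Idt_type[OF F] by simp
    fix t assume t: "t \<in> Arr (one_ihom M)"
    note c = one_ihom_type[OF t]
    show "snd (ihom_eval one_seq M ()) t \<in> Arr M"
      "Dom M (snd (ihom_eval one_seq M ()) t) = map (fst (ihom_eval one_seq M ())) (Dom (one_ihom M) t)"
      "Cod M (snd (ihom_eval one_seq M ()) t) = fst (ihom_eval one_seq M ()) (Cod (one_ihom M) t)"
      using t c by (auto simp: subset_code(1))
    show "snd (ihom_eval one_seq M ()) (Act (one_ihom M) \<sigma> t) = Act M \<sigma> (snd (ihom_eval one_seq M ()) t)"
      if "\<sigma> permutes {..<length (Dom (one_ihom M) t)}" for \<sigma>
      using J.Act_type[OF t that] t by simp
    show "snd (ihom_eval one_seq M ()) (Comp (one_ihom M) t ts) =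
        Comp M (snd (ihom_eval one_seq M ()) t) (map (snd (ihom_eval one_seq M ())) ts)"
      if ts: "set ts \<subseteq> Arr (one_ihom M)" "map (Cod (one_ihom M)) ts = Dom (one_ihom M) t" for ts
    proof -
      have eq: "map (snd (ihom_eval one_seq M ())) ts = map component ts"
        using ts(1) by (auto simp: subset_code(1))
      show ?thesis unfolding eq using one_ihom_Comp_Arr[OF t ts] t by (simp del: one_ihom_simps(5) add: one_ihom_sel)
    qed
  qed
qed

lemma ihom_map_simps [simp]:
  "G \<in> sfunctors one_seq M \<Longrightarrow> fst (one_ihom_map M F) G = sfun_comp one_seq F G"
  "t \<in> Arr (one_ihom M) \<Longrightarrow> snd (one_ihom_map M F) t =
    (map (sfun_comp one_seq F) (fst t), \<lambda>_. snd F (component t), sfun_comp one_seq F (snd (snd t)))"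
  by (simp_all add: ihom_map_def case_prod_beta restrict_def)

text \<open>The homomorphism law is an equation between composites and a permuted composite, so
  \<open>F\<close> preserves it; identities, composition and permutations of transformations are
  formed componentwise.\<close>

lemma (in symm_multicat) ihom_map_sfunctors:
  assumes M': "symm_multicat M'" and F: "F \<in> sfunctors M M'"
  shows "one_ihom_map M F \<in> sfunctors (one_ihom M) (one_ihom M')"
proof -
  interpret M': symm_multicat M' by fact
  interpret O: symm_multicat one_seq by (rule symm_multicat_one_seq)
  interpret J: symm_multicat "one_ihom M" by (rule symm_multicat_one_ihom)
  interpret H: cmon_family M "sfunctors one_seq M" "\<lambda>F. fst F ()" "\<lambda>F n. snd F (un n)"
    by (rule cmon_family_one_seq)
  interpret H': cmon_family M' "sfunctors one_seq M'" "\<lambda>F. fst F ()" "\<lambda>F n. snd F (un n)"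
    by (rule M'.cmon_family_one_seq)
  note comp = O.sfun_comp_sfunctors[OF _ F]
  have Arr: "snd (one_ihom_map M F) t \<in> Arr (one_ihom M')" if t: "t \<in> Arr (one_ihom M)" for t
  proof -
    let ?h = "component t" and ?Fs = "fst t" and ?G = "snd (snd t)"
    note c = one_ihom_type[OF t]
    have h: "H.ishom ?Fs ?h ?G" using t by (simp add: Arr_one_ihom)
    have "Comp M' (snd (sfun_comp one_seq F ?G) (un p)) (replicate p (snd F ?h)) =
        Act M' (transpose_perm p (length ?Fs))
          (Comp M' (snd F ?h) (map (\<lambda>G. snd G (un p)) (map (sfun_comp one_seq F) ?Fs)))" for p
    proof -
      let ?us = "map (\<lambda>G. snd G (un p)) ?Fs"
      have us: "set ?us \<subseteq> Arr M" "map (Cod M) ?us = Dom M ?h"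
        using c H.U_typed by (simp_all add: image_subset_iff subset_code(1) comp_def cong: map_cong)
      have D: "map (Dom M) ?us = map (\<lambda>G. replicate p (fst G ())) ?Fs"
        using c(4) H.U_typed(2) by (simp add: subset_code(1) cong: map_cong)
      have T: "transpose_perm p (length ?Fs) permutes {..<length (Dom M (Comp M ?h ?us))}"
        using permutes_transpose_perm[of p "length ?Fs"] Comp_type[OF c(1) us] unfolding D
        by (simp add: length_concat comp_def sum_list_triv mult.commute)
      have "Comp M' (snd (sfun_comp one_seq F ?G) (un p)) (replicate p (snd F ?h)) =
          snd F (Comp M (snd ?G (un p)) (replicate p ?h))"
        using c sfunctorsD(6)[OF F, of "snd ?G (un p)" "replicate p ?h"] by (auto simp: subset_code(1))
      also have "\<dots> = snd F (Act M (transpose_perm p (length ?Fs)) (Comp M ?h ?us))"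
        using h by (simp add: H.ishom_def)
      also have "\<dots> = Act M' (transpose_perm p (length ?Fs)) (Comp M' (snd F ?h) (map (snd F) ?us))"
        using sfunctorsD(7)[OF F _ T] sfunctorsD(6)[OF F c(1) us] Comp_type[OF c(1) us] by simp
      finally show ?thesis by (simp add: comp_def)
    qed
    then show ?thesis
      unfolding M'.Arr_one_ihom H'.ishom_def using t c comp F by (auto simp: sfunctorsD)
  qed
  have comps: "map component (map (snd (one_ihom_map M F)) ts) = map (snd F) (map component ts)"
    "map fst (map (snd (one_ihom_map M F)) ts) = map (map (sfun_comp one_seq F)) (map fst ts)"
    if "set ts \<subseteq> Arr (one_ihom M)" for ts
    using that by (auto simp: subset_code(1))
  show ?thesis
  proof (rule sfunctorsI)
    show "fst (one_ihom_map M F) \<in> extensional (Obj (one_ihom M))"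
      "snd (one_ihom_map M F) \<in> extensional (Arr (one_ihom M))"
      by (simp_all add: ihom_map_def)
    show "fst (one_ihom_map M F) G \<in> Obj (one_ihom M')" if "G \<in> Obj (one_ihom M)" for G
      using that comp by simp
    show "snd (one_ihom_map M F) (Idt (one_ihom M) G) = Idt (one_ihom M') (fst (one_ihom_map M F) G)"
      if G: "G \<in> Obj (one_ihom M)" for G
      using G J.Idt_type[OF G] F by (simp add: sfunctorsD)
    fix t assume t: "t \<in> Arr (one_ihom M)"
    note c = one_ihom_type[OF t]
    show "snd (one_ihom_map M F) t \<in> Arr (one_ihom M')" by (rule Arr[OF t])
    show "Dom (one_ihom M') (snd (one_ihom_map M F) t) = map (fst (one_ihom_map M F)) (Dom (one_ihom M) t)"
      "Cod (one_ihom M') (snd (one_ihom_map M F) t) = fst (one_ihom_map M F) (Cod (one_ihom M) t)"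
      using t c by (auto simp: subset_code(1))
    show "snd (one_ihom_map M F) (Act (one_ihom M) \<sigma> t) = Act (one_ihom M') \<sigma> (snd (one_ihom_map M F) t)"
      if s: "\<sigma> permutes {..<length (Dom (one_ihom M) t)}" for \<sigma>
      using J.Act_type[OF t s] t s c sfunctorsD(7)[OF F c(1), of \<sigma>] by (simp add: permute_list_map)
    show "snd (one_ihom_map M F) (Comp (one_ihom M) t ts) =
        Comp (one_ihom M') (snd (one_ihom_map M F) t) (map (snd (one_ihom_map M F)) ts)"
      if ts: "set ts \<subseteq> Arr (one_ihom M)" "map (Cod (one_ihom M)) ts = Dom (one_ihom M) t" for ts
    proof -
      note c' = one_ihom_components[OF ts t]
      have C: "Comp (one_ihom M) t ts \<in> Arr (one_ihom M)" by (rule one_ihom_Comp_Arr[OF t ts])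
      have "snd F (Comp M (component t) (map component ts)) = Comp M' (snd F (component t)) (map (snd F) (map component ts))"
        by (rule sfunctorsD(6)[OF F c(1) c'])
      then show ?thesis
        unfolding ihom_map_simps(2)[OF C] ihom_map_simps(2)[OF t] one_ihom_sel
        unfolding one_ihom_simps(5) comps[OF ts(1)] fst_conv snd_conv
        by (simp add: map_concat)
    qed
  qed
qed

lemma ihom_map_id:
  assumes "symm_multicat M" shows "one_ihom_map M (sfun_id M) = sfun_id (one_ihom M)"
proof -
  interpret symm_multicat M by fact
  interpret J: symm_multicat "one_ihom M" by (rule symm_multicat_one_ihom)
  note c = one_ihom_type
  show ?thesis
  proof (rule sfunctors_eqI[OF ihom_map_sfunctors[OF assms sfun_id_sfunctors] J.sfun_id_sfunctors])
    fix t assume t: "t \<in> Arr (one_ihom M)"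
    show "snd (one_ihom_map M (sfun_id M)) t = snd (sfun_id (one_ihom M)) t"
      using t c[OF t] by (intro strans_eqI) (auto simp: sfun_comp_id_left subset_code(1) intro!: map_idI)
  qed (simp add: sfun_comp_id_left)
qed

lemma ihom_map_comp:
  assumes "symm_multicat M" "symm_multicat M'" "symm_multicat M''"
    and F: "F \<in> sfunctors M M'" and F': "F' \<in> sfunctors M' M''"
  shows "one_ihom_map M (sfun_comp M F' F) = sfun_comp (one_ihom M) (one_ihom_map M' F') (one_ihom_map M F)"
proof -
  interpret symm_multicat M by fact
  interpret J: symm_multicat "one_ihom M" by (rule symm_multicat_one_ihom)
  interpret M': symm_multicat M' by fact
  note m = ihom_map_sfunctors[OF assms(2) F]
  note c = one_ihom_type
  have assoc: "sfun_comp one_seq (sfun_comp M F' F) G = sfun_comp one_seq F' (sfun_comp one_seq F G)"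
    if "G \<in> sfunctors one_seq M" for G
    by (rule sfun_comp_assoc[OF that, symmetric])
  show ?thesis
  proof (rule sfunctors_eqI[OF ihom_map_sfunctors[OF assms(3) sfun_comp_sfunctors[OF F F']]
        J.sfun_comp_sfunctors[OF m M'.ihom_map_sfunctors[OF assms(3) F']]])
    fix t assume t: "t \<in> Arr (one_ihom M)"
    have t': "snd (one_ihom_map M F) t \<in> Arr (one_ihom M')" using m t by (rule sfunctorsD(2))
    show "snd (one_ihom_map M (sfun_comp M F' F)) t =
        snd (sfun_comp (one_ihom M) (one_ihom_map M' F') (one_ihom_map M F)) t"
      unfolding snd_sfun_comp[OF t] ihom_map_simps(2)[OF t] ihom_map_simps(2)[OF t'[unfolded ihom_map_simps(2)[OF t]]]
      using c[OF t] by (simp add: assoc subset_code(1))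
  next
    fix G assume G: "G \<in> Obj (one_ihom M)"
    have "fst (one_ihom_map M F) G \<in> Obj (one_ihom M')" using m G by (rule sfunctorsD(1))
    then show "fst (one_ihom_map M (sfun_comp M F' F)) G =
        fst (sfun_comp (one_ihom M) (one_ihom_map M' F') (one_ihom_map M F)) G"
      using G by (simp add: assoc)
  qed
qed

section \<open>Transposition along the counit\<close>

lemma one_ihom_transpose_sfunctors:
  assumes "symm_multicat M" "symm_multicat S" "K \<in> sfunctors S (one_ihom M)"
  shows "one_ihom_transpose S M K \<in> sfunctors S M"
  unfolding one_ihom_transpose_def
  by (rule symm_multicat.sfun_comp_sfunctors[OF assms(2,3) symm_multicat.ihom_eval_sfunctors[OF assms(1)]])

context sequential_structure begin

text \<open>The monoid structure of \<open>fst K A\<close> is forced because \<open>K\<close> preserves the monoid structures.\<close>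

lemma functor_into_one_ihom:
  assumes N: "symm_multicat N" and K: "K \<in> sfunctors M (one_ihom N)" and A: "A \<in> Obj M"
  shows "fst K A = (\<lambda>_. fst (one_ihom_transpose M N K) A,
    \<lambda>w. snd (one_ihom_transpose M N K) (U A (length (fst w))))"
proof -
  interpret N: symm_multicat N by fact
  interpret J: sequential_structure "one_ihom N" N.ihom_monoid
    by (rule N.sequential_structure_one_ihom)
  have KA: "fst K A \<in> sfunctors one_seq N" using sfunctorsD(1)[OF K A] by simp
  have "snd K (U A n) = N.ihom_monoid (fst K A) n" for n
    using J.sfunctor_preserves_monoid[OF cmon_family_axioms K A] .
  then have "snd (fst K A) (un n) = snd (one_ihom_transpose M N K) (U A n)" for n
    using A sfunctorsD(2)[OF K, of "U A n"] by (simp add: one_ihom_transpose_def N.ihom_monoid_def)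
  then have "snd (fst K A) w = snd (one_ihom_transpose M N K) (U A (length (fst w)))" for w
    by (metis un_length)
  moreover have "fst (fst K A) x = fst (one_ihom_transpose M N K) A" for x
    using KA A by (simp add: one_ihom_transpose_def)
  ultimately show ?thesis by (intro prod_eqI ext) simp_all
qed

text \<open>Injectivity: \<open>functor_into_one_ihom\<close> fixes the values on objects, and an
  arrow of the hom is fixed by its single component together with domain and codomain. Surjectivity:
  \<open>L\<close> carries the monoid on each object of \<open>M\<close> to one in \<open>N\<close>,
  and arrows of \<open>M\<close>, being homomorphisms, to homomorphisms.\<close>

lemma bij_betw_one_ihom_transpose:
  assumes N: "symm_multicat N"
  shows "bij_betw (one_ihom_transpose M N) (sfunctors M (one_ihom N)) (sfunctors M N)"
  unfolding bij_betw_def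
proof
  interpret N: symm_multicat N by fact
  interpret J: symm_multicat "one_ihom N" by (rule N.symm_multicat_one_ihom)
  interpret H: cmon_family N "sfunctors one_seq N" "\<lambda>F. fst F ()" "\<lambda>F n. snd F (un n)"
    by (rule N.cmon_family_one_seq)
  note tr = one_ihom_transpose_sfunctors[OF N symm_multicat_axioms]
  show "inj_on (one_ihom_transpose M N) (sfunctors M (one_ihom N))"
  proof (rule inj_onI)
    fix K L assume K: "K \<in> sfunctors M (one_ihom N)" and L: "L \<in> sfunctors M (one_ihom N)"
      and eq: "one_ihom_transpose M N K = one_ihom_transpose M N L"
    have Obj: "fst K A = fst L A" if "A \<in> Obj M" for A
      using functor_into_one_ihom[OF N K that] functor_into_one_ihom[OF N L that] eq by simp
    show "K = L"
    proof (rule sfunctors_eqI[OF K L Obj])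
      fix f assume f: "f \<in> Arr M"
      have "fst (snd K f) = fst (snd L f)" "snd (snd (snd K f)) = snd (snd (snd L f))"
        using sfunctorsD(3,4)[OF K f] sfunctorsD(3,4)[OF L f] Obj in_Dom_Obj[OF f] Cod_Obj[OF f] by auto
      moreover have "component (snd K f) = component (snd L f)"
        using arg_cong[OF eq, of "\<lambda>F. snd F f"] f sfunctorsD(2)[OF K f] sfunctorsD(2)[OF L f]
        by (simp add: one_ihom_transpose_def)
      ultimately show "snd K f = snd L f" by (intro strans_eqI)
    qed
  qed
  show "one_ihom_transpose M N ` sfunctors M (one_ihom N) = sfunctors M N"
  proof (intro equalityI subsetI)
    fix L assume L: "L \<in> sfunctors M N"
    \<comment> \<open>The image under \<open>L\<close> of the monoid on \<open>A\<close>, the only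
      choice left by \<open>functor_into_one_ihom\<close>.\<close>
    define K0 where "K0 A = (\<lambda>_ :: unit. fst L A, \<lambda>w :: unit list \<times> unit. snd L (U A (length (fst w))))" for A
    define K where "K = (\<lambda>A\<in>Obj M. K0 A, \<lambda>f\<in>Arr M. (map K0 (Dom M f), \<lambda>_ :: unit. snd L f, K0 (Cod M f)))"
    have UD: "U A n \<in> Arr M" if "A \<in> Obj M" for A n using that by simp
    \<comment> \<open>The index is the object of \<open>M\<close>, not its image: \<open>L\<close>
      may identify objects whose monoids have different images.\<close>
    interpret L: cmon_family N "Obj M" "fst L" "\<lambda>A n. snd L (U A n)"
    proof (intro cmon_family.intro N.symm_multicat_axioms cmon_family_axioms.intro)
      fix A assume A: "A \<in> Obj M"
      show "Comp N (snd L (U A (length ms))) (map (\<lambda>n. snd L (U A n)) ms) = snd L (U A (sum_list ms))" for ms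
      proof -
        have "Comp N (snd L (U A (length ms))) (map (snd L) (map (U A) ms)) =
            snd L (Comp M (U A (length ms)) (map (U A) ms))"
          by (rule sfunctorsD(6)[OF L, symmetric]) (use A in \<open>auto intro: map_eq_replicate\<close>)
        then show ?thesis using U_Comp[OF A] by (simp add: comp_def)
      qed
      show "Act N \<sigma> (snd L (U A n)) = snd L (U A n)" if "\<sigma> permutes {..<n}" for \<sigma> n
        using sfunctorsD(7)[OF L UD[OF A], of \<sigma> n] U_Act[OF A that] that A by simp
    qed (use L in \<open>auto simp: sfunctorsD U_1[unfolded One_nat_def]\<close>)
    have K0: "K0 A \<in> sfunctors one_seq N" if "A \<in> Obj M" for A
      using L.functor_of_monoid[OF that] by (simp add: K0_def)
    have K0_sel: "fst (K0 A) x = fst L A" "snd (K0 A) (un n) = snd L (U A n)" for A x n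
      by (simp_all add: K0_def)
    have Arr: "(map K0 (Dom M f), \<lambda>_. snd L f, K0 (Cod M f)) \<in> Arr (one_ihom N)" if f: "f \<in> Arr M" for f
    proof -
      have "Comp N (snd L (U (Cod M f) p)) (replicate p (snd L f)) =
          Act N (transpose_perm p (length (Dom M f))) (Comp N (snd L f) (map (\<lambda>A. snd L (U A p)) (Dom M f)))" for p
      proof -
        let ?us = "map (\<lambda>A. U A p) (Dom M f)"
        have us: "set ?us \<subseteq> Arr M" "map (Cod M) ?us = Dom M f"
          using in_Dom_Obj[OF f] by (auto intro!: map_idI)
        have D: "map (Dom M) ?us = map (replicate p) (Dom M f)" using in_Dom_Obj[OF f] by auto
        have T: "transpose_perm p (length (Dom M f)) permutes {..<length (Dom M (Comp M f ?us))}"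
          using permutes_transpose_perm[of p "length (Dom M f)"] Comp_type[OF f us] unfolding D
          by (simp add: length_concat comp_def sum_list_triv mult.commute)
        have "Comp N (snd L (U (Cod M f) p)) (map (snd L) (replicate p f)) = snd L (Comp M (U (Cod M f) p) (replicate p f))"
          by (rule sfunctorsD(6)[OF L, symmetric]) (use f Cod_Obj[OF f] in auto)
        also have "\<dots> = snd L (Act M (transpose_perm p (length (Dom M f))) (Comp M f ?us))"
          using Arr_ishom[OF f] by (simp add: ishom_def)
        also have "\<dots> = Act N (transpose_perm p (length (Dom M f))) (Comp N (snd L f) (map (snd L) ?us))"
          using sfunctorsD(7)[OF L _ T] sfunctorsD(6)[OF L f us] Comp_type[OF f us] by simp
        finally show ?thesis by (simp add: comp_def)
      qed
      then show ?thesis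
        unfolding N.Arr_one_ihom H.ishom_def
        using f L K0 in_Dom_Obj[OF f] Cod_Obj[OF f] by (auto simp: sfunctorsD K0_sel comp_def)
    qed
    have K: "K \<in> sfunctors M (one_ihom N)"
    proof (rule sfunctorsI)
      show "fst K \<in> extensional (Obj M)" "snd K \<in> extensional (Arr M)" by (simp_all add: K_def)
      show "fst K A \<in> Obj (one_ihom N)" "snd K (Idt M A) = Idt (one_ihom N) (fst K A)" if "A \<in> Obj M" for A
        using that K0 Idt_type[OF that] L by (auto simp: K_def K0_sel sfunctorsD)
      fix f assume f: "f \<in> Arr M"
      show "snd K f \<in> Arr (one_ihom N)" "Dom (one_ihom N) (snd K f) = map (fst K) (Dom M f)"
        "Cod (one_ihom N) (snd K f) = fst K (Cod M f)"
        using f Arr[OF f] in_Dom_Obj[OF f] Cod_Obj[OF f] by (auto simp: K_def)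
      show "snd K (Act M \<sigma> f) = Act (one_ihom N) \<sigma> (snd K f)" if s: "\<sigma> permutes {..<length (Dom M f)}" for \<sigma>
        using f s Act_type[OF f s] sfunctorsD(7)[OF L f s] by (simp add: K_def permute_list_map)
      show "snd K (Comp M f gs) = Comp (one_ihom N) (snd K f) (map (snd K) gs)"
        if gs: "set gs \<subseteq> Arr M" "map (Cod M) gs = Dom M f" for gs
      proof -
        have m: "map fst (map (snd K) gs) = map (map K0) (map (Dom M) gs)"
          "map component (map (snd K) gs) = map (snd L) gs"
          using gs(1) by (auto simp: K_def subset_code(1))
        show ?thesis
          unfolding one_ihom_simps(5) m
          using f Comp_type[OF f gs] sfunctorsD(6)[OF L f gs] by (simp add: K_def map_concat)
      qed
    qed
    have "one_ihom_transpose M N K = L"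
    proof (rule sfunctors_eqI[OF tr[OF K] L])
      fix A assume A: "A \<in> Obj M"
      then show "fst (one_ihom_transpose M N K) A = fst L A"
        using K0[OF A] by (simp add: one_ihom_transpose_def K_def K0_sel)
    next
      fix f assume f: "f \<in> Arr M"
      then show "snd (one_ihom_transpose M N K) f = snd L f"
        using Arr[OF f] by (simp add: one_ihom_transpose_def K_def)
    qed
    then show "L \<in> one_ihom_transpose M N ` sfunctors M (one_ihom N)" using K by blast
  qed (use tr in auto)
qed

end

lemma one_ihom_transpose_natural:
  assumes M: "symm_multicat M" and M': "symm_multicat M'"
    and F: "F \<in> sfunctors M M'" and G: "G \<in> sfunctors S' S" and K: "K \<in> sfunctors S (one_ihom M)"
  shows "one_ihom_transpose S' M' (sfun_comp S' (one_ihom_map M F) (sfun_comp S' K G)) =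
    sfun_comp S' F (sfun_comp S' (one_ihom_transpose S M K) G)"
proof -
  note m = symm_multicat.ihom_map_sfunctors[OF M M' F]
  have Obj: "fst (ihom_eval one_seq M' ()) (fst (one_ihom_map M F) (fst K (fst G A))) =
      fst F (fst (ihom_eval one_seq M ()) (fst K (fst G A)))" if "A \<in> Obj S'" for A
  proof -
    have "fst K (fst G A) \<in> Obj (one_ihom M)" using that G K by (auto dest: sfunctorsD(1))
    then show ?thesis using sfunctorsD(1)[OF m, of "fst K (fst G A)"] by simp
  qed
  have Arr: "snd (ihom_eval one_seq M' ()) (snd (one_ihom_map M F) (snd K (snd G f))) =
      snd F (snd (ihom_eval one_seq M ()) (snd K (snd G f)))" if "f \<in> Arr S'" for f
  proof -
    have "snd K (snd G f) \<in> Arr (one_ihom M)" using that G K by (auto dest: sfunctorsD(2))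
    then show ?thesis using sfunctorsD(2)[OF m, of "snd K (snd G f)"] by simp
  qed
  show ?thesis
    using Obj Arr sfunctorsD(1,2)[OF G]
    by (auto simp: one_ihom_transpose_def sfun_comp_def compose_def fun_eq_iff)
qed

section \<open>Presented symmetric multicategories\<close>

lemma twf_TComp_lists:
  assumes "list_all2 (\<lambda>t us. twf P (TComp t us)) ts uss"
  shows "list_all (twf P) (map2 TComp ts uss)" "map (tcod P) (map2 TComp ts uss) = map (tcod P) ts"
    "list_all (twf P) (concat uss)" "map (tcod P) (concat uss) = concat (map (tdom P) ts)"
    "map (tdom P) (map2 TComp ts uss) = map (\<lambda>us. concat (map (tdom P) us)) uss"
  using assms by (induction rule: list_all2_induct) auto

lemma permutes_sum_perm_map:
  assumes "list_all2 (\<lambda>\<sigma> t. \<sigma> permutes {..<length (d t)}) \<sigma>s ts"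
  shows "sum_perm \<sigma>s (map (\<lambda>t. length (d t)) ts) permutes {..<length (concat (map d ts))}"
    and "permute_list (sum_perm \<sigma>s (map (\<lambda>t. length (d t)) ts)) (concat (map d ts)) =
      concat (map2 permute_list \<sigma>s (map d ts))"
  using assms permutes_sum_perm[of \<sigma>s "map (\<lambda>t. length (d t)) ts"] permute_list_sum_perm[of \<sigma>s "map d ts"]
  by (simp_all add: list.rel_map length_concat comp_def)

lemma permutes_block_perm_map:
  assumes "\<sigma> permutes {..<length ts}"
  shows "block_perm \<sigma> (map (\<lambda>t. length (d t)) ts) permutes {..<length (concat (map d ts))}"
    and "permute_list (block_perm \<sigma> (map (\<lambda>t. length (d t)) ts)) (concat (map d ts)) =
      concat (permute_list \<sigma> (map d ts))"
  using assms permutes_block_perm[of \<sigma> "map (\<lambda>t. length (d t)) ts"] permute_list_block_perm[of \<sigma> "map d ts"]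
  by (simp_all add: length_concat comp_def)

text \<open>Relations between terms of equal type are what makes domain and codomain well defined on
  classes.\<close>

locale wf_presentation =
  fixes P :: "('x, 'g) presentation"
  assumes PDom_PObj: "g \<in> PGen P \<Longrightarrow> set (PDom P g) \<subseteq> PObj P"
    and PCod_PObj: "g \<in> PGen P \<Longrightarrow> PCod P g \<in> PObj P"
    and PRel_twf: "(s, t) \<in> PRel P \<Longrightarrow> twf P s \<and> twf P t \<and> tdom P s = tdom P t \<and> tcod P s = tcod P t"
begin

lemma twf_PObj: "twf P t \<Longrightarrow> set (tdom P t) \<subseteq> PObj P \<and> tcod P t \<in> PObj P"
  by (induction t) (auto simp: PDom_PObj PCod_PObj list_all_iff dest: PDom_PObj)

text \<open>For the rules that move a permutation out of a composite, types agree because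
  \<open>block_perm\<close> and \<open>sum_perm\<close> act on the concatenated domains as
  prescribed.\<close>

lemma tcong_twf: "tcong P s t \<Longrightarrow> twf P s \<and> twf P t \<and> tdom P s = tdom P t \<and> tcod P s = tcod P t"
proof (induction rule: tcong.induct)
  case (cong_Comp s ss t ts)
  then have "list_all2 (\<lambda>s t. twf P t \<and> tdom P s = tdom P t \<and> tcod P s = tcod P t) ss ts"
    by (auto elim: list_all2_mono)
  then have "list_all (twf P) ts \<and> map (tdom P) ss = map (tdom P) ts \<and> map (tcod P) ss = map (tcod P) ts"
    by (induction rule: list_all2_induct) auto
  then show ?case using cong_Comp by simp
next
  case (Comp_Idt t)
  then have "list_all (twf P) (map TIdt (tdom P t))" using twf_PObj[of t] by (auto simp: list_all_iff)
  then show ?case using Comp_Idt by (simp add: comp_def)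
next
  case (Idt_Comp t)
  then show ?case using twf_PObj[of t] by simp
next
  case (Comp_assoc s ts uss)
  note l = twf_TComp_lists[OF Comp_assoc(3)]
  have "concat (map (\<lambda>us. concat (map (tdom P) us)) uss) = concat (map (tdom P) (concat uss))"
    by (induction uss) auto
  then show ?case using Comp_assoc l by (simp del: map_map)
next
  case (Act_Act t \<sigma> \<tau>)
  then show ?case using permutes_compose[of \<sigma> _ \<tau>] by (simp add: permute_list_compose)
next
  case (Comp_Act_outer s ts \<sigma>)
  have "length ts = length (tdom P s)" using Comp_Act_outer(1) by (metis length_map twf.simps(3))
  then have s: "\<sigma> permutes {..<length ts}" using Comp_Act_outer by simp
  then show ?case
    using Comp_Act_outer permutes_block_perm_map[OF s, of "tdom P"]
    by (simp add: list_all_iff flip: permute_list_map)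
next
  case (Comp_Act_inner s ts \<sigma>s)
  from Comp_Act_inner(2) have "list_all (twf P) ts \<longrightarrow> list_all (twf P) (map2 TAct \<sigma>s ts)"
    "map (tcod P) (map2 TAct \<sigma>s ts) = map (tcod P) ts"
    "map (tdom P) (map2 TAct \<sigma>s ts) = map2 permute_list \<sigma>s (map (tdom P) ts)"
    by (induction rule: list_all2_induct) auto
  then show ?case
    using Comp_Act_inner permutes_sum_perm_map[OF Comp_Act_inner(2)] by (simp del: map_map)
qed (use PRel_twf in auto)

lemma tclass_eq_iff: "twf P t \<Longrightarrow> tclass P s = tclass P t \<longleftrightarrow> tcong P s t"
  unfolding tclass_def by (blast intro: tcong.refl tcong.sym tcong.trans)

lemma tcong_trep: "twf P t \<Longrightarrow> tcong P t (trep (tclass P t))"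
  unfolding trep_def by (rule someI2[of _ t]) (auto simp: tclass_def intro: tcong.refl)

lemma tclass_eqI: "tcong P s t \<Longrightarrow> tclass P s = tclass P t"
  using tclass_eq_iff tcong_twf by blast

abbreviation Q where "Q \<equiv> presented P"

lemma trep_Arr:
  assumes "c \<in> Arr Q" shows "twf P (trep c)" "tclass P (trep c) = c"
proof -
  obtain t where t: "twf P t" "c = tclass P t" using assms by (auto simp: presented_def)
  then have tr: "tcong P t (trep c)" using tcong_trep by simp
  show "twf P (trep c)" using tcong_twf[OF tr] by blast
  show "tclass P (trep c) = c" using tclass_eqI[OF tr] t(2) by simp
qed

lemma presented_simps:
  "Obj Q = PObj P" "Idt Q x = tclass P (TIdt x)"
  "twf P t \<Longrightarrow> tclass P t \<in> Arr Q"
  "twf P t \<Longrightarrow> Dom Q (tclass P t) = tdom P t"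
  "twf P t \<Longrightarrow> Cod Q (tclass P t) = tcod P t"
  using tcong_twf[OF tcong_trep[of t]] by (auto simp: presented_def)

text \<open>\<open>Comp Q\<close> is defined through chosen representatives;
  \<open>cong_Comp\<close> makes the choice immaterial, so that computations can be done on
  terms.\<close>

lemma Comp_tclass:
  assumes "twf P (TComp t ts)"
  shows "Comp Q (tclass P t) (map (tclass P) ts) = tclass P (TComp t ts)"
proof -
  have "list_all2 (tcong P) ts (map (trep \<circ> tclass P) ts)"
    using assms tcong_trep by (auto simp: list_all2_conv_all_nth list_all_length)
  then have "tcong P (TComp t ts) (TComp (trep (tclass P t)) (map trep (map (tclass P) ts)))"
    using assms tcong_trep by (intro tcong.cong_Comp) auto
  then show ?thesis using tclass_eqI by (auto simp: presented_def)
qed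

lemma Act_tclass:
  assumes "twf P (TAct \<sigma> t)"
  shows "Act Q \<sigma> (tclass P t) = tclass P (TAct \<sigma> t)"
proof -
  have "tcong P (TAct \<sigma> t) (TAct \<sigma> (trep (tclass P t)))"
    using assms tcong_trep by (intro tcong.cong_Act) auto
  then show ?thesis using tclass_eqI by (auto simp: presented_def)
qed

lemma Arr_cases:
  assumes "c \<in> Arr Q" obtains t where "twf P t" "c = tclass P t"
  using trep_Arr[OF assms] by metis

lemma Arr_list_cases:
  assumes "set cs \<subseteq> Arr Q" obtains ts where "list_all (twf P) ts" "cs = map (tclass P) ts"
proof
  show "list_all (twf P) (map trep cs)" "cs = map (tclass P) (map trep cs)"
    using assms trep_Arr by (auto simp: list_all_iff intro!: map_idI[symmetric])
qed

lemma map_Cod_tclass: "list_all (twf P) ts \<Longrightarrow> map (Cod Q) (map (tclass P) ts) = map (tcod P) ts"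
  and map_Dom_tclass: "list_all (twf P) ts \<Longrightarrow> map (Dom Q) (map (tclass P) ts) = map (tdom P) ts"
  by (auto simp: list_all_iff presented_simps)

lemma Comp_cases:
  assumes "f \<in> Arr Q" "set gs \<subseteq> Arr Q" "map (Cod Q) gs = Dom Q f"
  obtains t ts where "twf P (TComp t ts)" "twf P t" "list_all (twf P) ts" "f = tclass P t" "gs = map (tclass P) ts"
    "Comp Q f gs = tclass P (TComp t ts)"
proof -
  obtain t where t: "twf P t" "f = tclass P t" using Arr_cases[OF assms(1)] .
  obtain ts where ts: "list_all (twf P) ts" "gs = map (tclass P) ts" using Arr_list_cases[OF assms(2)] .
  have "twf P (TComp t ts)" using t ts assms(3) map_Cod_tclass[OF ts(1)] by (simp add: presented_simps del: map_map)
  then show ?thesis using that t ts Comp_tclass by blast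
qed

text \<open>Each equational axiom is the rule of \<open>tcong\<close> with the same name, read on
  representatives.\<close>

lemma symm_multicat_presented: "symm_multicat Q"
proof
  fix f assume "f \<in> Arr Q"
  then obtain t where t: "twf P t" "f = tclass P t" by (rule Arr_cases)
  show "set (Dom Q f) \<subseteq> Obj Q" "Cod Q f \<in> Obj Q" using t twf_PObj by (auto simp: presented_simps)
  have Idts: "list_all (twf P) (map TIdt (tdom P t))" "twf P (TIdt (tcod P t))"
    using twf_PObj[OF t(1)] by (auto simp: list_all_iff)
  have "Comp Q f (map (Idt Q) (Dom Q f)) = tclass P (TComp t (map TIdt (tdom P t)))"
    using t Idts Comp_tclass[of t "map TIdt (tdom P t)"] by (simp add: presented_simps(2)[abs_def] presented_simps(4) comp_def)
  then show "Comp Q f (map (Idt Q) (Dom Q f)) = f"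
    using t tclass_eqI[OF tcong.Comp_Idt] by simp
  have "Comp Q (Idt Q (Cod Q f)) [f] = tclass P (TComp (TIdt (tcod P t)) [t])"
    using t Idts Comp_tclass[of "TIdt (tcod P t)" "[t]"] by (simp add: presented_simps)
  then show "Comp Q (Idt Q (Cod Q f)) [f] = f"
    using t tclass_eqI[OF tcong.Idt_Comp] by simp
  have "Act Q id f = tclass P (TAct id t)"
    using t Act_tclass[of id t] by (simp add: permutes_id)
  then show "Act Q id f = f" using t tclass_eqI[OF tcong.Act_id] by simp
  fix \<sigma> assume "\<sigma> permutes {..<length (Dom Q f)}"
  then have s: "\<sigma> permutes {..<length (tdom P t)}" using t by (simp add: presented_simps)
  show "Act Q \<sigma> f \<in> Arr Q \<and> Dom Q (Act Q \<sigma> f) = permute_list \<sigma> (Dom Q f) \<and> Cod Q (Act Q \<sigma> f) = Cod Q f"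
    using t s Act_tclass[of \<sigma> t] presented_simps(3-5)[of "TAct \<sigma> t"] by (simp add: presented_simps)
  fix \<tau> assume "\<tau> permutes {..<length (Dom Q f)}"
  then have t': "\<tau> permutes {..<length (tdom P t)}" using t by (simp add: presented_simps)
  have "Act Q \<sigma> (Act Q \<tau> f) = tclass P (TAct \<sigma> (TAct \<tau> t))"
    using t s t' Act_tclass[of \<tau> t] Act_tclass[of \<sigma> "TAct \<tau> t"] by simp
  also have "\<dots> = tclass P (TAct (\<tau> \<circ> \<sigma>) t)"
    by (rule tclass_eqI[OF tcong.Act_Act[OF t(1) s t']])
  also have "\<dots> = Act Q (\<tau> \<circ> \<sigma>) f"
    using t Act_tclass[of "\<tau> \<circ> \<sigma>" t] permutes_compose[OF s t'] by simp
  finally show "Act Q \<sigma> (Act Q \<tau> f) = Act Q (\<tau> \<circ> \<sigma>) f" .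
next
  fix x assume "x \<in> Obj Q"
  then show "Idt Q x \<in> Arr Q \<and> Dom Q (Idt Q x) = [x] \<and> Cod Q (Idt Q x) = x"
    using presented_simps(3-5)[of "TIdt x"] by (simp add: presented_simps)
next
  fix f gs assume fgs: "f \<in> Arr Q" "set gs \<subseteq> Arr Q" "map (Cod Q) gs = Dom Q f"
  obtain t ts where t: "twf P (TComp t ts)" "twf P t" "list_all (twf P) ts" "f = tclass P t" "gs = map (tclass P) ts"
    and C: "Comp Q f gs = tclass P (TComp t ts)"
    using Comp_cases[OF fgs] .
  have lens: "map (\<lambda>g. length (Dom Q g)) gs = map (\<lambda>t. length (tdom P t)) ts"
    using t by (auto simp: list_all_iff presented_simps)
  show "Comp Q f gs \<in> Arr Q \<and> Dom Q (Comp Q f gs) = concat (map (Dom Q) gs) \<and> Cod Q (Comp Q f gs) = Cod Q f"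
    unfolding C unfolding t(5) map_Dom_tclass[OF t(3)]
    using t(2,4) presented_simps(3-5)[OF t(1)] by (simp add: presented_simps)
  show "Comp Q (Act Q \<sigma> f) (permute_list \<sigma> gs) =
      Act Q (block_perm \<sigma> (map (\<lambda>g. length (Dom Q g)) gs)) (Comp Q f gs)"
    if "\<sigma> permutes {..<length (Dom Q f)}" for \<sigma>
  proof -
    have s: "\<sigma> permutes {..<length (tdom P t)}" using that t by (simp add: presented_simps)
    have l: "length (tdom P t) = length ts" using t(1) by (metis length_map twf.simps(3))
    have wf: "twf P (TComp (TAct \<sigma> t) (permute_list \<sigma> ts)) \<and>
        twf P (TAct (block_perm \<sigma> (map (\<lambda>t. length (tdom P t)) ts)) (TComp t ts))"
      using tcong_twf[OF tcong.Comp_Act_outer[OF t(1) s]] by blast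
    have "Comp Q (Act Q \<sigma> f) (permute_list \<sigma> gs) = tclass P (TComp (TAct \<sigma> t) (permute_list \<sigma> ts))"
      using Comp_tclass[of "TAct \<sigma> t" "permute_list \<sigma> ts"] wf Act_tclass[of \<sigma> t] t s l
      by (simp add: permute_list_map)
    then show ?thesis
      using tclass_eqI[OF tcong.Comp_Act_outer[OF t(1) s]] Act_tclass[OF conjunct2[OF wf]] C lens by simp
  qed
  show "Comp Q f (map2 (Act Q) \<sigma>s gs) =
      Act Q (sum_perm \<sigma>s (map (\<lambda>g. length (Dom Q g)) gs)) (Comp Q f gs)"
    if "list_all2 (\<lambda>\<sigma> g. \<sigma> permutes {..<length (Dom Q g)}) \<sigma>s gs" for \<sigma>s
  proof -
    have s: "list_all2 (\<lambda>\<sigma> t. \<sigma> permutes {..<length (tdom P t)}) \<sigma>s ts"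
      using that t(3,5) by (auto simp: list_all2_conv_all_nth list_all_length presented_simps)
    have wf: "twf P (TComp t (map2 TAct \<sigma>s ts)) \<and>
        twf P (TAct (sum_perm \<sigma>s (map (\<lambda>t. length (tdom P t)) ts)) (TComp t ts))"
      using tcong_twf[OF tcong.Comp_Act_inner[OF t(1) s]] by blast
    have "map2 (Act Q) \<sigma>s gs = map (tclass P) (map2 TAct \<sigma>s ts)"
      using s t(3) unfolding t(5)
      by (intro nth_equalityI) (simp_all add: list_all2_conv_all_nth list_all_length Act_tclass)
    then have "Comp Q f (map2 (Act Q) \<sigma>s gs) = tclass P (TComp t (map2 TAct \<sigma>s ts))"
      using Comp_tclass[OF conjunct1[OF wf]] t(4) by simp
    then show ?thesis
      using tclass_eqI[OF tcong.Comp_Act_inner[OF t(1) s]] Act_tclass[OF conjunct2[OF wf]] C lens by simp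
  qed
  show "Comp Q f (map2 (Comp Q) gs hss) = Comp Q (Comp Q f gs) (concat hss)"
    if hss: "length hss = length gs" "\<forall>hs\<in>set hss. set hs \<subseteq> Arr Q" "map (map (Cod Q)) hss = map (Dom Q) gs" for hss
  proof -
    define uss where "uss = map (map trep) hss"
    have hss_eq: "hss = map (map (tclass P)) uss"
      using hss(2) trep_Arr by (auto simp: uss_def subset_code(1) intro!: map_idI map_idI[symmetric])
    have us: "\<forall>us\<in>set uss. list_all (twf P) us"
      using hss(2) trep_Arr by (auto simp: uss_def list_all_iff)
    have l: "length uss = length ts" using hss(1) t(5) by (simp add: uss_def)
    have tus: "list_all2 (\<lambda>t us. twf P (TComp t us)) ts uss"
    proof (rule list_all2_all_nthI)
      fix k assume k: "k < length ts"
      have "map (tcod P) (uss ! k) = map (Cod Q) (hss ! k)"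
        using map_Cod_tclass[of "uss ! k"] us k l by (simp add: hss_eq)
      also have "\<dots> = tdom P (ts ! k)"
        using arg_cong[OF hss(3), of "\<lambda>xs. xs ! k"] k l t(3,5) hss(1)
        by (simp add: presented_simps list_all_length)
      finally show "twf P (TComp (ts ! k) (uss ! k))" using us k l t(3) by (simp add: list_all_length)
    qed (simp add: l)
    note A = tcong.Comp_assoc[OF t(1) l tus]
    have wf: "twf P (TComp t (map2 TComp ts uss)) \<and> twf P (TComp (TComp t ts) (concat uss))"
      using tcong_twf[OF A] by blast
    have "map2 (Comp Q) gs hss = map (tclass P) (map2 TComp ts uss)"
      using tus l unfolding hss_eq t(5)
      by (intro nth_equalityI) (simp_all add: list_all2_conv_all_nth Comp_tclass del: twf.simps)
    then have "Comp Q f (map2 (Comp Q) gs hss) = tclass P (TComp t (map2 TComp ts uss))"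
      using Comp_tclass[OF conjunct1[OF wf]] t(4) by simp
    also have "\<dots> = tclass P (TComp (TComp t ts) (concat uss))" by (rule tclass_eqI[OF A])
    also have "\<dots> = Comp Q (Comp Q f gs) (concat hss)"
      using Comp_tclass[OF conjunct2[OF wf]] by (simp add: C hss_eq map_concat)
    finally show ?thesis .
  qed
qed

text \<open>Every class is built from generators and identities by operations that functors
  preserve; hence an induction on representing terms.\<close>

lemma presented_sfunctors_eqI:
  assumes F: "F \<in> sfunctors Q N" and G: "G \<in> sfunctors Q N"
    and Obj: "\<And>x. x \<in> PObj P \<Longrightarrow> fst F x = fst G x"
    and Gen: "\<And>g. g \<in> PGen P \<Longrightarrow> snd F (tclass P (TGen g)) = snd G (tclass P (TGen g))"
  shows "F = G"
proof (rule sfunctors_eqI[OF F G])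
  have "twf P t \<Longrightarrow> snd F (tclass P t) = snd G (tclass P t)" for t
  proof (induction t)
    case (TGen g)
    then show ?case using Gen by simp
  next
    case (TIdt x)
    then show ?case
      using sfunctorsD(5)[OF F, of x] sfunctorsD(5)[OF G, of x] Obj by (simp add: presented_simps)
  next
    case (TComp t ts)
    then have wf: "twf P t" "list_all (twf P) ts" "map (tcod P) ts = tdom P t" by simp_all
    have a: "tclass P t \<in> Arr Q" "set (map (tclass P) ts) \<subseteq> Arr Q"
      "map (Cod Q) (map (tclass P) ts) = Dom Q (tclass P t)"
      using wf map_Cod_tclass[OF wf(2)] by (auto simp: presented_simps list_all_iff simp del: map_map)
    have eq: "map (snd F) (map (tclass P) ts) = map (snd G) (map (tclass P) ts)"
      using TComp wf(2) by (auto simp: list_all_iff)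
    show ?case
      using sfunctorsD(6)[OF F a] sfunctorsD(6)[OF G a] TComp(1) wf(1)
      unfolding eq Comp_tclass[OF TComp(3)] by simp
  next
    case (TAct \<sigma> t)
    then show ?case
      using sfunctorsD(7)[OF F, of "tclass P t" \<sigma>] sfunctorsD(7)[OF G, of "tclass P t" \<sigma>] Act_tclass[of \<sigma> t]
      by (simp add: presented_simps)
  qed
  then show "snd F c = snd G c" if "c \<in> Arr Q" for c using Arr_cases[OF that] by metis
qed (simp add: Obj presented_simps)

end

section \<open>Models of a presentation and its universal property\<close>

primrec teval :: "('p, 'b) smulticat \<Rightarrow> ('x \<Rightarrow> 'p) \<Rightarrow> ('g \<Rightarrow> 'b) \<Rightarrow> ('x, 'g) mterm \<Rightarrow> 'b" where
  "teval N v w (TGen g) = w g"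
| "teval N v w (TIdt x) = Idt N (v x)"
| "teval N v w (TComp t ts) = Comp N (teval N v w t) (map (teval N v w) ts)"
| "teval N v w (TAct \<sigma> t) = Act N \<sigma> (teval N v w t)"

locale presentation_model = wf_presentation P + symm_multicat N
  for P :: "('x, 'g) presentation" and N :: "('p, 'b) smulticat" +
  fixes v :: "'x \<Rightarrow> 'p" and w :: "'g \<Rightarrow> 'b"
  assumes v_Obj: "x \<in> PObj P \<Longrightarrow> v x \<in> Obj N"
    and w_type: "g \<in> PGen P \<Longrightarrow> w g \<in> Arr N \<and> Dom N (w g) = map v (PDom P g) \<and> Cod N (w g) = v (PCod P g)"
    and teval_PRel: "(s, t) \<in> PRel P \<Longrightarrow> teval N v w s = teval N v w t"
begin

abbreviation ev where "ev \<equiv> teval N v w"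

lemma teval_type:
  "twf P t \<Longrightarrow> ev t \<in> Arr N \<and> Dom N (ev t) = map v (tdom P t) \<and> Cod N (ev t) = v (tcod P t)"
proof (induction t)
  case (TGen g)
  then show ?case using w_type by simp
next
  case (TIdt x)
  then show ?case using Idt_type v_Obj by simp
next
  case (TComp t ts)
  then have wf: "twf P t" "list_all (twf P) ts" "map (tcod P) ts = tdom P t" by simp_all
  have *: "set (map ev ts) \<subseteq> Arr N" "map (Cod N) (map ev ts) = map v (map (tcod P) ts)"
    "map (Dom N) (map ev ts) = map (map v) (map (tdom P) ts)"
    using TComp(2) wf(2) by (auto simp: list_all_iff)
  show ?case
    using Comp_type[of "ev t" "map ev ts"] TComp(1) * wf by (simp add: map_concat del: map_map)
next
  case (TAct \<sigma> t)
  then show ?case using Act_type[of "ev t" \<sigma>] by (simp add: permute_list_map)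
qed

lemma teval_Comp_premises:
  assumes "twf P (TComp t ts)"
  shows "ev t \<in> Arr N" "set (map ev ts) \<subseteq> Arr N" "map (Cod N) (map ev ts) = Dom N (ev t)"
    "map (\<lambda>g. length (Dom N g)) (map ev ts) = map (\<lambda>t. length (tdom P t)) ts"
proof -
  have wf: "twf P t" "list_all (twf P) ts" "map (tcod P) ts = tdom P t" using assms by simp_all
  show "ev t \<in> Arr N" "set (map ev ts) \<subseteq> Arr N"
    "map (\<lambda>g. length (Dom N g)) (map ev ts) = map (\<lambda>t. length (tdom P t)) ts"
    using wf teval_type by (auto simp: list_all_iff)
  have "map (Cod N) (map ev ts) = map v (map (tcod P) ts)"
    using wf(2) teval_type by (auto simp: list_all_iff)
  then show "map (Cod N) (map ev ts) = Dom N (ev t)" using wf teval_type by simp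
qed

text \<open>Soundness: the given relations hold in \<open>N\<close> by assumption, and the remaining
  equations by the axioms of a symmetric multicategory. Evaluation therefore descends to
  classes.\<close>

lemma tcong_teval: "tcong P s t \<Longrightarrow> ev s = ev t"
proof (induction rule: tcong.induct)
  note N = symm_multicat_axioms
  {
    case (rel s t)
    then show ?case by (rule teval_PRel)
  next
    case (cong_Comp s ss t ts)
    then have "map ev ss = map ev ts"
      by (auto simp: list_all2_conv_all_nth intro!: nth_equalityI)
    then show ?case using cong_Comp by simp
  next
    case (Comp_Idt t)
    then show ?case using teval_type[of t] symm_multicat.Comp_Idt[OF N, of "ev t"] by (simp add: comp_def)
  next
    case (Idt_Comp t)
    then show ?case using teval_type[of t] symm_multicat.Idt_Comp[OF N, of "ev t"] by simp
  next
    case (Comp_assoc s ts uss)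
    note p = teval_Comp_premises[OF Comp_assoc(1)]
    have q: "\<forall>hs\<in>set (map (map ev) uss). set hs \<subseteq> Arr N"
      "map (map (Cod N)) (map (map ev) uss) = map (Dom N) (map ev ts)"
      "map ev (map2 TComp ts uss) = map2 (Comp N) (map ev ts) (map (map ev) uss)"
      using Comp_assoc(3) by (induction rule: list_all2_induct) (use teval_Comp_premises in \<open>auto simp del: twf.simps\<close>)
    show ?case
      using symm_multicat.Comp_assoc[OF N p(1-3) _ q(1,2)] Comp_assoc(2) q(3) by (simp add: map_concat del: map_map)
  next
    case (Act_id t)
    then show ?case using teval_type[of t] symm_multicat.Act_id[OF N] by simp
  next
    case (Act_Act t \<sigma> \<tau>)
    then show ?case using teval_type[of t] symm_multicat.Act_Act[OF N, of "ev t"] by simp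
  next
    case (Comp_Act_outer s ts \<sigma>)
    note p = teval_Comp_premises[OF Comp_Act_outer(1)]
    have l: "length ts = length (tdom P s)" using Comp_Act_outer(1) by (metis length_map twf.simps(3))
    have s: "\<sigma> permutes {..<length (Dom N (ev s))}" "\<sigma> permutes {..<length ts}"
      using Comp_Act_outer teval_type[of s] l by simp_all
    show ?case
      using symm_multicat.Comp_Act_outer[OF N p(1-3) s(1)] s(2) unfolding p(4) by (simp add: permute_list_map)
  next
    case (Comp_Act_inner s ts \<sigma>s)
    note p = teval_Comp_premises[OF Comp_Act_inner(1)]
    have "list_all2 (\<lambda>\<sigma> g. \<sigma> permutes {..<length (Dom N g)}) \<sigma>s (map ev ts)"
      using Comp_Act_inner teval_type by (auto simp: list_all2_conv_all_nth list_all_length)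
    moreover have "map ev (map2 TAct \<sigma>s ts) = map2 (Act N) \<sigma>s (map ev ts)"
      using Comp_Act_inner(2) by (induction rule: list_all2_induct) auto
    ultimately show ?case
      using symm_multicat.Comp_Act_inner[OF N p(1-3)] unfolding p(4) by simp
  }
qed auto

definition lift :: "('x, ('x, 'g) mterm set, 'p, 'b) sfun"
  where "lift = (\<lambda>x\<in>PObj P. v x, \<lambda>c\<in>Arr (presented P). ev (trep c))"

lemma fst_lift: "x \<in> PObj P \<Longrightarrow> fst lift x = v x"
  by (simp add: lift_def)

lemma snd_lift: "twf P t \<Longrightarrow> snd lift (tclass P t) = ev t"
  using tcong_teval[OF tcong_trep] presented_simps(3) by (simp add: lift_def)

lemma lift_sfunctors: "lift \<in> sfunctors (presented P) N"
proof (rule sfunctorsI)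
  show "fst lift \<in> extensional (Obj Q)" "snd lift \<in> extensional (Arr Q)"
    by (simp_all add: lift_def presented_simps)
  show "fst lift x \<in> Obj N" "snd lift (Idt Q x) = Idt N (fst lift x)" if "x \<in> Obj Q" for x
    using that v_Obj fst_lift snd_lift[of "TIdt x"] by (simp_all add: presented_simps)
  fix c assume "c \<in> Arr Q"
  then obtain t where t: "twf P t" "c = tclass P t" by (rule Arr_cases)
  have "map (fst lift) (tdom P t) = map v (tdom P t)" using twf_PObj[OF t(1)] fst_lift by auto
  then show "snd lift c \<in> Arr N" "Dom N (snd lift c) = map (fst lift) (Dom Q c)"
    "Cod N (snd lift c) = fst lift (Cod Q c)"
    using t teval_type[OF t(1)] twf_PObj[OF t(1)] fst_lift by (simp_all add: snd_lift presented_simps)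
  show "snd lift (Act Q \<sigma> c) = Act N \<sigma> (snd lift c)" if "\<sigma> permutes {..<length (Dom Q c)}" for \<sigma>
    using t that Act_tclass[of \<sigma> t] snd_lift[of "TAct \<sigma> t"] by (simp add: snd_lift presented_simps)
  show "snd lift (Comp Q c cs) = Comp N (snd lift c) (map (snd lift) cs)"
    if cs: "set cs \<subseteq> Arr Q" "map (Cod Q) cs = Dom Q c" for cs
  proof -
    obtain s ss where s: "twf P (TComp s ss)" "twf P s" "list_all (twf P) ss" "c = tclass P s"
      "cs = map (tclass P) ss" "Comp Q c cs = tclass P (TComp s ss)"
      using Comp_cases[OF \<open>c \<in> Arr Q\<close> cs] .
    have "map (snd lift) cs = map ev ss" using s(3,5) snd_lift by (auto simp: list_all_iff)
    then show ?thesis using s(2,4) snd_lift[OF s(1)] snd_lift[OF s(2)] unfolding s(6) by simp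
  qed
qed

end

section \<open>Morphisms of presentations\<close>

lemma tdom_map_mterm:
  assumes "\<And>g. g \<in> PGen P \<Longrightarrow> PDom P' (\<gamma> g) = map \<omega> (PDom P g) \<and> PCod P' (\<gamma> g) = \<omega> (PCod P g) \<and> \<gamma> g \<in> PGen P'"
    and "\<And>x. x \<in> PObj P \<Longrightarrow> \<omega> x \<in> PObj P'"
  shows "twf P t \<Longrightarrow> twf P' (map_mterm \<omega> \<gamma> t) \<and> tdom P' (map_mterm \<omega> \<gamma> t) = map \<omega> (tdom P t) \<and>
    tcod P' (map_mterm \<omega> \<gamma> t) = \<omega> (tcod P t)"
proof (induction t)
  case (TComp t ts)
  then have wf: "list_all (twf P) ts" "map (tcod P) ts = tdom P t" by auto
  from wf(1) have "map (tcod P') (map (map_mterm \<omega> \<gamma>) ts) = map \<omega> (map (tcod P) ts)"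
    "map (tdom P') (map (map_mterm \<omega> \<gamma>) ts) = map (map \<omega>) (map (tdom P) ts)"
    "list_all (twf P') (map (map_mterm \<omega> \<gamma>) ts)"
    using TComp(2) by (auto simp: list_all_iff)
  then show ?case using TComp(1,3) wf by (simp add: map_concat del: map_map)
qed (use assms in \<open>auto simp: permute_list_map\<close>)

locale presentation_morphism = wf_presentation P + P': wf_presentation P'
  for P :: "('x, 'g) presentation" and P' :: "('y, 'h) presentation" +
  fixes \<omega> :: "'x \<Rightarrow> 'y" and \<gamma> :: "'g \<Rightarrow> 'h"
  assumes gen: "g \<in> PGen P \<Longrightarrow>
      PDom P' (\<gamma> g) = map \<omega> (PDom P g) \<and> PCod P' (\<gamma> g) = \<omega> (PCod P g) \<and> \<gamma> g \<in> PGen P'"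
    and obj: "x \<in> PObj P \<Longrightarrow> \<omega> x \<in> PObj P'"
    and rel: "(s, t) \<in> PRel P \<Longrightarrow> (map_mterm \<omega> \<gamma> s, map_mterm \<omega> \<gamma> t) \<in> PRel P'"
begin

lemma map_mterm_twf:
  "twf P t \<Longrightarrow> twf P' (map_mterm \<omega> \<gamma> t) \<and> tdom P' (map_mterm \<omega> \<gamma> t) = map \<omega> (tdom P t) \<and>
    tcod P' (map_mterm \<omega> \<gamma> t) = \<omega> (tcod P t)"
  using gen obj by (rule tdom_map_mterm)

lemma teval_tclass:
  "twf P t \<Longrightarrow> teval (presented P') \<omega> (\<lambda>g. tclass P' (TGen (\<gamma> g))) t = tclass P' (map_mterm \<omega> \<gamma> t)"
proof (induction t)
  case (TIdt x)
  then show ?case by (simp add: P'.presented_simps)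
next
  case (TComp t ts)
  then have "map (teval (presented P') \<omega> (\<lambda>g. tclass P' (TGen (\<gamma> g)))) ts = map (tclass P') (map (map_mterm \<omega> \<gamma>) ts)"
    by (auto simp: list_all_iff)
  then show ?case using TComp P'.Comp_tclass map_mterm_twf[OF TComp(3)] by (simp del: map_map)
next
  case (TAct \<sigma> t)
  then show ?case using P'.Act_tclass map_mterm_twf[OF TAct(2)] by simp
qed simp

text \<open>A morphism of presentations is a model of \<open>P\<close> in the multicategory
  presented by \<open>P'\<close>; thus \<open>lift\<close> supplies the induced functor and its
  laws.\<close>

sublocale presentation_model P "presented P'" \<omega> "\<lambda>g. tclass P' (TGen (\<gamma> g))"
proof (intro presentation_model.intro presentation_model_axioms.intro P'.symm_multicat_presented wf_presentation_axioms)
  fix s t assume "(s, t) \<in> PRel P"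
  then show "teval (presented P') \<omega> (\<lambda>g. tclass P' (TGen (\<gamma> g))) s =
      teval (presented P') \<omega> (\<lambda>g. tclass P' (TGen (\<gamma> g))) t"
    using teval_tclass PRel_twf P'.tclass_eqI[OF tcong.rel] rel by simp
next
  fix g assume "g \<in> PGen P"
  then show "tclass P' (TGen (\<gamma> g)) \<in> Arr (presented P') \<and>
      Dom (presented P') (tclass P' (TGen (\<gamma> g))) = map \<omega> (PDom P g) \<and>
      Cod (presented P') (tclass P' (TGen (\<gamma> g))) = \<omega> (PCod P g)"
    using gen P'.presented_simps(3-5)[of "TGen (\<gamma> g)"] by simp
qed (simp add: obj P'.presented_simps)

lemma snd_lift_tclass: "twf P t \<Longrightarrow> snd lift (tclass P t) = tclass P' (map_mterm \<omega> \<gamma> t)"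
  by (simp add: snd_lift teval_tclass)

text \<open>Brings the induced functor into the form of \<open>tensor_map\<close>, which renames the
  symbols of a representative instead of evaluating it.\<close>

lemma lift_eq: "lift = (\<lambda>x\<in>PObj P. \<omega> x, \<lambda>c\<in>Arr (presented P). tclass P' (map_mterm \<omega> \<gamma> (trep c)))"
  using trep_Arr(1) by (auto simp: lift_def teval_tclass fun_eq_iff)

end

section \<open>Reflection\<close>

lemma tensor_presentation_simps [simp]:
  "PObj (tensor_presentation M N) = Obj M \<times> Obj N"
  "Inl (f, X) \<in> PGen (tensor_presentation M N) \<longleftrightarrow> f \<in> Arr M \<and> X \<in> Obj N"
  "Inr (A, h) \<in> PGen (tensor_presentation M N) \<longleftrightarrow> A \<in> Obj M \<and> h \<in> Arr N"
  "PDom (tensor_presentation M N) (Inl (f, X)) = map (\<lambda>A. (A, X)) (Dom M f)"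
  "PDom (tensor_presentation M N) (Inr (A, h)) = map (\<lambda>X. (A, X)) (Dom N h)"
  "PCod (tensor_presentation M N) (Inl (f, X)) = (Cod M f, X)"
  "PCod (tensor_presentation M N) (Inr (A, h)) = (A, Cod N h)"
  "PRel (tensor_presentation M N) = tensor_rel M N"
  by (auto simp: tensor_presentation_def)

lemma tensor_gen_cases:
  assumes "g \<in> PGen (tensor_presentation M N)"
  obtains f X where "g = Inl (f, X)" "f \<in> Arr M" "X \<in> Obj N"
    | A h where "g = Inr (A, h)" "A \<in> Obj M" "h \<in> Arr N"
  using assms by (auto simp: tensor_presentation_def)

lemma wf_tensor_presentation:
  assumes M: "symm_multicat M" and N: "symm_multicat N"
  shows "wf_presentation (tensor_presentation M N)"
proof
  interpret M: symm_multicat M by fact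
  interpret N: symm_multicat N by fact
  let ?P = "tensor_presentation M N"
  show "set (PDom ?P g) \<subseteq> PObj ?P" "PCod ?P g \<in> PObj ?P" if "g \<in> PGen ?P" for g
    using that by (cases rule: tensor_gen_cases;
      auto simp: M.in_Dom_Obj N.in_Dom_Obj M.Cod_Obj N.Cod_Obj)+
  fix s t assume "(s, t) \<in> PRel ?P"
  then have "(s, t) \<in> tensor_rel M N" by simp
  then show "twf ?P s \<and> twf ?P t \<and> tdom ?P s = tdom ?P t \<and> tcod ?P s = tcod ?P t"
  proof cases
    case (lgen_Idt A X)
    then show ?thesis using M.Idt_type by simp
  next
    case (lgen_Comp f gs X)
    then have "map (\<lambda>g. (Cod M g, X)) gs = map (\<lambda>A. (A, X)) (Dom M f)"
      by (simp flip: lgen_Comp(5) add: comp_def)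
    then show ?thesis
      using lgen_Comp M.Comp_type[of f gs] by (auto simp: list_all_iff comp_def map_concat)
  next
    case (lgen_Act f \<sigma> X)
    then show ?thesis using M.Act_type[of f \<sigma>] by (simp add: permute_list_map)
  next
    case (rgen_Idt A X)
    then show ?thesis using N.Idt_type by simp
  next
    case (rgen_Comp A h ks)
    then have "map (\<lambda>k. (A, Cod N k)) ks = map (\<lambda>X. (A, X)) (Dom N h)"
      by (simp flip: rgen_Comp(6) add: comp_def)
    then show ?thesis
      using rgen_Comp N.Comp_type[of h ks] by (auto simp: list_all_iff comp_def map_concat)
  next
    case (rgen_Act A h \<sigma>)
    then show ?thesis using N.Act_type[of h \<sigma>] by (simp add: permute_list_map)
  next
    case (interchange f h)
    \<comment> \<open>The left side of the interchange relation groups the pairs by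
      \<open>A\<close>, the composite under \<open>TAct\<close> groups them by
      \<open>X\<close>.\<close>
    have "permute_list (transpose_perm (length (Dom M f)) (length (Dom N h)))
        (concat (map (\<lambda>X. map (\<lambda>A. (A, X)) (Dom M f)) (Dom N h))) =
        concat (map (\<lambda>A. map (\<lambda>X. (A, X)) (Dom N h)) (Dom M f))"
      by (rule permute_list_transpose_perm_lists) simp_all
    then show ?thesis
      using interchange permutes_transpose_perm[of "length (Dom M f)" "length (Dom N h)"]
      by (auto simp: list_all_iff M.in_Dom_Obj N.in_Dom_Obj M.Cod_Obj N.Cod_Obj comp_def
          length_concat sum_list_triv mult.commute)
  qed
qed

text \<open>Every relation is stable under functors in both variables, since these preserve the
  operations it mentions; each rule is carried to the same rule. This is the source of functoriality
  of the tensor product.\<close>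

lemma tensor_rel_map:
  fixes M :: "('o, 'a) smulticat" and N :: "('p, 'b) smulticat"
    and M' :: "('o1, 'a1) smulticat" and N' :: "('p1, 'b1) smulticat"
  assumes M: "symm_multicat M" and N: "symm_multicat N"
    and F: "F \<in> sfunctors M M'" and G: "G \<in> sfunctors N N'"
    and st: "(s, t) \<in> tensor_rel M N"
  defines "m \<equiv> map_mterm (map_prod (fst F) (fst G))
    (map_sum (map_prod (snd F) (fst G)) (map_prod (fst F) (snd G)))"
  shows "(m s, m t) \<in> tensor_rel M' N'"
proof -
  interpret M: symm_multicat M by fact
  interpret N: symm_multicat N by fact
  note D = sfunctorsD(1-7)[OF F] sfunctorsD(1-7)[OF G]
  show ?thesis
    using st
  proof cases
    case (lgen_Idt A X)
    then show ?thesis using tensor_rel.lgen_Idt[of "fst F A" M' "fst G X" N'] by (simp add: m_def D)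
  next
    case (lgen_Comp f gs X)
    have "set (map (snd F) gs) \<subseteq> Arr M'" using lgen_Comp D(2) by auto
    then show ?thesis
      using lgen_Comp tensor_rel.lgen_Comp[of "snd F f" M' "map (snd F) gs" "fst G X" N']
        sfunctors_map_Cod[OF F lgen_Comp(4,5,3)] by (simp add: m_def D comp_def)
  next
    case (lgen_Act f \<sigma> X)
    then show ?thesis using tensor_rel.lgen_Act[of "snd F f" M' \<sigma> "fst G X" N'] by (simp add: m_def D)
  next
    case (rgen_Idt A X)
    then show ?thesis using tensor_rel.rgen_Idt[of "fst F A" M' "fst G X" N'] by (simp add: m_def D)
  next
    case (rgen_Comp A h ks)
    have "set (map (snd G) ks) \<subseteq> Arr N'" using rgen_Comp D(9) by auto
    then show ?thesis
      using rgen_Comp tensor_rel.rgen_Comp[of "fst F A" M' "snd G h" N' "map (snd G) ks"]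
        sfunctors_map_Cod[OF G rgen_Comp(5,6,4)] by (simp add: m_def D comp_def)
  next
    case (rgen_Act A h \<sigma>)
    then show ?thesis using tensor_rel.rgen_Act[of "fst F A" M' "snd G h" N' \<sigma>] by (simp add: m_def D)
  next
    case (interchange f h)
    then show ?thesis using tensor_rel.interchange[of "snd F f" M' "snd G h" N'] by (simp add: m_def D comp_def)
  qed
qed

lemma tensor_simps [simp]: "Obj (tensor M N) = Obj M \<times> Obj N"
  by (simp add: tensor_def presented_def)

lemma symm_multicat_tensor: "symm_multicat M \<Longrightarrow> symm_multicat N \<Longrightarrow> symm_multicat (tensor M N)"
  unfolding tensor_def by (intro wf_presentation.symm_multicat_presented wf_tensor_presentation)

lemma tensor_map:
  assumes MN: "symm_multicat M" "symm_multicat N" "symm_multicat M'" "symm_multicat N'"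
    and F: "F \<in> sfunctors M M'" and G: "G \<in> sfunctors N N'"
  shows "tensor_map M N M' N' F G \<in> sfunctors (tensor M N) (tensor M' N')"
    and "f \<in> Arr M \<Longrightarrow> X \<in> Obj N \<Longrightarrow> snd (tensor_map M N M' N' F G) (tclass (tensor_presentation M N) (lgen f X)) =
      tclass (tensor_presentation M' N') (lgen (snd F f) (fst G X))"
    and "A \<in> Obj M \<Longrightarrow> h \<in> Arr N \<Longrightarrow> snd (tensor_map M N M' N' F G) (tclass (tensor_presentation M N) (rgen A h)) =
      tclass (tensor_presentation M' N') (rgen (fst F A) (snd G h))"
proof -
  let ?\<omega> = "map_prod (fst F) (fst G)" and ?\<gamma> = "map_sum (map_prod (snd F) (fst G)) (map_prod (fst F) (snd G))"
  interpret P: presentation_morphism "tensor_presentation M N" "tensor_presentation M' N'" ?\<omega> ?\<gamma>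
  proof (intro presentation_morphism.intro presentation_morphism_axioms.intro wf_tensor_presentation MN)
    fix g assume "g \<in> PGen (tensor_presentation M N)"
    then show "PDom (tensor_presentation M' N') (?\<gamma> g) = map ?\<omega> (PDom (tensor_presentation M N) g) \<and>
        PCod (tensor_presentation M' N') (?\<gamma> g) = ?\<omega> (PCod (tensor_presentation M N) g) \<and>
        ?\<gamma> g \<in> PGen (tensor_presentation M' N')"
      by (cases rule: tensor_gen_cases) (auto simp: sfunctorsD(1-4)[OF F] sfunctorsD(1-4)[OF G])
  next
    fix x assume "x \<in> PObj (tensor_presentation M N)"
    then show "?\<omega> x \<in> PObj (tensor_presentation M' N')"
      by (auto simp: sfunctorsD(1)[OF F] sfunctorsD(1)[OF G])
  next
    fix s t assume "(s, t) \<in> PRel (tensor_presentation M N)"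
    then show "(map_mterm ?\<omega> ?\<gamma> s, map_mterm ?\<omega> ?\<gamma> t) \<in> PRel (tensor_presentation M' N')"
      using tensor_rel_map[OF MN(1,2) F G] by simp
  qed
  have eq: "tensor_map M N M' N' F G = P.lift"
    unfolding P.lift_eq tensor_map_def tensor_def P.presented_simps(1) ..
  show "tensor_map M N M' N' F G \<in> sfunctors (tensor M N) (tensor M' N')"
    unfolding eq tensor_def by (rule P.lift_sfunctors)
  show "snd (tensor_map M N M' N' F G) (tclass (tensor_presentation M N) (lgen f X)) =
      tclass (tensor_presentation M' N') (lgen (snd F f) (fst G X))" if "f \<in> Arr M" "X \<in> Obj N"
    unfolding eq using P.snd_lift_tclass[of "lgen f X"] that by simp
  show "snd (tensor_map M N M' N' F G) (tclass (tensor_presentation M N) (rgen A h)) =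
      tclass (tensor_presentation M' N') (rgen (fst F A) (snd G h))" if "A \<in> Obj M" "h \<in> Arr N"
    unfolding eq using P.snd_lift_tclass[of "rgen A h"] that by simp
qed

lemma fst_tensor_map [simp]:
  "A \<in> Obj M \<Longrightarrow> X \<in> Obj N \<Longrightarrow> fst (tensor_map M N M' N' F G) (A, X) = (fst F A, fst G X)"
  by (simp add: tensor_map_def)

lemma tensor_sfunctors_eqI:
  assumes MN: "symm_multicat M" "symm_multicat N"
    and H: "H \<in> sfunctors (tensor M N) S" and K: "K \<in> sfunctors (tensor M N) S"
    and "\<And>A X. A \<in> Obj M \<Longrightarrow> X \<in> Obj N \<Longrightarrow> fst H (A, X) = fst K (A, X)"
    and "\<And>f X. f \<in> Arr M \<Longrightarrow> X \<in> Obj N \<Longrightarrow>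
      snd H (tclass (tensor_presentation M N) (lgen f X)) = snd K (tclass (tensor_presentation M N) (lgen f X))"
    and "\<And>A h. A \<in> Obj M \<Longrightarrow> h \<in> Arr N \<Longrightarrow>
      snd H (tclass (tensor_presentation M N) (rgen A h)) = snd K (tclass (tensor_presentation M N) (rgen A h))"
  shows "H = K"
proof (rule wf_presentation.presented_sfunctors_eqI[OF wf_tensor_presentation[OF MN] H[unfolded tensor_def] K[unfolded tensor_def]])
  fix g assume "g \<in> PGen (tensor_presentation M N)"
  then show "snd H (tclass (tensor_presentation M N) (TGen g)) = snd K (tclass (tensor_presentation M N) (TGen g))"
    by (cases rule: tensor_gen_cases) (use assms in auto)
qed (use assms in auto)

lemma tensor_gen_Arr:
  assumes "symm_multicat M" "symm_multicat N"
  shows "f \<in> Arr M \<Longrightarrow> X \<in> Obj N \<Longrightarrow> tclass (tensor_presentation M N) (lgen f X) \<in> Arr (tensor M N)"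
    and "A \<in> Obj M \<Longrightarrow> h \<in> Arr N \<Longrightarrow> tclass (tensor_presentation M N) (rgen A h) \<in> Arr (tensor M N)"
  using wf_presentation.presented_simps(3)[OF wf_tensor_presentation[OF assms], of "lgen f X"]
    wf_presentation.presented_simps(3)[OF wf_tensor_presentation[OF assms], of "rgen A h"]
  by (simp_all add: tensor_def)

lemma tensor_map_id:
  assumes MN: "symm_multicat M" "symm_multicat N"
  shows "tensor_map M N M N (sfun_id M) (sfun_id N) = sfun_id (tensor M N)"
proof -
  interpret M: symm_multicat M by fact
  interpret N: symm_multicat N by fact
  interpret T: symm_multicat "tensor M N" by (rule symm_multicat_tensor[OF MN])
  note t = tensor_map[OF MN MN M.sfun_id_sfunctors N.sfun_id_sfunctors]
  show ?thesis
    by (rule tensor_sfunctors_eqI[OF MN t(1) T.sfun_id_sfunctors])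
      (simp_all add: t(2,3) tensor_gen_Arr[OF MN])
qed

lemma tensor_map_comp:
  assumes MN: "symm_multicat M" "symm_multicat N" and MN': "symm_multicat M'" "symm_multicat N'"
    and MN'': "symm_multicat M''" "symm_multicat N''"
    and F: "F \<in> sfunctors M M'" "F' \<in> sfunctors M' M''" and G: "G \<in> sfunctors N N'" "G' \<in> sfunctors N' N''"
  shows "tensor_map M N M'' N'' (sfun_comp M F' F) (sfun_comp N G' G) =
    sfun_comp (tensor M N) (tensor_map M' N' M'' N'' F' G') (tensor_map M N M' N' F G)"
proof -
  interpret M: symm_multicat M by fact
  interpret N: symm_multicat N by fact
  interpret T: symm_multicat "tensor M N" by (rule symm_multicat_tensor[OF MN])
  note t = tensor_map[OF MN MN' F(1) G(1)] and t' = tensor_map[OF MN' MN'' F(2) G(2)]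
    and t'' = tensor_map[OF MN MN'' M.sfun_comp_sfunctors[OF F] N.sfun_comp_sfunctors[OF G]]
  note D = sfunctorsD(1,2)[OF F(1)] sfunctorsD(1,2)[OF G(1)]
  show ?thesis
    by (rule tensor_sfunctors_eqI[OF MN t''(1) T.sfun_comp_sfunctors[OF t(1) t'(1)]])
      (simp_all add: t(2,3) t'(2,3) t''(2,3) tensor_gen_Arr[OF MN] D)
qed

text \<open>The functor laws are the relations \<open>rgen_Idt\<close>, \<open>rgen_Comp\<close> and
  \<open>rgen_Act\<close>.\<close>

lemma tensor_in:
  assumes MN: "symm_multicat M" "symm_multicat N" and A: "A \<in> Obj M"
  shows "tensor_in M N A \<in> sfunctors N (tensor M N)"
proof -
  interpret N: symm_multicat N by fact
  let ?P = "tensor_presentation M N"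
  interpret P: wf_presentation ?P by (rule wf_tensor_presentation[OF MN])
  have wf: "twf ?P (rgen A h)" if "h \<in> Arr N" for h using that A by simp
  show ?thesis
    unfolding tensor_def
  proof (rule sfunctorsI)
    show "fst (tensor_in M N A) \<in> extensional (Obj N)" "snd (tensor_in M N A) \<in> extensional (Arr N)"
      by (simp_all add: tensor_in_def)
    show "fst (tensor_in M N A) X \<in> Obj P.Q"
      "snd (tensor_in M N A) (Idt N X) = Idt P.Q (fst (tensor_in M N A) X)" if "X \<in> Obj N" for X
      using that A N.Idt_type P.tclass_eqI[OF tcong.rel[of _ _ ?P], simplified, OF tensor_rel.rgen_Idt]
      by (simp_all add: tensor_in_def P.presented_simps)
    fix h assume h: "h \<in> Arr N"
    show "snd (tensor_in M N A) h \<in> Arr P.Q" "Cod P.Q (snd (tensor_in M N A) h) = fst (tensor_in M N A) (Cod N h)"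
      "Dom P.Q (snd (tensor_in M N A) h) = map (fst (tensor_in M N A)) (Dom N h)"
      using h N.Cod_Obj N.in_Dom_Obj[OF h] P.presented_simps(3-5)[OF wf[OF h]] by (simp_all add: tensor_in_def)
    show "snd (tensor_in M N A) (Act N \<sigma> h) = Act P.Q \<sigma> (snd (tensor_in M N A) h)"
      if s: "\<sigma> permutes {..<length (Dom N h)}" for \<sigma>
      using h s A N.Act_type[OF h s] P.Act_tclass[of \<sigma> "rgen A h"]
        P.tclass_eqI[OF tcong.rel[of _ _ ?P], simplified, OF tensor_rel.rgen_Act[OF A h s]]
      by (simp add: tensor_in_def)
    show "snd (tensor_in M N A) (Comp N h ks) = Comp P.Q (snd (tensor_in M N A) h) (map (snd (tensor_in M N A)) ks)"
      if ks: "set ks \<subseteq> Arr N" "map (Cod N) ks = Dom N h" for ks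
    proof -
      have eq: "tclass ?P (rgen A (Comp N h ks)) = tclass ?P (TComp (rgen A h) (map (rgen A) ks))"
        using P.tclass_eqI[OF tcong.rel[of _ _ ?P], simplified, OF tensor_rel.rgen_Comp[OF A h ks]] .
      have "twf ?P (TComp (rgen A h) (map (rgen A) ks))"
        using P.PRel_twf[of "rgen A (Comp N h ks)"] tensor_rel.rgen_Comp[OF A h ks] by (simp del: twf.simps)
      from P.Comp_tclass[OF this]
      have "Comp P.Q (tclass ?P (rgen A h)) (map (\<lambda>k. tclass ?P (rgen A k)) ks) = tclass ?P (rgen A (Comp N h ks))"
        by (simp add: eq comp_def)
      moreover have m: "map (snd (tensor_in M N A)) ks = map (\<lambda>k. tclass ?P (rgen A k)) ks"
        using ks(1) by (auto simp: tensor_in_def)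
      ultimately show ?thesis unfolding m using h N.Comp_type[OF h ks] by (simp add: tensor_in_def)
    qed
  qed
qed

lemma tensor_in_simps [simp]:
  "X \<in> Obj N \<Longrightarrow> fst (tensor_in M N A) X = (A, X)"
  "h \<in> Arr N \<Longrightarrow> snd (tensor_in M N A) h = tclass (tensor_presentation M N) (rgen A h)"
  by (simp_all add: tensor_in_def)

section \<open>Monoid structure on the tensor product\<close>

definition one_tensor_monoid :: "('o, 'a) smulticat \<Rightarrow> unit \<times> 'o \<Rightarrow> nat \<Rightarrow>
    (unit, unit list \<times> unit, 'o, 'a) tensor_term set"
  where "one_tensor_monoid M x n = tclass (tensor_presentation one_seq M) (lgen (un n) (snd x))"

text \<open>The relations for \<open>lgen\<close> make \<open>(-)\<^sub>X\<close> a functor from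
  \<open>1\<^sub>\<triangleright>\<close>, hence a monoid on \<open>((), X)\<close>. In the
  induction on terms, left generators are its operations and fall under \<open>ishom_U\<close>;
  right generators are homomorphisms by the interchange relation at \<open>un p\<close>; identities,
  composites and permutations follow from the closure properties.\<close>

lemma sequential_structure_one_tensor:
  assumes M: "symm_multicat M"
  shows "sequential_structure (one_tensor M) (one_tensor_monoid M)"
proof -
  interpret M: symm_multicat M by fact
  let ?P = "tensor_presentation one_seq M" and ?U = "one_tensor_monoid M"
  interpret P: wf_presentation ?P by (rule wf_tensor_presentation[OF symm_multicat_one_seq M])
  have T: "one_tensor M = P.Q" by (simp add: tensor_def)
  interpret T: symm_multicat P.Q by (rule P.symm_multicat_presented)
  have rel: "tclass ?P s = tclass ?P t \<and> twf ?P s \<and> twf ?P t" if "(s, t) \<in> tensor_rel one_seq M" for s t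
    using P.tclass_eqI[OF tcong.rel] P.PRel_twf that by simp
  have lgen: "tclass ?P (lgen (un n) X) \<in> Arr P.Q" "Dom P.Q (tclass ?P (lgen (un n) X)) = replicate n ((), X)"
    "Cod P.Q (tclass ?P (lgen (un n) X)) = ((), X)" if "X \<in> Obj M" for X n
    using that P.presented_simps(3-5)[of "lgen (un n) X"] by (simp_all add: un_def)
  interpret T: cmon_family P.Q "Obj P.Q" "\<lambda>x. x" ?U
  proof
    fix x assume x: "x \<in> Obj P.Q"
    then obtain X where X: "x = ((), X)" "X \<in> Obj M" by (cases x) (auto simp: P.presented_simps)
    show "x \<in> Obj P.Q" by fact
    show "?U x n \<in> Arr P.Q \<and> Dom P.Q (?U x n) = replicate n x \<and> Cod P.Q (?U x n) = x" for n
      using lgen[OF X(2)] X by (simp add: one_tensor_monoid_def)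
    show "?U x 1 = Idt P.Q x"
      using rel[OF tensor_rel.lgen_Idt[of "()" one_seq X]] X by (simp add: one_tensor_monoid_def P.presented_simps)
    show "Comp P.Q (?U x (length ms)) (map (?U x) ms) = ?U x (sum_list ms)" for ms
    proof -
      have "map (Cod one_seq) (map un ms) = Dom one_seq (un (length ms))" by (rule unit_list_eqI) simp
      from rel[OF tensor_rel.lgen_Comp[OF _ _ this X(2)]]
      show ?thesis
        using P.Comp_tclass[of "lgen (un (length ms)) X" "map (\<lambda>n. lgen (un n) X) ms"] X
        by (simp add: one_tensor_monoid_def[abs_def] comp_def)
    qed
    show "Act P.Q \<sigma> (?U x n) = ?U x n" if "\<sigma> permutes {..<n}" for \<sigma> n
      using rel[OF tensor_rel.lgen_Act[of "un n" one_seq \<sigma> X]] P.Act_tclass[of \<sigma> "lgen (un n) X"] that X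
      by (simp add: one_tensor_monoid_def)
  qed
  have "twf ?P t \<Longrightarrow> T.ishom (tdom ?P t) (tclass ?P t) (tcod ?P t)" for t
  proof (induction t)
    case (TGen g)
    then have "g \<in> PGen ?P" by simp
    then show ?case
    proof (cases rule: tensor_gen_cases)
      case (1 f X)
      obtain n where n: "f = un n" by (rule un_cases)
      have eq: "tdom ?P (TGen g) = replicate n ((), X)" "tclass ?P (TGen g) = ?U ((), X) n"
        "tcod ?P (TGen g) = ((), X)"
        using 1 n by (simp_all add: one_tensor_monoid_def) (simp add: un_def)
      have "((), X) \<in> Obj P.Q" using 1 by (simp add: P.presented_simps)
      then show ?thesis unfolding eq by (rule T.ishom_U)
    next
      case (2 A h)
      have A: "A = ()" by simp
      let ?r = "tclass ?P (rgen () h)" and ?xs = "map (\<lambda>X. ((), X)) (Dom M h)"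
      have wf: "twf ?P (rgen () h)" using 2 by simp
      have "Comp P.Q (?U ((), Cod M h) p) (replicate p ?r) =
          Act P.Q (transpose_perm p (length ?xs)) (Comp P.Q ?r (map (\<lambda>x. ?U x p) ?xs))" for p
      proof -
        let ?l = "TComp (lgen (un p) (Cod M h)) (replicate p (rgen () h))"
        let ?c = "TComp (rgen () h) (map (lgen (un p)) (Dom M h))"
        have m: "map (\<lambda>A. rgen A h) (fst (un p)) = replicate p (rgen () h)" by (simp add: un_def)
        have r: "tclass ?P ?l = tclass ?P (TAct (transpose_perm p (length (Dom M h))) ?c) \<and> twf ?P ?l \<and>
            twf ?P (TAct (transpose_perm p (length (Dom M h))) ?c)"
          using rel[OF tensor_rel.interchange[of "un p" one_seq h M]] 2 unfolding one_seq_simps m length_fst_un by simp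
        then show ?thesis
          using P.Comp_tclass[of "lgen (un p) (Cod M h)" "replicate p (rgen () h)"]
            P.Comp_tclass[of "rgen () h" "map (lgen (un p)) (Dom M h)"]
            P.Act_tclass[of "transpose_perm p (length (Dom M h))" ?c]
          by (simp add: one_tensor_monoid_def comp_def del: twf.simps) (simp add: comp_def)
      qed
      then show ?thesis
        using 2 P.presented_simps(3-5)[OF wf] M.in_Dom_Obj M.Cod_Obj
        unfolding T.ishom_def by (auto simp: P.presented_simps(1))
    qed
  next
    case (TIdt x)
    then show ?case using T.ishom_Idt[of x] by (simp add: P.presented_simps)
  next
    case (TComp t ts)
    then have wf: "twf ?P t" "list_all (twf ?P) ts" "map (tcod ?P) ts = tdom ?P t" by simp_all
    have "T.ishom (concat (map (tdom ?P) ts)) (Comp P.Q (tclass ?P t) (map (tclass ?P) ts)) (tcod ?P t)"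
    proof (rule T.ishom_Comp)
      show "T.ishom (tdom ?P t) (tclass ?P t) (tcod ?P t)" using TComp(1) wf(1) .
      show l: "length (map (tdom ?P) ts) = length (tdom ?P t)" "length (map (tclass ?P) ts) = length (tdom ?P t)"
        unfolding wf(3)[symmetric] by simp_all
      fix k assume "k < length (tdom ?P t)"
      then have k: "k < length ts" using l by simp
      then have "T.ishom (tdom ?P (ts ! k)) (tclass ?P (ts ! k)) (tcod ?P (ts ! k))"
        using TComp(2)[of "ts ! k"] wf(2) by (simp add: list_all_length)
      then show "T.ishom (map (tdom ?P) ts ! k) (map (tclass ?P) ts ! k) (tdom ?P t ! k)"
        unfolding wf(3)[symmetric] using k by simp
    qed
    then show ?case using P.Comp_tclass[OF TComp(3)] by simp
  next
    case (TAct \<sigma> t)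
    then show ?case using T.ishom_Act[of "tdom ?P t" "tclass ?P t" "tcod ?P t" \<sigma>] P.Act_tclass[of \<sigma> t] by simp
  qed
  then have "T.ishom (Dom P.Q c) c (Cod P.Q c)" if "c \<in> Arr P.Q" for c
    using P.Arr_cases[OF that] P.presented_simps(4,5) by metis
  then show ?thesis unfolding T by unfold_locales
qed

section \<open>Transposition along the unit\<close>

lemma one_tensor_transpose_sfunctors:
  assumes "symm_multicat M" "H \<in> sfunctors (one_tensor M) S"
  shows "one_tensor_transpose M H \<in> sfunctors M S"
  unfolding one_tensor_transpose_def
  using symm_multicat.sfun_comp_sfunctors[OF assms(1) tensor_in[OF symm_multicat_one_seq assms(1)] assms(2)] by simp

context sequential_structure begin

text \<open>Injectivity: the transpose records the values on right generators, while left generators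
  are monoid operations, whose images depend only on the image of the object
  (\<open>sfunctor_preserves_monoid\<close>). Surjectivity: a functor \<open>K\<close> and the
  monoids of \<open>M\<close> form a model of the presentation.\<close>

lemma bij_betw_one_tensor_transpose:
  fixes N :: "('d, 'e) smulticat"
  assumes N: "symm_multicat N"
  shows "bij_betw (one_tensor_transpose N) (sfunctors (one_tensor N) M) (sfunctors N M)"
  unfolding bij_betw_def
proof
  interpret N: symm_multicat N by fact
  let ?P = "tensor_presentation one_seq N"
  interpret P: wf_presentation ?P by (rule wf_tensor_presentation[OF symm_multicat_one_seq N])
  interpret T: sequential_structure "one_tensor N" "one_tensor_monoid N"
    by (rule sequential_structure_one_tensor[OF N])
  show "inj_on (one_tensor_transpose N) (sfunctors (one_tensor N) M)"
  proof (rule inj_onI)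
    fix H K assume H: "H \<in> sfunctors (one_tensor N) M" and K: "K \<in> sfunctors (one_tensor N) M"
      and eq: "one_tensor_transpose N H = one_tensor_transpose N K"
    have Obj: "fst H (A, X) = fst K (A, X)" if "X \<in> Obj N" for A X
      using arg_cong[OF eq, of "\<lambda>F. fst F X"] that by (simp add: one_tensor_transpose_def)
    show "H = K"
    proof (rule tensor_sfunctors_eqI[OF symm_multicat_one_seq N H K Obj])
      fix f and X assume X: "X \<in> Obj N"
      obtain n where n: "f = un n" by (rule un_cases)
      have "((), X) \<in> Obj (one_tensor N)" using X by simp
      from sfunctor_preserves_monoid[OF T.cmon_family_axioms H this, of n]
        sfunctor_preserves_monoid[OF T.cmon_family_axioms K this, of n]
      show "snd H (tclass ?P (lgen f X)) = snd K (tclass ?P (lgen f X))"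
        using Obj[OF X] by (simp add: one_tensor_monoid_def n)
    next
      fix A h assume "h \<in> Arr N"
      then show "snd H (tclass ?P (rgen A h)) = snd K (tclass ?P (rgen A h))"
        using arg_cong[OF eq, of "\<lambda>F. snd F h"] by (simp add: one_tensor_transpose_def)
    qed
  qed
  show "one_tensor_transpose N ` sfunctors (one_tensor N) M = sfunctors N M"
  proof (intro equalityI subsetI)
    fix K assume K: "K \<in> sfunctors N M"
    note D = sfunctorsD[OF K]
    let ?v = "\<lambda>x :: unit \<times> 'd. fst K (snd x)"
    \<comment> \<open>Left generators must go to the operations on \<open>fst K X\<close>, since
      every functor into \<open>M\<close> preserves monoids; right generators take their values
      under \<open>K\<close>.\<close>
    let ?w = "case_sum (\<lambda>(f :: unit list \<times> unit, X). U (fst K X) (length (fst f))) (\<lambda>(A :: unit, h). snd K h)"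
    interpret L: presentation_model ?P M ?v ?w
    proof (intro presentation_model.intro presentation_model_axioms.intro P.wf_presentation_axioms symm_multicat_axioms)
      fix x assume "x \<in> PObj ?P"
      then show "?v x \<in> Obj M" using D(1) by auto
    next
      fix g assume "g \<in> PGen ?P"
      then show "?w g \<in> Arr M \<and> Dom M (?w g) = map ?v (PDom ?P g) \<and> Cod M (?w g) = ?v (PCod ?P g)"
        by (cases rule: tensor_gen_cases) (auto simp: D comp_def map_replicate_const)
    next
      fix s t assume "(s, t) \<in> PRel ?P"
      then have "(s, t) \<in> tensor_rel one_seq N" by simp
      then show "teval M ?v ?w s = teval M ?v ?w t"
      proof cases
        case (lgen_Idt A X)
        then show ?thesis using U_1[of "fst K X"] D(1) by simp
      next
        case (lgen_Comp f gs X)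
        have l: "length gs = length (fst f)" using lgen_Comp(5) by (metis length_map one_seq_simps(3))
        then show ?thesis
          using lgen_Comp U_Comp[of "fst K X" "map (\<lambda>g. length (fst g)) gs"] D(1)
          by (simp add: Comp_one_seq' comp_def case_prod_unfold)
      next
        case (lgen_Act f \<sigma> X)
        then show ?thesis using U_Act[of "fst K X" \<sigma>] D(1) by simp
      next
        case (rgen_Idt A X)
        then show ?thesis using D(5) by simp
      next
        case (rgen_Comp A h ks)
        then show ?thesis using D(6) by (simp add: comp_def)
      next
        case (rgen_Act A h \<sigma>)
        then show ?thesis using D(7) by simp
      next
        case (interchange f h)
        \<comment> \<open>Evaluated in \<open>M\<close>, the interchange relation is the
          homomorphism law of \<open>snd K h\<close>, which holds because all arrows of
          \<open>M\<close> are homomorphisms.\<close>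
        then have h: "ishom (map (fst K) (Dom N h)) (snd K h) (fst K (Cod N h))"
          using Arr_ishom[of "snd K h"] D(2-4) by simp
        have "map (\<lambda>A. snd K h) (fst f) = replicate (length (fst f)) (snd K h)"
          by (rule map_replicate_const)
        then show ?thesis
          using interchange h by (simp add: ishom_def comp_def)
      qed
    qed
    have H: "L.lift \<in> sfunctors (one_tensor N) M" using L.lift_sfunctors by (simp add: tensor_def)
    have "one_tensor_transpose N L.lift = K"
    proof (rule sfunctors_eqI[OF one_tensor_transpose_sfunctors[OF N H] K])
      fix X assume "X \<in> Obj N"
      then show "fst (one_tensor_transpose N L.lift) X = fst K X"
        by (simp add: one_tensor_transpose_def L.fst_lift)
    next
      fix h assume "h \<in> Arr N"
      then show "snd (one_tensor_transpose N L.lift) h = snd K h"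
        using L.snd_lift[of "rgen () h"] by (simp add: one_tensor_transpose_def)
    qed
    from image_eqI[where f = "one_tensor_transpose N", OF this[symmetric] H]
    show "K \<in> one_tensor_transpose N ` sfunctors (one_tensor N) M" .
  qed (use one_tensor_transpose_sfunctors[OF N] in auto)
qed

end

lemma one_tensor_transpose_natural:
  assumes M: "symm_multicat M" and M': "symm_multicat M'" and F: "F \<in> sfunctors M' M"
  shows "one_tensor_transpose M'
      (sfun_comp (one_tensor M') G (sfun_comp (one_tensor M') H (one_tensor_map M' M F))) =
    sfun_comp M' G (sfun_comp M' (one_tensor_transpose M H) F)"
proof -
  interpret O: symm_multicat one_seq by (rule symm_multicat_one_seq)
  note t = tensor_map[OF symm_multicat_one_seq M' symm_multicat_one_seq M O.sfun_id_sfunctors F]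
  have "tclass (tensor_presentation one_seq M') (rgen () h) \<in> Arr (one_tensor M')" if "h \<in> Arr M'" for h
    using tensor_gen_Arr(2)[OF symm_multicat_one_seq M', of "()" h] that by simp
  then show ?thesis
    using sfunctorsD(1,2)[OF F] t(3)
    by (auto simp: one_tensor_transpose_def sfun_comp_def compose_def fun_eq_iff)
qed

lemma sequential_one_tensor: "symm_multicat M \<Longrightarrow> sequential (one_tensor M)"
  by (rule sequential_structure.sequential[OF sequential_structure_one_tensor])

lemma sequential_one_ihom: "symm_multicat M \<Longrightarrow> sequential (one_ihom M)"
  by (rule sequential_structure.sequential[OF symm_multicat.sequential_structure_one_ihom])

theorem corollary3p10:
  shows
    \<comment> \<open>both constructions take values in Seq\<close>
    "(\<forall>M :: ('o, 'a) smulticat. symm_multicat M \<longrightarrow>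
        sequential (one_tensor M) \<and> sequential (one_ihom M)) \<and>
    \<comment> \<open>both are functors\<close>
     (\<forall>(M :: ('o, 'a) smulticat) (M' :: ('p, 'b) smulticat). \<forall>F\<in>sfunctors M M'.
        symm_multicat M \<longrightarrow> symm_multicat M' \<longrightarrow>
          one_tensor_map M M' F \<in> sfunctors (one_tensor M) (one_tensor M') \<and>
          one_ihom_map M F \<in> sfunctors (one_ihom M) (one_ihom M')) \<and>
     (\<forall>M :: ('o, 'a) smulticat. symm_multicat M \<longrightarrow>
        one_tensor_map M M (sfun_id M) = sfun_id (one_tensor M) \<and>
        one_ihom_map M (sfun_id M) = sfun_id (one_ihom M)) \<and>
     (\<forall>(M :: ('o, 'a) smulticat) (M' :: ('p, 'b) smulticat) (M'' :: ('q, 'e) smulticat).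
        \<forall>F\<in>sfunctors M M'. \<forall>F'\<in>sfunctors M' M''.
        symm_multicat M \<longrightarrow> symm_multicat M' \<longrightarrow> symm_multicat M'' \<longrightarrow>
          one_tensor_map M M'' (sfun_comp M F' F) =
            sfun_comp (one_tensor M) (one_tensor_map M' M'' F') (one_tensor_map M M' F) \<and>
          one_ihom_map M (sfun_comp M F' F) =
            sfun_comp (one_ihom M) (one_ihom_map M' F') (one_ihom_map M F)) \<and>
    \<comment> \<open>left adjointness: natural bijections of hom sets, for sequential S\<close>
     (\<forall>(M :: ('o, 'a) smulticat) (S :: ('s, 'c) smulticat).
        symm_multicat M \<longrightarrow> sequential S \<longrightarrow>
          bij_betw (one_tensor_transpose M) (sfunctors (one_tensor M) S) (sfunctors M S)) \<and>
     (\<forall>(M :: ('o, 'a) smulticat) (M' :: ('p, 'b) smulticat)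
        (S :: ('s, 'c) smulticat) (S' :: ('t, 'd) smulticat).
        \<forall>F\<in>sfunctors M' M. \<forall>G\<in>sfunctors S S'. \<forall>H\<in>sfunctors (one_tensor M) S.
        symm_multicat M \<longrightarrow> symm_multicat M' \<longrightarrow> sequential S \<longrightarrow> sequential S' \<longrightarrow>
          one_tensor_transpose M'
            (sfun_comp (one_tensor M') G (sfun_comp (one_tensor M') H (one_tensor_map M' M F))) =
          sfun_comp M' G (sfun_comp M' (one_tensor_transpose M H) F)) \<and>
    \<comment> \<open>right adjointness: natural bijections of hom sets, for sequential S\<close>
     (\<forall>(M :: ('o, 'a) smulticat) (S :: ('s, 'c) smulticat).
        symm_multicat M \<longrightarrow> sequential S \<longrightarrow>
          bij_betw (one_ihom_transpose S M) (sfunctors S (one_ihom M)) (sfunctors S M)) \<and>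
     (\<forall>(M :: ('o, 'a) smulticat) (M' :: ('p, 'b) smulticat)
        (S :: ('s, 'c) smulticat) (S' :: ('t, 'd) smulticat).
        \<forall>F\<in>sfunctors M M'. \<forall>G\<in>sfunctors S' S. \<forall>K\<in>sfunctors S (one_ihom M).
        symm_multicat M \<longrightarrow> symm_multicat M' \<longrightarrow> sequential S \<longrightarrow> sequential S' \<longrightarrow>
          one_ihom_transpose S' M'
            (sfun_comp S' (one_ihom_map M F) (sfun_comp S' K G)) =
          sfun_comp S' F (sfun_comp S' (one_ihom_transpose S M K) G))"
proof (intro conjI allI ballI impI)
  fix M :: "('o, 'a) smulticat" assume M: "symm_multicat M"
  show "sequential (one_tensor M)" "sequential (one_ihom M)"
    using sequential_one_tensor[OF M] sequential_one_ihom[OF M] .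
  show "one_tensor_map M M (sfun_id M) = sfun_id (one_tensor M)"
    by (rule tensor_map_id[OF symm_multicat_one_seq M])
  show "one_ihom_map M (sfun_id M) = sfun_id (one_ihom M)"
    by (rule ihom_map_id[OF M])
next
  fix M :: "('o, 'a) smulticat" and M' :: "('p, 'b) smulticat" and F
  assume F: "F \<in> sfunctors M M'" and M: "symm_multicat M" and M': "symm_multicat M'"
  show "one_tensor_map M M' F \<in> sfunctors (one_tensor M) (one_tensor M')"
    by (rule tensor_map(1)[OF symm_multicat_one_seq M symm_multicat_one_seq M'
        symm_multicat.sfun_id_sfunctors[OF symm_multicat_one_seq] F])
  show "one_ihom_map M F \<in> sfunctors (one_ihom M) (one_ihom M')"
    by (rule symm_multicat.ihom_map_sfunctors[OF M M' F])
next
  fix M :: "('o, 'a) smulticat" and M' :: "('p, 'b) smulticat" and M'' :: "('q, 'e) smulticat" and F F'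
  assume F: "F \<in> sfunctors M M'" and F': "F' \<in> sfunctors M' M''"
    and M: "symm_multicat M" and M': "symm_multicat M'" and M'': "symm_multicat M''"
  note one = symm_multicat_one_seq symm_multicat.sfun_id_sfunctors[OF symm_multicat_one_seq]
  show "one_tensor_map M M'' (sfun_comp M F' F) =
      sfun_comp (one_tensor M) (one_tensor_map M' M'' F') (one_tensor_map M M' F)"
    using tensor_map_comp[OF one(1) M one(1) M' one(1) M'' one(2,2) F F']
    unfolding sfun_comp_id_left[OF one(2)] .
  show "one_ihom_map M (sfun_comp M F' F) =
      sfun_comp (one_ihom M) (one_ihom_map M' F') (one_ihom_map M F)"
    by (rule ihom_map_comp[OF M M' M'' F F'])
next
  fix M :: "('o, 'a) smulticat" and S :: "('s, 'c) smulticat"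
  assume M: "symm_multicat M" and S: "sequential S"
  \<comment> \<open>Sequentiality of \<open>S\<close> enters both bijections through a compatible
    monoid structure.\<close>
  obtain U where "sequential_structure S U" using sequential_structure_exists[OF S] .
  then interpret sequential_structure S U .
  show "bij_betw (one_tensor_transpose M) (sfunctors (one_tensor M) S) (sfunctors M S)"
    by (rule bij_betw_one_tensor_transpose[OF M])
  show "bij_betw (one_ihom_transpose S M) (sfunctors S (one_ihom M)) (sfunctors S M)"
    by (rule bij_betw_one_ihom_transpose[OF M])
next
  fix M :: "('o, 'a) smulticat" and M' :: "('p, 'b) smulticat"
    and S :: "('s, 'c) smulticat" and S' :: "('t, 'd) smulticat" and F G H
  assume "F \<in> sfunctors M' M" "symm_multicat M" "symm_multicat M'"
  then show "one_tensor_transpose M'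
      (sfun_comp (one_tensor M') G (sfun_comp (one_tensor M') H (one_tensor_map M' M F))) =
      sfun_comp M' G (sfun_comp M' (one_tensor_transpose M H) F)"
    by (intro one_tensor_transpose_natural)
next
  fix M :: "('o, 'a) smulticat" and M' :: "('p, 'b) smulticat"
    and S :: "('s, 'c) smulticat" and S' :: "('t, 'd) smulticat" and F G K
  assume "F \<in> sfunctors M M'" "G \<in> sfunctors S' S" "K \<in> sfunctors S (one_ihom M)"
    "symm_multicat M" "symm_multicat M'"
  then show "one_ihom_transpose S' M' (sfun_comp S' (one_ihom_map M F) (sfun_comp S' K G)) =
      sfun_comp S' F (sfun_comp S' (one_ihom_transpose S M K) G)"
    by (intro one_ihom_transpose_natural)
qed

end
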